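(* Let $n>1$, $0\le s\le n-1$, and let $\gamma=(\gamma_{pi})$ be an admissible $s\times n$ parameter matrix over $\mathbb F$ that is of a reduced form, with associated number $s'$ and indices $k_1<\dots<k_{s'}$. For $k\in\{1,\dots,[n/2]\}$ put $$\alpha_{qk}:=-\sum_{k'=1}^k(\gamma_{q,n-k'+1}-\gamma_{qk'})=-\sum_{k'=k_q}^k(\gamma_{q,n-k'+1}-\gamma_{qk'}),\quad q=1,\dots,s',$$ and $\beta_{qk}:=-\Delta_{qk}/\Delta$, where $\Delta:=\det(\alpha_{q'k_{q''}})_{q',q''=1,\dots,s'}=(-1)^{s'}$ and $\Delta_{qk}$ is the determinant obtained from $\Delta$ by replacing the column $(\alpha_{q'k_q})_{q'=1,\dots,s'}$ by the column $(\alpha_{q'k})_{q'=1,\dots,s'}$. Then a basis of $\mathrm{Inv}(\mathrm{Ad}^*_{\mathrm T_\gamma(n)})$ is formed by the expressions $$|X^{\varkappa,n}_{1,k}|\prod_{q=1}^{s'}|X^{\varkappa_q,n}_{1,k_q}|^{\beta_{qk}},\qquad k\in\{1,\dots,[n/2]\}\setminus\{k_1,\dots,k_{s'}\},$$ $$x_{p0}+\sum_{k=1}^{[n/2]}\frac{(-1)^{k+1}}{|X^{\varkappa,n}_{1,k}|}(\gamma_{pk}-\gamma_{p,k+1})\sum_{k<i<\varkappa}\left|\begin{array}{cc}X^{i,i}_{1,k}&0\\ X^{\varkappa,n}_{1,k}&X^{\varkappa,n}_{i,i}\end{array}\right|,\qquad p=s'+1,\dots,s,$$ where $\varkappa:=n-k+1$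 and $\varkappa_q:=n-k_q+1$.
   Context: $\mathbb F$ is $\mathbb C$ or $\mathbb R$; $[a]$ is the integer part of $a$. An $s\times n$ matrix $\gamma=(\gamma_{pi})$ over $\mathbb F$ is admissible if the diagonal matrices $\Gamma_p=\mathrm{diag}(\gamma_{p1},\dots,\gamma_{pn})$, $p=1,\dots,s$, and the identity matrix are jointly linearly independent (for $s=0$ there is no $\gamma$, and terms with subscript $p$ are omitted). The Lie algebra $\mathfrak t_\gamma(n)$ over $\mathbb F$ has basis $e_{ij}$ ($1\le i<j\le n$), $f_p$ ($1\le p\le s$), and commutation relations $[e_{ij},e_{i'j'}]=\delta_{i'j}e_{ij'}-\delta_{ij'}e_{i'j}$, $[f_p,e_{ij}]=(\gamma_{pi}-\gamma_{pj})e_{ij}$, $[f_p,f_{p'}]=0$; i.e. it is identified with the span of the strictly upper triangular $n\times n$ matrices ($e_{ij}\sim E^n_{ij}$, matrix units) and the $\Gamma_p$ ($f_p\sim\Gamma_p$). It is the Lie algebra of the connected Lie group $\mathrm T_\gamma(n)$ of nonsingular upper triangular matrices $B=(b_{ij})$ for which there are $\varepsilon_1,\dots,\varepsilon_s\in\mathbb F$ with $b_{ii}=\exp(\sum_p\gamma_{pi}\varepsilon_p)$ for all $i$. Reduced form: $\gamma$ is of a reduced form if there are $s'\in\{0,\dots,\min(s,[n/2])\}$ and $1\le k_1<\dots<k_{s'}\le[n/2]$ such that, writing $\varkappa=n-k+1$, $\varkappa_q=n-k_q+1$: for each $q=1,\dots,s'$, $\gamma_{qk}=\gamma_{q\varkappa}$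 for $k<k_q$, $\gamma_{q\varkappa_q}-\gamma_{qk_q}=1$, and $\gamma_{pk_q}=\gamma_{p\varkappa_q}$ for all $p\ne q$ ($1\le p\le s$); and $\gamma_{pk}=\gamma_{p\varkappa}$ for all $p>s'$, $k=1,\dots,[n/2]$. Dual coordinates: $x_{ji}$ ($i<j$) and $x_{p0}$ are the coordinate functions on the dual space $\mathfrak t_\gamma^*(n)$ corresponding to the basis elements $e_{ij}$ and $f_p$ (coordinates with respect to the dual basis; note the reversed order of subscripts). $X$ is the strictly lower triangular $n\times n$ matrix with entries $x_{ij}$ for $i>j$ and zeros elsewhere. For a matrix $A=(a_{ij})$, $A^{i_1,i_2}_{j_1,j_2}$ is the submatrix with rows $i_1,\dots,i_2$ and columns $j_1,\dots,j_2$, and $|A|=\det A$. Invariants: for a connected Lie group $G$ with Lie algebra $\mathfrak g$, the coadjoint action is $\langle\mathrm{Ad}^*_gx,u\rangle=\langle x,\mathrm{Ad}_{g^{-1}}u\rangle$. An invariant of $\mathrm{Ad}^*_G$ on a domain $\Omega\subset\mathfrak g^*$ is a smooth function $F:\Omega\to\mathbb F$ with $F(\mathrm{Ad}^*_gx)=F(x)$ for all $g\in G$, $x\in\Omega$ with $\mathrm{Ad}^*_gx\in\Omega$; $\mathrm{Inv}(\mathrm{Ad}^*_G)$ is the set of such invariants. Here $\Omega$ is a neighborhood of a point of a regular orbit (an orbit of maximal dimension), chosen so that $\mathrm{Ad}^*_G$ acts regularly on $\Omega$. The maximal number of functionally independent invariants is $N_{\mathfrak g}=\dim\mathfrak g-\mathrm{rank}\,\mathrm{Ad}^*_G$,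 with $\mathrm{rank}\,\mathrm{Ad}^*_G$ the dimension of the regular orbits. A basis of $\mathrm{Inv}(\mathrm{Ad}^*_G)$ is a set of $N_{\mathfrak g}$ functionally independent invariants; every invariant is then uniquely a function of them. Domain and power conventions: the expressions are considered where they are defined (those of the second kind where $|X^{\varkappa,n}_{1,k}|\ne0$, $k=1,\dots,[n/2]$). In the complex case with non-integer exponents, a branch of the logarithm is fixed and used for all powers. In the real case, the powers are defined for any exponents only where the determinants being their bases are positive; in general, when an exponent is not an integer or a rational number with odd denominator, the corresponding determinant is replaced by its absolute value.
   Formalization: The neighborhood Ω on which the action is regular is required itself to meet every orbit in a connected set; without this, over the complex numbers a fixed branch of a non-integer power can change value under group elements that wind a minor around zero. *)

theory Defs
  imports
    "HOL-Library.Function_Algebras"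
    "HOL-Analysis.Derivative"
    "HOL-Analysis.Function_Topology"
    "Jordan_Normal_Form.Determinant"
begin

text \<open>
  The scalar field is a type of class \<open>{real_normed_field, banach}\<close>, used only at \<open>real\<close> and
  \<open>complex\<close>. All mathematical indices start at 1, as in \<open>\<gamma> p i\<close> for \<open>p \<in> {1..s}\<close>,
  \<open>i \<in> {1..n}\<close>; entry \<open>(i, j)\<close> of a matrix of type \<open>'a mat\<close> is \<open>A $$ (i - 1, j - 1)\<close>.
\<close>

subsection \<open>The parameter matrix\<close>

text \<open>The linear combination of the diagonal matrices and the identity is written on the diagonal.\<close>

definition admissible :: "nat \<Rightarrow> nat \<Rightarrow> (nat \<Rightarrow> nat \<Rightarrow> 'a::field) \<Rightarrow> bool" where
  "admissible n s \<gamma> \<longleftrightarrow>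
     (\<forall>a c. (\<forall>i\<in>{1..n}. a + (\<Sum>p=1..s. c p * \<gamma> p i) = 0) \<longrightarrow> a = 0 \<and> (\<forall>p\<in>{1..s}. c p = 0))"

definition reduced_form ::
    "nat \<Rightarrow> nat \<Rightarrow> (nat \<Rightarrow> nat \<Rightarrow> 'a::field) \<Rightarrow> nat \<Rightarrow> (nat \<Rightarrow> nat) \<Rightarrow> bool" where
  "reduced_form n s \<gamma> s' ks \<longleftrightarrow>
     s' \<le> min s (n div 2) \<and>
     ks ` {1..s'} \<subseteq> {1..n div 2} \<and> strict_mono_on {1..s'} ks \<and>
     (\<forall>q\<in>{1..s'}.
        (\<forall>k\<in>{1..<ks q}. \<gamma> q k = \<gamma> q (n - k + 1)) \<and>
        \<gamma> q (n - ks q + 1) - \<gamma> q (ks q) = 1 \<and>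
        (\<forall>p\<in>{1..s} - {q}. \<gamma> p (ks q) = \<gamma> p (n - ks q + 1))) \<and>
     (\<forall>p\<in>{s'+1..s}. \<forall>k\<in>{1..n div 2}. \<gamma> p k = \<gamma> p (n - k + 1))"


subsection \<open>The Lie algebra, its dual and the group\<close>

text \<open>
  Both the algebra and its dual are coordinate spaces over the same index set. The index \<open>(j, i)\<close>
  with \<open>i < j\<close> belongs to the basis element \<open>e\<^sub>i\<^sub>j\<close> and the index \<open>(p, 0)\<close> to \<open>f\<^sub>p\<close>, so that
  \<open>x (j, i)\<close> and \<open>x (p, 0)\<close> are the dual coordinates \<open>x\<^sub>j\<^sub>i\<close> and \<open>x\<^sub>p\<^sub>0\<close>.
\<close>

definition basis_idx :: "nat \<Rightarrow> nat \<Rightarrow> (nat \<times> nat) set" where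
  "basis_idx n s = {(j, i). 1 \<le> i \<and> i < j \<and> j \<le> n} \<union> {(p, i). 1 \<le> p \<and> p \<le> s \<and> i = 0}"

definition coord_space :: "nat \<Rightarrow> nat \<Rightarrow> (nat \<times> nat \<Rightarrow> 'a::zero) set" where
  "coord_space n s = {x. \<forall>c. c \<notin> basis_idx n s \<longrightarrow> x c = 0}"

definition unit_coord :: "nat \<times> nat \<Rightarrow> nat \<times> nat \<Rightarrow> 'a::zero_neq_one" where
  "unit_coord c = (\<lambda>d. if d = c then 1 else 0)"

definition pairing ::
    "nat \<Rightarrow> nat \<Rightarrow> (nat \<times> nat \<Rightarrow> 'a::comm_ring_1) \<Rightarrow> (nat \<times> nat \<Rightarrow> 'a) \<Rightarrow> 'a" where
  "pairing n s x u = (\<Sum>c\<in>basis_idx n s. x c * u c)"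

text \<open>The matrix \<open>\<Sum>\<^sub>i\<^sub><\<^sub>j u\<^sub>i\<^sub>j E\<^sub>i\<^sub>j + \<Sum>\<^sub>p u\<^sub>p \<Gamma>\<^sub>p\<close> with which an element of the algebra is identified.\<close>

definition alg_mat ::
    "nat \<Rightarrow> nat \<Rightarrow> (nat \<Rightarrow> nat \<Rightarrow> 'a::comm_ring_1) \<Rightarrow> (nat \<times> nat \<Rightarrow> 'a) \<Rightarrow> 'a mat" where
  "alg_mat n s \<gamma> u = mat n n (\<lambda>(a, b).
     if a < b then u (b + 1, a + 1)
     else if a = b then \<Sum>p=1..s. u (p, 0) * \<gamma> p (a + 1)
     else 0)"

definition tri_group ::
    "nat \<Rightarrow> nat \<Rightarrow> (nat \<Rightarrow> nat \<Rightarrow> 'a::{real_normed_field, banach}) \<Rightarrow> 'a mat set" where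
  "tri_group n s \<gamma> = {B \<in> carrier_mat n n. upper_triangular B \<and>
     (\<exists>\<epsilon>. \<forall>i\<in>{1..n}. B $$ (i - 1, i - 1) = exp (\<Sum>p=1..s. \<gamma> p i * \<epsilon> p))}"

definition mat_inv :: "'a::semiring_1 mat \<Rightarrow> 'a mat" where
  "mat_inv B = (THE C. inverts_mat B C \<and> inverts_mat C B)"

definition Ad ::
    "nat \<Rightarrow> nat \<Rightarrow> (nat \<Rightarrow> nat \<Rightarrow> 'a::comm_ring_1) \<Rightarrow> 'a mat \<Rightarrow> (nat \<times> nat \<Rightarrow> 'a)
       \<Rightarrow> (nat \<times> nat \<Rightarrow> 'a)" where
  "Ad n s \<gamma> B u =
     (THE v. v \<in> coord_space n s \<and> alg_mat n s \<gamma> v = B * alg_mat n s \<gamma> u * mat_inv B)"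

text \<open>
  The coordinates of the functional \<open>u \<mapsto> \<langle>x, Ad\<^bsub>B\<^sup>-\<^sup>1\<^esub> u\<rangle>\<close> are its values on the basis
  elements.
\<close>

definition coad ::
    "nat \<Rightarrow> nat \<Rightarrow> (nat \<Rightarrow> nat \<Rightarrow> 'a::comm_ring_1) \<Rightarrow> 'a mat \<Rightarrow> (nat \<times> nat \<Rightarrow> 'a)
       \<Rightarrow> (nat \<times> nat \<Rightarrow> 'a)" where
  "coad n s \<gamma> B x = (\<lambda>c.
     if c \<in> basis_idx n s then pairing n s x (Ad n s \<gamma> (mat_inv B) (unit_coord c)) else 0)"


subsection \<open>Orbits\<close>

definition orbit ::
    "nat \<Rightarrow> nat \<Rightarrow> (nat \<Rightarrow> nat \<Rightarrow> 'a::{real_normed_field, banach}) \<Rightarrow> (nat \<times> nat \<Rightarrow> 'a)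
       \<Rightarrow> (nat \<times> nat \<Rightarrow> 'a) set" where
  "orbit n s \<gamma> x = (\<lambda>B. coad n s \<gamma> B x) ` tri_group n s \<gamma>"

text \<open>
  The map \<open>group_param\<close> sends the coordinate space onto the group and \<open>0\<close> to the identity, and its
  differential at \<open>0\<close> is \<open>alg_mat\<close>. Hence the velocities at \<open>t = 0\<close> below form the image of the
  differential at the identity of the orbit map \<open>B \<mapsto> Ad\<^sup>*\<^sub>B x\<close>, that is, the tangent
  space at \<open>x\<close> of the (immersed) orbit through \<open>x\<close>.
\<close>

definition group_param ::
    "nat \<Rightarrow> nat \<Rightarrow> (nat \<Rightarrow> nat \<Rightarrow> 'a::{real_normed_field, banach}) \<Rightarrow> (nat \<times> nat \<Rightarrow> 'a)
       \<Rightarrow> 'a mat" where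
  "group_param n s \<gamma> u = mat n n (\<lambda>(a, b).
     if a < b then u (b + 1, a + 1)
     else if a = b then exp (\<Sum>p=1..s. \<gamma> p (a + 1) * u (p, 0))
     else 0)"

definition orbit_tangent ::
    "nat \<Rightarrow> nat \<Rightarrow> (nat \<Rightarrow> nat \<Rightarrow> 'a::{real_normed_field, banach}) \<Rightarrow> (nat \<times> nat \<Rightarrow> 'a)
       \<Rightarrow> (nat \<times> nat \<Rightarrow> 'a) set" where
  "orbit_tangent n s \<gamma> x = {v. \<exists>u\<in>coord_space n s. \<forall>c.
     ((\<lambda>t. coad n s \<gamma> (group_param n s \<gamma> (\<lambda>d. t * u d)) x c) has_field_derivative v c) (at 0)}"

definition fun_scale :: "'a::field \<Rightarrow> ('b \<Rightarrow> 'a) \<Rightarrow> ('b \<Rightarrow> 'a)" where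
  "fun_scale a f = (\<lambda>c. a * f c)"

global_interpretation fun_vs: vector_space "fun_scale :: 'a::field \<Rightarrow> ('b \<Rightarrow> 'a) \<Rightarrow> ('b \<Rightarrow> 'a)"
  defines fun_dim = fun_vs.dim
  by unfold_locales (auto simp: fun_scale_def fun_eq_iff algebra_simps)

definition orbit_dim ::
    "nat \<Rightarrow> nat \<Rightarrow> (nat \<Rightarrow> nat \<Rightarrow> 'a::{real_normed_field, banach}) \<Rightarrow> (nat \<times> nat \<Rightarrow> 'a) \<Rightarrow> nat" where
  "orbit_dim n s \<gamma> x = fun_dim (orbit_tangent n s \<gamma> x)"

definition coad_rank ::
    "nat \<Rightarrow> nat \<Rightarrow> (nat \<Rightarrow> nat \<Rightarrow> 'a::{real_normed_field, banach}) \<Rightarrow> nat" where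
  "coad_rank n s \<gamma> = Max (orbit_dim n s \<gamma> ` coord_space n s)"

text \<open>
  An action is regular if its orbits have the same dimension and every point has arbitrarily small
  neighbourhoods that meet each orbit in a connected set; here \<open>\<Omega>\<close> is taken to be a neighbourhood
  with this property. Without it an element of the group may carry a point of \<open>\<Omega>\<close> back into \<open>\<Omega>\<close>
  after a minor has wound around \<open>0\<close> in the complex plane, which changes the values of
  non-integer powers computed with a fixed branch.
\<close>

definition acts_regularly ::
    "nat \<Rightarrow> nat \<Rightarrow> (nat \<Rightarrow> nat \<Rightarrow> 'a::{real_normed_field, banach}) \<Rightarrow> (nat \<times> nat \<Rightarrow> 'a) set
       \<Rightarrow> bool" where
  "acts_regularly n s \<gamma> \<Omega> \<longleftrightarrow>
     (\<forall>x\<in>\<Omega>. \<forall>y\<in>\<Omega>. orbit_dim n s \<gamma> x = orbit_dim n s \<gamma> y) \<and>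
     (\<forall>x\<in>\<Omega>. connected (orbit n s \<gamma> x \<inter> \<Omega>))"

definition regular_nbhd ::
    "nat \<Rightarrow> nat \<Rightarrow> (nat \<Rightarrow> nat \<Rightarrow> 'a::{real_normed_field, banach}) \<Rightarrow> (nat \<times> nat \<Rightarrow> 'a) set
       \<Rightarrow> bool" where
  "regular_nbhd n s \<gamma> \<Omega> \<longleftrightarrow>
     openin (top_of_set (coord_space n s)) \<Omega> \<and>
     (\<exists>x\<in>\<Omega>. orbit_dim n s \<gamma> x = coad_rank n s \<gamma>) \<and>
     acts_regularly n s \<gamma> \<Omega>"


subsection \<open>Invariants and their bases\<close>

definition partial_deriv ::
    "nat \<times> nat \<Rightarrow> ((nat \<times> nat \<Rightarrow> 'a::real_normed_field) \<Rightarrow> 'a) \<Rightarrow> (nat \<times> nat \<Rightarrow> 'a) \<Rightarrow> 'a" where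
  "partial_deriv c F x = deriv (\<lambda>t. F (x(c := t))) (x c)"

text \<open>
  Smoothness is over the scalar field: \<open>C\<^sup>\<infinity>\<close> over the reals, holomorphic over the complex numbers.
\<close>

primrec Ck_on ::
    "nat \<Rightarrow> nat \<Rightarrow> nat \<Rightarrow> (nat \<times> nat \<Rightarrow> 'a) set \<Rightarrow> ((nat \<times> nat \<Rightarrow> 'a::real_normed_field) \<Rightarrow> 'a)
       \<Rightarrow> bool" where
  "Ck_on 0 n s \<Omega> F \<longleftrightarrow> continuous_on \<Omega> F"
| "Ck_on (Suc m) n s \<Omega> F \<longleftrightarrow> continuous_on \<Omega> F \<and>
     (\<forall>c\<in>basis_idx n s.
        (\<forall>x\<in>\<Omega>. (\<lambda>t. F (x(c := t))) field_differentiable at (x c)) \<and>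
        Ck_on m n s \<Omega> (partial_deriv c F))"

definition smooth_on ::
    "nat \<Rightarrow> nat \<Rightarrow> (nat \<times> nat \<Rightarrow> 'a) set \<Rightarrow> ((nat \<times> nat \<Rightarrow> 'a::real_normed_field) \<Rightarrow> 'a) \<Rightarrow> bool" where
  "smooth_on n s \<Omega> F \<longleftrightarrow> (\<forall>m. Ck_on m n s \<Omega> F)"

definition Inv ::
    "nat \<Rightarrow> nat \<Rightarrow> (nat \<Rightarrow> nat \<Rightarrow> 'a::{real_normed_field, banach}) \<Rightarrow> (nat \<times> nat \<Rightarrow> 'a) set
       \<Rightarrow> ((nat \<times> nat \<Rightarrow> 'a) \<Rightarrow> 'a) set" where
  "Inv n s \<gamma> \<Omega> = {F. smooth_on n s \<Omega> F \<and>
     (\<forall>B\<in>tri_group n s \<gamma>. \<forall>x\<in>\<Omega>. coad n s \<gamma> B x \<in> \<Omega> \<longrightarrow> F (coad n s \<gamma> B x) = F x)}"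

definition indep_diff_at ::
    "nat \<Rightarrow> nat \<Rightarrow> ((nat \<times> nat \<Rightarrow> 'a::real_normed_field) \<Rightarrow> 'a) set \<Rightarrow> (nat \<times> nat \<Rightarrow> 'a) \<Rightarrow> bool" where
  "indep_diff_at n s Fs x \<longleftrightarrow>
     (\<forall>a. (\<forall>c\<in>basis_idx n s. (\<Sum>F\<in>Fs. a F * partial_deriv c F x) = 0) \<longrightarrow> (\<forall>F\<in>Fs. a F = 0))"

text \<open>
  Functional independence requires a Jacobian of full rank on a dense subset, so that there is no
  functional dependence on any nonempty open subset. The Jacobian may degenerate on a nowhere dense
  set, such as the zero set of a minor.
\<close>

definition functionally_independent ::
    "nat \<Rightarrow> nat \<Rightarrow> (nat \<times> nat \<Rightarrow> 'a) set \<Rightarrow> ((nat \<times> nat \<Rightarrow> 'a::real_normed_field) \<Rightarrow> 'a) set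
       \<Rightarrow> bool" where
  "functionally_independent n s \<Omega> Fs \<longleftrightarrow> \<Omega> \<subseteq> closure {x \<in> \<Omega>. indep_diff_at n s Fs x}"

definition Inv_basis ::
    "nat \<Rightarrow> nat \<Rightarrow> (nat \<Rightarrow> nat \<Rightarrow> 'a::{real_normed_field, banach}) \<Rightarrow> (nat \<times> nat \<Rightarrow> 'a) set
       \<Rightarrow> ((nat \<times> nat \<Rightarrow> 'a) \<Rightarrow> 'a) set \<Rightarrow> bool" where
  "Inv_basis n s \<gamma> \<Omega> Fs \<longleftrightarrow>
     finite Fs \<and> card Fs = card (basis_idx n s) - coad_rank n s \<gamma> \<and>
     Fs \<subseteq> Inv n s \<gamma> \<Omega> \<and> functionally_independent n s \<Omega> Fs"


subsection \<open>The expressions\<close>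

definition Xmat :: "nat \<Rightarrow> (nat \<times> nat \<Rightarrow> 'a::zero) \<Rightarrow> 'a mat" where
  "Xmat n x = mat n n (\<lambda>(a, b). if b < a then x (a + 1, b + 1) else 0)"

text \<open>The submatrix of rows \<open>i1, \<dots>, i2\<close> and columns \<open>j1, \<dots>, j2\<close>, counted from 1.\<close>

definition block :: "'a mat \<Rightarrow> nat \<Rightarrow> nat \<Rightarrow> nat \<Rightarrow> nat \<Rightarrow> 'a mat" where
  "block A i1 i2 j1 j2 =
     mat (i2 + 1 - i1) (j2 + 1 - j1) (\<lambda>(a, b). A $$ (i1 + a - 1, j1 + b - 1))"

definition minor :: "nat \<Rightarrow> (nat \<times> nat \<Rightarrow> 'a::comm_ring_1) \<Rightarrow> nat \<Rightarrow> 'a" where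
  "minor n x k = Determinant.det (block (Xmat n x) (n - k + 1) n 1 k)"

definition alpha :: "nat \<Rightarrow> (nat \<Rightarrow> nat \<Rightarrow> 'a::field) \<Rightarrow> nat \<Rightarrow> nat \<Rightarrow> 'a" where
  "alpha n \<gamma> q k = - (\<Sum>k'=1..k. \<gamma> q (n - k' + 1) - \<gamma> q k')"

definition Delta :: "nat \<Rightarrow> (nat \<Rightarrow> nat \<Rightarrow> 'a::field) \<Rightarrow> nat \<Rightarrow> (nat \<Rightarrow> nat) \<Rightarrow> 'a" where
  "Delta n \<gamma> s' ks = Determinant.det (mat s' s' (\<lambda>(a, b). alpha n \<gamma> (a + 1) (ks (b + 1))))"

definition Delta_repl ::
    "nat \<Rightarrow> (nat \<Rightarrow> nat \<Rightarrow> 'a::field) \<Rightarrow> nat \<Rightarrow> (nat \<Rightarrow> nat) \<Rightarrow> nat \<Rightarrow> nat \<Rightarrow> 'a" where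
  "Delta_repl n \<gamma> s' ks q k = Determinant.det
     (mat s' s' (\<lambda>(a, b). alpha n \<gamma> (a + 1) (if b + 1 = q then k else ks (b + 1))))"

definition beta ::
    "nat \<Rightarrow> (nat \<Rightarrow> nat \<Rightarrow> 'a::field) \<Rightarrow> nat \<Rightarrow> (nat \<Rightarrow> nat) \<Rightarrow> nat \<Rightarrow> nat \<Rightarrow> 'a" where
  "beta n \<gamma> s' ks q k = - Delta_repl n \<gamma> s' ks q k / Delta n \<gamma> s' ks"

text \<open>
  Real powers of bases of either sign. For a rational exponent \<open>m / d\<close> with \<open>d\<close> odd (in particular
  for an integer one) the power does not depend on the choice of the fraction; for all other
  exponents the base is replaced by its absolute value.
\<close>

definition real_power :: "real \<Rightarrow> real \<Rightarrow> real" where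
  "real_power a b =
     (if \<exists>(m::int) (d::nat). odd d \<and> b = of_int m / of_nat d
      then THE y. \<exists>(m::int) (d::nat). odd d \<and> b = of_int m / of_nat d \<and> y = root d a powi m
      else \<bar>a\<bar> powr b)"

definition log_branch :: "(complex \<Rightarrow> complex) \<Rightarrow> complex set \<Rightarrow> bool" where
  "log_branch L D \<longleftrightarrow> open D \<and> connected D \<and> continuous_on D L \<and> (\<forall>z\<in>D. exp (L z) = z)"

definition branch_power :: "(complex \<Rightarrow> complex) \<Rightarrow> complex \<Rightarrow> complex \<Rightarrow> complex" where
  "branch_power L z b =
     (if \<exists>m::int. b = of_int m then z powi (THE m. b = of_int m) else exp (b * L z))"

text \<open>
  The pairs (base, exponent) for which a power is admitted. The base \<open>0\<close> is admitted only with
  exponents in \<open>\<nat>\<close>; with other positive exponents the power would not be smooth there.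
\<close>

definition real_power_ok :: "real \<Rightarrow> real \<Rightarrow> bool" where
  "real_power_ok a b \<longleftrightarrow> b \<in> \<nat> \<or> a \<noteq> 0"

definition branch_power_ok :: "complex set \<Rightarrow> complex \<Rightarrow> complex \<Rightarrow> bool" where
  "branch_power_ok D z b \<longleftrightarrow> b \<in> \<nat> \<or> b \<in> \<int> \<and> z \<noteq> 0 \<or> z \<in> D"

definition first_kind ::
    "('a \<Rightarrow> 'a \<Rightarrow> 'a) \<Rightarrow> nat \<Rightarrow> (nat \<Rightarrow> nat \<Rightarrow> 'a::field) \<Rightarrow> nat \<Rightarrow> (nat \<Rightarrow> nat) \<Rightarrow> nat
       \<Rightarrow> (nat \<times> nat \<Rightarrow> 'a) \<Rightarrow> 'a" where
  "first_kind pw n \<gamma> s' ks k x =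
     minor n x k * (\<Prod>q=1..s'. pw (minor n x (ks q)) (beta n \<gamma> s' ks q k))"

definition second_kind ::
    "nat \<Rightarrow> (nat \<Rightarrow> nat \<Rightarrow> 'a::field) \<Rightarrow> nat \<Rightarrow> (nat \<times> nat \<Rightarrow> 'a) \<Rightarrow> 'a" where
  "second_kind n \<gamma> p x = x (p, 0) +
     (\<Sum>k=1..n div 2. (- 1) ^ (k + 1) / minor n x k * (\<gamma> p k - \<gamma> p (k + 1)) *
        (\<Sum>i\<in>{k<..<n - k + 1}. Determinant.det (four_block_mat
           (block (Xmat n x) i i 1 k)           (0\<^sub>m 1 1)
           (block (Xmat n x) (n - k + 1) n 1 k) (block (Xmat n x) (n - k + 1) n i i))))"

definition expr_domain ::
    "('a \<Rightarrow> 'a \<Rightarrow> bool) \<Rightarrow> nat \<Rightarrow> nat \<Rightarrow> (nat \<Rightarrow> nat \<Rightarrow> 'a::field) \<Rightarrow> nat \<Rightarrow> (nat \<Rightarrow> nat)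
       \<Rightarrow> (nat \<times> nat \<Rightarrow> 'a) set" where
  "expr_domain ok n s \<gamma> s' ks = {x.
     (\<forall>k\<in>{1..n div 2} - ks ` {1..s'}. \<forall>q\<in>{1..s'}.
        ok (minor n x (ks q)) (beta n \<gamma> s' ks q k)) \<and>
     (s' < s \<longrightarrow> (\<forall>k\<in>{1..n div 2}. minor n x k \<noteq> 0))}"

end

theory Submission
  imports Defs "HOL-Analysis.Uncountable_Sets" "HOL-Analysis.Complex_Transcendental"
begin

text \<open>
  Let \<open>X\<close> be the strictly lower triangular matrix of a point \<open>x\<close> of the dual. The element \<open>B\<close> of the
  group replaces \<open>X\<close> by the strictly lower part of \<open>B X B\<^sup>-\<^sup>1\<close> and adds \<open>tr (\<Gamma>\<^sub>p B X B\<^sup>-\<^sup>1)\<close> to the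
  coordinate \<open>x\<^sub>p\<^sub>0\<close>. As \<open>B\<close> is upper triangular, the lower left \<open>k \<times> k\<close> minor is multiplied by
  \<open>exp (- \<Sum>\<^sub>p \<epsilon>\<^sub>p \<alpha>\<^sub>p\<^sub>k)\<close>, and the exponents \<open>\<beta>\<^sub>q\<^sub>k\<close> solve the linear system that makes these factors
  cancel. The bordered determinants of the second kind compute, up to sign, the trace of the Schur
  complement of the lower left \<open>k \<times> k\<close> corner. Passing from \<open>X\<close> to \<open>B X B\<^sup>-\<^sup>1\<close> conjugates this Schur
  complement, so discarding the upper part of \<open>B X B\<^sup>-\<^sup>1\<close> changes the trace by middle diagonal entries
  only, and summation by parts over \<open>k\<close> cancels these against the change of \<open>x\<^sub>p\<^sub>0\<close>.

  The differentials of all expressions are independent wherever all minors are nonzero, because the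
  entry \<open>x\<^bsub>\<kappa>k\<^esub>\<close> with \<open>\<kappa> = n - k + 1\<close> occurs in the \<open>k\<close>-th minor with the coefficient \<open>\<plusminus>\<close> the previous minor
  and does not occur in the smaller minors. Such points are dense, and there the differentials
  annihilate the tangent space of the orbit, which bounds the rank of the action from above. An
  explicit point supported on the antidiagonal gives the same bound from below.
\<close>

section \<open>Dimension in coordinate spaces\<close>

text \<open>The obstacle is that \<open>\<Omega>\<close> need not consist of generic points. If
  \<open>s' = s\<close> there are no expressions of the second kind, and a power with exponent in
  \<open>\<nat>\<close> admits the base 0, so minors may vanish inside \<open>\<Omega>\<close>.
  Smoothness and invariance are therefore proved at every point of \<open>\<Omega>\<close>,
  independence only at generic points. Density supplies one generic point of
  \<open>\<Omega>\<close>, and since the orbits have the same dimension at all points of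
  \<open>\<Omega>\<close>, the bound found there is a bound for the rank. The rank is not computed
  in advance: each expression is matched with one coordinate, the corner
  \<open>(n - k + 1, k)\<close> or \<open>(p, 0)\<close>, and the two bounds meet because both
  families have the same size. The real and the complex case share everything except the properties
  of powers, which are collected in the locale \<open>power_function\<close>.\<close>

lemma finite_basis_idx [simp]: "finite (basis_idx n s)"
proof (rule finite_subset)
  show "basis_idx n s \<subseteq> {0..max n s} \<times> {0..n}"
    by (auto simp: basis_idx_def)
qed simp

lemma fun_sum_apply: "(\<Sum>i\<in>I. f i) x = (\<Sum>i\<in>I. f i x)"
  by (induction I rule: infinite_finite_induct) auto

lemma unit_coord_inj: "inj_on (unit_coord :: _ \<Rightarrow> _ \<Rightarrow> 'a::zero_neq_one) A"
  by (rule inj_onI) (metis unit_coord_def zero_neq_one)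

lemma unit_coord_in_coord_space: "c \<in> basis_idx n s \<Longrightarrow> unit_coord c \<in> coord_space n s"
  by (auto simp: coord_space_def unit_coord_def)

lemma coord_spaceD: "x \<in> coord_space n s \<Longrightarrow> c \<notin> basis_idx n s \<Longrightarrow> x c = 0"
  unfolding coord_space_def by blast

lemma coord_space_eq_sum:
  fixes x :: "nat \<times> nat \<Rightarrow> 'a::field"
  assumes "x \<in> coord_space n s"
  shows "x = (\<Sum>c\<in>basis_idx n s. fun_scale (x c) (unit_coord c))"
proof
  fix d
  have "(\<Sum>c\<in>basis_idx n s. fun_scale (x c) (unit_coord c)) d
      = (\<Sum>c\<in>basis_idx n s. if d = c then x c else 0)"
    by (simp add: fun_sum_apply fun_scale_def unit_coord_def if_distrib cong: if_cong)
  also have "\<dots> = x d"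
    using assms by (auto simp: coord_spaceD)
  finally show "x d = (\<Sum>c\<in>basis_idx n s. fun_scale (x c) (unit_coord c)) d" ..
qed

lemma coord_space_subset_span:
  "coord_space n s \<subseteq> fun_vs.span ((unit_coord :: _ \<Rightarrow> _ \<Rightarrow> 'a::field) ` basis_idx n s)"
proof
  fix x :: "nat \<times> nat \<Rightarrow> 'a" assume "x \<in> coord_space n s"
  then show "x \<in> fun_vs.span (unit_coord ` basis_idx n s)"
    by (subst coord_space_eq_sum, assumption) (intro fun_vs.span_sum fun_vs.span_scale fun_vs.span_base imageI)
qed

lemma fun_dim_le_card_basis_idx:
  assumes "T \<subseteq> coord_space n s"
  shows "fun_dim T \<le> card (basis_idx n s)"
proof -
  have "fun_dim T \<le> card ((unit_coord :: _ \<Rightarrow> _ \<Rightarrow> 'a) ` basis_idx n s)"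
    using assms coord_space_subset_span by (intro fun_vs.dim_le_card) auto
  then show ?thesis by (simp add: card_image unit_coord_inj)
qed

text \<open>The coordinates in \<open>C\<close> alone separate the vectors \<open>w c\<close>,
  whatever their other coordinates are. Tangent vectors thus need to be known only on
  \<open>C\<close>.\<close>

lemma card_le_fun_dim:
  fixes w :: "nat \<times> nat \<Rightarrow> nat \<times> nat \<Rightarrow> 'a::field"
  assumes T: "T \<subseteq> coord_space n s" and C: "finite C"
    and w: "\<And>c. c \<in> C \<Longrightarrow> w c \<in> T"
    and dual: "\<And>c d. c \<in> C \<Longrightarrow> d \<in> C \<Longrightarrow> w c d = (if c = d then 1 else 0)"
  shows "card C \<le> fun_dim T"
proof -
  have inj: "inj_on w C"
    by (rule inj_onI) (metis dual zero_neq_one)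
  have indep: "\<not> fun_vs.dependent (w ` C)"
  proof (rule fun_vs.independent_if_scalars_zero)
    show "finite (w ` C)" using C by simp
    fix f x assume 0: "(\<Sum>x\<in>w ` C. fun_scale (f x) x) = 0" and "x \<in> w ` C"
    then obtain d where d: "d \<in> C" "x = w d" by auto
    have "0 = (\<Sum>x\<in>w ` C. fun_scale (f x) x) d" using 0 by simp
    also have "\<dots> = (\<Sum>c\<in>C. f (w c) * w c d)"
      by (simp add: sum.reindex[OF inj] fun_sum_apply fun_scale_def)
    also have "\<dots> = (\<Sum>c\<in>C. if c = d then f (w c) else 0)"
      by (rule sum.cong) (simp_all add: dual d)
    also have "\<dots> = f x" using C d by simp
    finally show "f x = 0" by simp
  qed
  obtain B where B: "B \<subseteq> T" "\<not> fun_vs.dependent B" "T \<subseteq> fun_vs.span B" "card B = fun_dim T"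
    using fun_vs.basis_exists[of T] by blast
  \<comment> \<open>Finiteness has to come first, since \<open>card\<close> is 0 on infinite sets
    and the dimension of \<open>T\<close> is the cardinality of \<open>B\<close>.\<close>
  have "finite B"
    using fun_vs.independent_span_bound[of "unit_coord ` basis_idx n s" B] B T
      coord_space_subset_span[of n s] by auto
  moreover have "w ` C \<subseteq> fun_vs.span B" using w B by auto
  ultimately have "card (w ` C) \<le> card B"
    using indep fun_vs.independent_span_bound by blast
  then show ?thesis using B by (simp add: card_image inj)
qed

text \<open>The functionals are extended by coordinate functionals to a basis of the dual space; the
  remaining coordinates then determine every vector of \<open>T\<close>.\<close>

lemma fun_dim_annihilated:
  fixes \<Lambda> :: "'b \<Rightarrow> nat \<times> nat \<Rightarrow> 'a::field"
  assumes T: "T \<subseteq> coord_space n s" and I: "finite I"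
    and ann: "\<And>i v. i \<in> I \<Longrightarrow> v \<in> T \<Longrightarrow> (\<Sum>c\<in>basis_idx n s. \<Lambda> i c * v c) = 0"
    and indep: "\<And>a. \<forall>c\<in>basis_idx n s. (\<Sum>i\<in>I. a i * \<Lambda> i c) = 0 \<Longrightarrow> \<forall>i\<in>I. a i = 0"
  shows "fun_dim T + card I \<le> card (basis_idx n s)"
proof -
  \<comment> \<open>The values of \<open>\<Lambda> i\<close> outside \<open>basis_idx\<close> are
    arbitrary; cutting them off puts the functionals into the span of the finite set
    \<open>U\<close>.\<close>
  define l where "l i = (\<lambda>c. if c \<in> basis_idx n s then \<Lambda> i c else 0)" for i
  define U where "U = (unit_coord :: _ \<Rightarrow> _ \<Rightarrow> 'a) ` basis_idx n s"
  have finU: "finite U" and cardU: "card U = card (basis_idx n s)"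
    by (simp_all add: U_def card_image unit_coord_inj)
  have inj: "inj_on l I"
  proof (rule inj_onI, rule ccontr)
    fix i j assume ij: "i \<in> I" "j \<in> I" "l i = l j" "i \<noteq> j"
    let ?a = "\<lambda>k. if k = i then 1 else if k = j then - 1 else 0 :: 'a"
    have "(\<Sum>k\<in>I. ?a k * \<Lambda> k c) = 0" if "c \<in> basis_idx n s" for c
    proof -
      have "(\<Sum>k\<in>I. ?a k * \<Lambda> k c) = (\<Sum>k\<in>{i, j}. ?a k * \<Lambda> k c)"
        using I ij by (intro sum.mono_neutral_right) auto
      also have "\<dots> = \<Lambda> i c - \<Lambda> j c" using ij by simp
      also have "\<dots> = 0" using fun_cong[OF ij(3), of c] that by (simp add: l_def)
      finally show ?thesis .
    qed
    then have "\<forall>k\<in>I. ?a k = 0" by (intro indep) blast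
    then have "?a i = 0" using ij by blast
    then show False by simp
  qed
  have ind: "\<not> fun_vs.dependent (l ` I)"
  proof (rule fun_vs.independent_if_scalars_zero)
    show "finite (l ` I)" using I by simp
    fix f x assume 0: "(\<Sum>x\<in>l ` I. fun_scale (f x) x) = 0" and x: "x \<in> l ` I"
    have "(\<Sum>i\<in>I. f (l i) * \<Lambda> i c) = 0" if c: "c \<in> basis_idx n s" for c
    proof -
      have "0 = (\<Sum>x\<in>l ` I. fun_scale (f x) x) c" using 0 by simp
      also have "\<dots> = (\<Sum>i\<in>I. f (l i) * \<Lambda> i c)"
        unfolding sum.reindex[OF inj] fun_sum_apply o_def fun_scale_def using c by (simp add: l_def)
      finally show ?thesis by simp
    qed
    then show "f x = 0" using indep[of "\<lambda>i. f (l i)"] x by blast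
  qed
  have lU: "l ` I \<subseteq> coord_space n s" by (auto simp: l_def coord_space_def)
  obtain B where B: "l ` I \<subseteq> B" "B \<subseteq> l ` I \<union> U" "\<not> fun_vs.dependent B" "l ` I \<union> U \<subseteq> fun_vs.span B"
    using fun_vs.maximal_independent_subset_extend[OF _ ind, of "l ` I \<union> U"] by auto
  have "B \<subseteq> fun_vs.span U"
    using B(2) lU coord_space_subset_span[of n s] fun_vs.span_superset[of U] unfolding U_def by blast
  then have finB: "finite B" and cardB: "card B \<le> card (basis_idx n s)"
    using fun_vs.independent_span_bound[OF finU B(3)] cardU by auto
  \<comment> \<open>The coordinates that complete the functionals to the basis \<open>B\<close>.
    There are at most \<open>card (basis_idx n s) - card I\<close> of them, because \<open>B\<close>
    is independent in the span of \<open>U\<close>.\<close>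
  define E where "E = {e \<in> basis_idx n s. unit_coord e \<in> B - l ` I}"
  have finE: "finite E" by (simp add: E_def)
  have "card E = card ((unit_coord :: _ \<Rightarrow> _ \<Rightarrow> 'a) ` E)" by (simp add: card_image unit_coord_inj)
  also have "\<dots> \<le> card (B - l ` I)" using finB by (intro card_mono) (auto simp: E_def)
  also have "\<dots> = card B - card I" using B(1) I by (simp add: card_Diff_subset card_image inj)
  finally have "card E \<le> card B - card I" .
  moreover have "card I \<le> card B" using B(1) finB by (metis card_image card_mono inj)
  ultimately have cardE: "card E + card I \<le> card (basis_idx n s)" using cardB by linarith
  \<comment> \<open>\<open>Q f\<close>: on \<open>T\<close> the functional \<open>f\<close> is a
    combination of the coordinates in \<open>E\<close>. The given functionals satisfy this because
    they vanish on \<open>T\<close>, and the property passes from \<open>B\<close> to its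
    span.\<close>
  define Q where "Q f \<longleftrightarrow> (\<exists>b. \<forall>v\<in>T. (\<Sum>c\<in>basis_idx n s. f c * v c) = (\<Sum>e\<in>E. b e * v e))"
    for f :: "nat \<times> nat \<Rightarrow> 'a"
  have Qspan: "Q f" if "f \<in> fun_vs.span B" for f
    using that
  proof (rule fun_vs.span_induct)
    show "fun_vs.subspace {f. Q f}"
    proof (rule fun_vs.subspaceI)
      show "0 \<in> {f. Q f}" unfolding Q_def by (auto intro!: exI[of _ "\<lambda>_. 0"])
      fix f g assume "f \<in> {f. Q f}" "g \<in> {f. Q f}"
      then obtain b b' where "\<forall>v\<in>T. (\<Sum>c\<in>basis_idx n s. f c * v c) = (\<Sum>e\<in>E. b e * v e)"
        "\<forall>v\<in>T. (\<Sum>c\<in>basis_idx n s. g c * v c) = (\<Sum>e\<in>E. b' e * v e)"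
        unfolding Q_def by blast
      then show "f + g \<in> {f. Q f}"
        unfolding Q_def by (auto intro!: exI[of _ "\<lambda>e. b e + b' e"] simp: algebra_simps sum.distrib)
    next
      fix a f assume "f \<in> {f. Q f}"
      then obtain b where "\<forall>v\<in>T. (\<Sum>c\<in>basis_idx n s. f c * v c) = (\<Sum>e\<in>E. b e * v e)"
        unfolding Q_def by blast
      then show "fun_scale a f \<in> {f. Q f}"
        unfolding Q_def
        by (auto intro!: exI[of _ "\<lambda>e. a * b e"] simp: fun_scale_def mult.assoc sum_distrib_left[symmetric])
    qed
    fix f assume f: "f \<in> B"
    show "Q f"
    proof (cases "f \<in> l ` I")
      case True
      then obtain i where i: "i \<in> I" "f = l i" by auto
      have "(\<Sum>c\<in>basis_idx n s. f c * v c) = 0" if "v \<in> T" for v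
        using ann[OF i(1) that] by (simp add: i(2) l_def)
      then show ?thesis unfolding Q_def by (auto intro!: exI[of _ "\<lambda>_. 0"])
    next
      case False
      then obtain e where e: "e \<in> E" "f = unit_coord e" using f B(2) by (auto simp: U_def E_def)
      then have "(\<Sum>c\<in>basis_idx n s. f c * v c) = v e" for v :: "nat \<times> nat \<Rightarrow> 'a"
        by (simp add: unit_coord_def E_def if_distrib[of "\<lambda>x. x * _"] cong: if_cong)
      then show ?thesis
        unfolding Q_def using e finE
        by (auto intro!: exI[of _ "\<lambda>d. if d = e then 1 else 0"] simp: if_distrib[of "\<lambda>x. x * _"] cong: if_cong)
    qed
  qed
  have "\<forall>c\<in>basis_idx n s. \<exists>b. \<forall>v\<in>T. v c = (\<Sum>e\<in>E. b e * v e)"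
  proof
    fix c assume c: "c \<in> basis_idx n s"
    then have "Q (unit_coord c)" using B(4) by (intro Qspan) (auto simp: U_def)
    then show "\<exists>b. \<forall>v\<in>T. v c = (\<Sum>e\<in>E. b e * v e)"
      using c by (simp add: Q_def unit_coord_def if_distrib[of "\<lambda>x. x * _"] cong: if_cong)
  qed
  then obtain b where b: "\<And>c v. c \<in> basis_idx n s \<Longrightarrow> v \<in> T \<Longrightarrow> v c = (\<Sum>e\<in>E. b c e * v e)"
    by metis
  define W where "W e = (\<lambda>c. if c \<in> basis_idx n s then b c e else 0)" for e
  have "T \<subseteq> fun_vs.span (W ` E)"
  proof
    fix v assume v: "v \<in> T"
    have "v = (\<Sum>e\<in>E. fun_scale (v e) (W e))"
    proof
      fix c show "v c = (\<Sum>e\<in>E. fun_scale (v e) (W e)) c"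
      proof (cases "c \<in> basis_idx n s")
        case True
        then show ?thesis using b[OF True v] by (simp add: fun_sum_apply fun_scale_def W_def mult.commute)
      next
        case False
        have "v \<in> coord_space n s" using v T by blast
        then show ?thesis using False by (simp add: fun_sum_apply fun_scale_def W_def coord_spaceD)
      qed
    qed
    then show "v \<in> fun_vs.span (W ` E)"
      by (metis (no_types, lifting) fun_vs.span_base fun_vs.span_scale fun_vs.span_sum image_eqI)
  qed
  then have "fun_dim T \<le> card (W ` E)" using finE by (intro fun_vs.dim_le_card) auto
  also have "\<dots> \<le> card E" using finE by (rule card_image_le)
  finally show ?thesis using cardE by linarith
qed

section \<open>An algebra of smooth functions\<close>

text \<open>The derivative of \<open>\<phi>\<close> in the last rule is a multiple of \<open>\<phi> (F x) / F x\<close>, so the class is closed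
  under partial derivatives. The rule covers inverses and all kinds of powers.\<close>

inductive smooth_gen :: "nat \<Rightarrow> nat \<Rightarrow> (nat \<times> nat \<Rightarrow> 'a) set \<Rightarrow> ((nat \<times> nat \<Rightarrow> 'a::real_normed_field) \<Rightarrow> 'a) \<Rightarrow> bool"
  for n s \<Omega> where
  const: "smooth_gen n s \<Omega> (\<lambda>_. a)"
| coord: "c \<in> basis_idx n s \<Longrightarrow> smooth_gen n s \<Omega> (\<lambda>x. x c)"
| add: "smooth_gen n s \<Omega> F \<Longrightarrow> smooth_gen n s \<Omega> G \<Longrightarrow> smooth_gen n s \<Omega> (\<lambda>x. F x + G x)"
| mult: "smooth_gen n s \<Omega> F \<Longrightarrow> smooth_gen n s \<Omega> G \<Longrightarrow> smooth_gen n s \<Omega> (\<lambda>x. F x * G x)"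
| power_comp: "smooth_gen n s \<Omega> F \<Longrightarrow>
    (\<And>x. x \<in> \<Omega> \<Longrightarrow> F x \<noteq> 0 \<and> (\<phi> has_field_derivative b * \<phi> (F x) / F x) (at (F x))) \<Longrightarrow>
    smooth_gen n s \<Omega> (\<lambda>x. \<phi> (F x))"

lemma smooth_gen_inverse:
  assumes "smooth_gen n s \<Omega> F" "\<And>x. x \<in> \<Omega> \<Longrightarrow> F x \<noteq> 0"
  shows "smooth_gen n s \<Omega> (\<lambda>x. inverse (F x))"
proof (rule smooth_gen.power_comp[where b = "-1" and F = F and \<phi> = inverse])
  fix x assume "x \<in> \<Omega>"
  then have "F x \<noteq> 0" using assms by auto
  then show "F x \<noteq> 0 \<and> (inverse has_field_derivative - 1 * inverse (F x) / F x) (at (F x))"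
    by (auto intro!: DERIV_cong[OF DERIV_inverse] simp: divide_inverse)
qed (fact assms)

lemma smooth_gen_sum:
  "(\<And>i. i \<in> I \<Longrightarrow> smooth_gen n s \<Omega> (F i)) \<Longrightarrow> smooth_gen n s \<Omega> (\<lambda>x. \<Sum>i\<in>I. F i x)"
proof (induction I rule: infinite_finite_induct)
  case (insert i I)
  then show ?case using smooth_gen.add[of n s \<Omega> "F i" "\<lambda>x. \<Sum>i\<in>I. F i x"] by simp
qed (simp_all add: smooth_gen.const)

lemma smooth_gen_prod:
  "(\<And>i. i \<in> I \<Longrightarrow> smooth_gen n s \<Omega> (F i)) \<Longrightarrow> smooth_gen n s \<Omega> (\<lambda>x. \<Prod>i\<in>I. F i x)"
proof (induction I rule: infinite_finite_induct)
  case (insert i I)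
  then show ?case using smooth_gen.mult[of n s \<Omega> "F i" "\<lambda>x. \<Prod>i\<in>I. F i x"] by simp
qed (simp_all add: smooth_gen.const)

lemma smooth_gen_power:
  "smooth_gen n s \<Omega> F \<Longrightarrow> smooth_gen n s \<Omega> (\<lambda>x. F x ^ j)"
  using smooth_gen_prod[of "{..<j}" n s \<Omega> "\<lambda>_. F"] by simp

lemma smooth_gen_det:
  assumes A: "\<And>x. A x \<in> carrier_mat k k"
    and e: "\<And>i j. i < k \<Longrightarrow> j < k \<Longrightarrow> smooth_gen n s \<Omega> (\<lambda>x. A x $$ (i, j))"
  shows "smooth_gen n s \<Omega> (\<lambda>x. Determinant.det (A x))"
proof -
  have "smooth_gen n s \<Omega> (\<lambda>x. \<Sum>p\<in>{p. p permutes {0..<k}}. signof p * (\<Prod>i = 0..<k. A x $$ (i, p i)))"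
    by (intro smooth_gen_sum smooth_gen.mult smooth_gen.const smooth_gen_prod e)
      (auto dest: permutes_in_image)
  then show ?thesis by (simp add: det_def'[OF A])
qed

text \<open>Asking for the derivative along every curve makes one notion serve both for partial
  derivatives (coordinate lines) and for orbit curves. The curve need not stay in
  \<open>\<Omega>\<close>, because the rules generating the class use derivatives only at the base
  point.\<close>

definition has_gradient where
  "has_gradient n s \<Omega> F G \<longleftrightarrow>
    (\<forall>x\<in>\<Omega>. \<forall>\<xi> v. \<xi> 0 = x \<longrightarrow>
       (\<forall>c\<in>basis_idx n s. ((\<lambda>t. \<xi> t c) has_field_derivative v c) (at 0)) \<longrightarrow>
       ((\<lambda>t. F (\<xi> t)) has_field_derivative (\<Sum>c\<in>basis_idx n s. G c x * v c)) (at 0))"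

lemma has_gradientD:
  assumes "has_gradient n s \<Omega> F G" "x \<in> \<Omega>" "\<xi> 0 = x"
    and "\<And>c. c \<in> basis_idx n s \<Longrightarrow> ((\<lambda>t. \<xi> t c) has_field_derivative v c) (at 0)"
  shows "((\<lambda>t. F (\<xi> t)) has_field_derivative (\<Sum>c\<in>basis_idx n s. G c x * v c)) (at 0)"
  using assms(1)[unfolded has_gradient_def, rule_format, of x \<xi> v] assms(2-4) by simp

text \<open>That the components of the gradient lie again in the class is what carries the later
  induction on the order of differentiability.\<close>

lemma smooth_gen_chain:
  assumes "smooth_gen n s \<Omega> F"
  shows "\<exists>G. (\<forall>c. smooth_gen n s \<Omega> (G c)) \<and> has_gradient n s \<Omega> F G"
  using assms
proof induction
  case (const a)
  show ?case by (intro exI[of _ "\<lambda>_ _. 0"]) (auto simp: has_gradient_def intro!: smooth_gen.const)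
next
  case (coord c)
  show ?case
  proof (rule exI[of _ "\<lambda>d _. if d = c then 1 else 0"], unfold has_gradient_def, intro conjI allI ballI impI)
    fix x \<xi> v assume "\<forall>c\<in>basis_idx n s. ((\<lambda>t. \<xi> t c) has_field_derivative v c) (at 0)"
    then show "((\<lambda>t. \<xi> t c) has_field_derivative
        (\<Sum>d\<in>basis_idx n s. (if d = c then 1 else 0) * v d)) (at 0)"
      using coord by (simp add: if_distrib[of "\<lambda>x. x * _"] cong: if_cong)
  qed (rule smooth_gen.const)
next
  case (add F1 F2)
  obtain G1 where G1: "\<And>c. smooth_gen n s \<Omega> (G1 c)" "has_gradient n s \<Omega> F1 G1"
    using add.IH(1) by blast
  obtain G2 where G2: "\<And>c. smooth_gen n s \<Omega> (G2 c)" "has_gradient n s \<Omega> F2 G2"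
    using add.IH(2) by blast
  show ?case
  proof (rule exI[of _ "\<lambda>d x. G1 d x + G2 d x"], unfold has_gradient_def, intro conjI allI ballI impI)
    fix x \<xi> v assume "x \<in> \<Omega>" "\<xi> 0 = x" "\<forall>c\<in>basis_idx n s. ((\<lambda>t. \<xi> t c) has_field_derivative v c) (at 0)"
    then show "((\<lambda>t. F1 (\<xi> t) + F2 (\<xi> t)) has_field_derivative
        (\<Sum>d\<in>basis_idx n s. (G1 d x + G2 d x) * v d)) (at 0)"
      unfolding distrib_right sum.distrib by (intro DERIV_add has_gradientD[OF G1(2)] has_gradientD[OF G2(2)]) auto
  qed (intro smooth_gen.add G1(1) G2(1))
next
  case (mult F1 F2)
  obtain G1 where G1: "\<And>c. smooth_gen n s \<Omega> (G1 c)" "has_gradient n s \<Omega> F1 G1"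
    using mult.IH(1) by blast
  obtain G2 where G2: "\<And>c. smooth_gen n s \<Omega> (G2 c)" "has_gradient n s \<Omega> F2 G2"
    using mult.IH(2) by blast
  show ?case
  proof (rule exI[of _ "\<lambda>d x. G1 d x * F2 x + G2 d x * F1 x"], unfold has_gradient_def, intro conjI allI ballI impI)
    fix x \<xi> v assume x: "x \<in> \<Omega>" "\<xi> 0 = x" "\<forall>c\<in>basis_idx n s. ((\<lambda>t. \<xi> t c) has_field_derivative v c) (at 0)"
    have "((\<lambda>t. F1 (\<xi> t) * F2 (\<xi> t)) has_field_derivative
        (\<Sum>d\<in>basis_idx n s. G1 d x * v d) * F2 (\<xi> 0) + (\<Sum>d\<in>basis_idx n s. G2 d x * v d) * F1 (\<xi> 0)) (at 0)"
      by (intro DERIV_mult has_gradientD[OF G1(2)] has_gradientD[OF G2(2)]) (use x in auto)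
    also have "(\<Sum>d\<in>basis_idx n s. G1 d x * v d) * F2 (\<xi> 0) + (\<Sum>d\<in>basis_idx n s. G2 d x * v d) * F1 (\<xi> 0)
      = (\<Sum>d\<in>basis_idx n s. (G1 d x * F2 x + G2 d x * F1 x) * v d)"
      by (simp add: x sum_distrib_right sum_distrib_left sum.distrib algebra_simps)
    finally show "((\<lambda>t. F1 (\<xi> t) * F2 (\<xi> t)) has_field_derivative \<dots>) (at 0)" .
  qed (intro smooth_gen.add smooth_gen.mult mult.hyps G1(1) G2(1))
next
  case (power_comp F \<phi> b)
  obtain G where G: "\<And>c. smooth_gen n s \<Omega> (G c)" "has_gradient n s \<Omega> F G"
    using power_comp.IH by blast
  have P: "smooth_gen n s \<Omega> (\<lambda>x. \<phi> (F x))"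
    by (rule smooth_gen.power_comp[where \<phi> = \<phi> and F = F and b = b]) (use power_comp.hyps in auto)
  have I: "smooth_gen n s \<Omega> (\<lambda>x. inverse (F x))"
    by (rule smooth_gen_inverse) (use power_comp.hyps in auto)
  show ?case
  proof (rule exI[of _ "\<lambda>d x. b * \<phi> (F x) * inverse (F x) * G d x"], unfold has_gradient_def, intro conjI allI ballI impI)
    fix x \<xi> v assume x: "x \<in> \<Omega>" "\<xi> 0 = x" "\<forall>c\<in>basis_idx n s. ((\<lambda>t. \<xi> t c) has_field_derivative v c) (at 0)"
    have "((\<lambda>t. \<phi> (F (\<xi> t))) has_field_derivative
        b * \<phi> (F (\<xi> 0)) / F (\<xi> 0) * (\<Sum>d\<in>basis_idx n s. G d x * v d)) (at 0)"
      by (rule DERIV_chain2[where f = \<phi>]) (use x power_comp.hyps has_gradientD[OF G(2)] in auto)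
    then show "((\<lambda>t. \<phi> (F (\<xi> t))) has_field_derivative
        (\<Sum>d\<in>basis_idx n s. b * \<phi> (F x) * inverse (F x) * G d x * v d)) (at 0)"
      by (simp add: x sum_distrib_left divide_inverse mult.assoc)
  qed (intro smooth_gen.mult smooth_gen.const P I G(1))
qed

lemma has_gradient_partial:
  assumes G: "has_gradient n s \<Omega> F G" and x: "x \<in> \<Omega>" and c: "c \<in> basis_idx n s"
  shows "((\<lambda>t. F (x(c := t))) has_field_derivative G c x) (at (x c))"
proof -
  have "((\<lambda>t. F (x(c := t + x c))) has_field_derivative
      (\<Sum>d\<in>basis_idx n s. G d x * (if d = c then 1 else 0))) (at 0)"
  proof (rule has_gradientD[OF G x])
    fix d
    show "((\<lambda>t. (x(c := t + x c)) d) has_field_derivative (if d = c then 1 else 0)) (at 0)"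
      by (cases "d = c") (auto intro!: derivative_eq_intros)
  qed simp
  then have "((\<lambda>t. F (x(c := t + x c))) has_field_derivative G c x) (at 0)"
    using c by (simp add: if_distrib cong: if_cong)
  then show ?thesis
    using DERIV_shift[of "\<lambda>t. F (x(c := t))" "G c x" 0 "x c"] by simp
qed

lemma has_gradient_partial_deriv:
  "has_gradient n s \<Omega> F G \<Longrightarrow> x \<in> \<Omega> \<Longrightarrow> c \<in> basis_idx n s \<Longrightarrow> partial_deriv c F x = G c x"
  unfolding partial_deriv_def by (intro DERIV_imp_deriv has_gradient_partial)

lemma smooth_gen_has_partial_deriv:
  assumes "smooth_gen n s \<Omega> F" "x \<in> \<Omega>" "c \<in> basis_idx n s"
  shows "((\<lambda>t. F (x(c := t))) has_field_derivative partial_deriv c F x) (at (x c))"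
  using smooth_gen_chain[OF assms(1)] has_gradient_partial[OF _ assms(2,3)]
    has_gradient_partial_deriv[OF _ assms(2,3)] by metis

lemma smooth_gen_partial_deriv:
  assumes "smooth_gen n s \<Omega> F" "c \<in> basis_idx n s"
  shows "\<exists>G. smooth_gen n s \<Omega> G \<and> (\<forall>x\<in>\<Omega>. partial_deriv c F x = G x)"
  using smooth_gen_chain[OF assms(1)] has_gradient_partial_deriv[OF _ _ assms(2)] by metis

lemma smooth_gen_curve_deriv:
  assumes "smooth_gen n s \<Omega> F" "x \<in> \<Omega>" "\<xi> 0 = x"
    and "\<And>c. c \<in> basis_idx n s \<Longrightarrow> ((\<lambda>t. \<xi> t c) has_field_derivative v c) (at 0)"
  shows "((\<lambda>t. F (\<xi> t)) has_field_derivative (\<Sum>c\<in>basis_idx n s. partial_deriv c F x * v c)) (at 0)"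
proof -
  obtain G where G: "has_gradient n s \<Omega> F G" using smooth_gen_chain[OF assms(1)] by blast
  have "(\<Sum>c\<in>basis_idx n s. partial_deriv c F x * v c) = (\<Sum>c\<in>basis_idx n s. G c x * v c)"
    by (intro sum.cong) (simp_all add: has_gradient_partial_deriv[OF G assms(2)])
  then show ?thesis using has_gradientD[OF G assms(2-4)] by simp
qed

section \<open>Continuity and smoothness on relatively open sets\<close>

lemma smooth_gen_continuous: "smooth_gen n s \<Omega> F \<Longrightarrow> continuous_on \<Omega> F"
proof (induction rule: smooth_gen.induct)
  case (coord c)
  show ?case by (rule continuous_on_subset[OF continuous_on_product_coordinates]) simp
next
  case (power_comp F \<phi> b)
  have "continuous_on (F ` \<Omega>) \<phi>"
    using power_comp.hyps by (auto intro!: continuous_at_imp_continuous_on dest!: DERIV_isCont)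
  then show ?case using power_comp.IH by (rule continuous_on_compose2) auto
qed (auto intro!: continuous_intros)

text \<open>\<open>\<Omega>\<close> is open only relative to the coordinate space; changing a
  coordinate in \<open>basis_idx\<close> does not leave that space.\<close>

lemma eventually_upd_in_open:
  fixes \<Omega> :: "(nat \<times> nat \<Rightarrow> 'a::{zero,topological_space}) set"
  assumes "openin (top_of_set (coord_space n s)) \<Omega>" "x \<in> \<Omega>" "c \<in> basis_idx n s"
  shows "\<forall>\<^sub>F t in nhds (x c). x(c := t) \<in> \<Omega>"
proof -
  obtain U where U: "open U" "\<Omega> = coord_space n s \<inter> U"
    using assms(1) by (auto simp: openin_open)
  have "continuous_on UNIV (\<lambda>t. x(c := t))"
  proof (rule continuous_on_coordinatewise_then_product)
    show "continuous_on UNIV (\<lambda>t. (x(c := t)) i)" for i by (cases "i = c") simp_all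
  qed
  then have "open ((\<lambda>t. x(c := t)) -` U)"
    using U(1) by (simp add: open_vimage)
  then have "\<forall>\<^sub>F t in nhds (x c). x(c := t) \<in> U"
    using assms(2) U(2) by (auto simp: eventually_nhds intro!: exI[of _ "(\<lambda>t. x(c := t)) -` U"])
  then show ?thesis
    by eventually_elim (use assms U in \<open>auto simp: coord_space_def\<close>)
qed

text \<open>A basic neighbourhood in the product topology restricts only finitely many coordinates,
  so continuity of each coordinate suffices. This keeps orbit curves inside \<open>\<Omega>\<close>
  for small times.\<close>

lemma eventually_curve_in_open:
  fixes \<xi> :: "'a::t2_space \<Rightarrow> nat \<times> nat \<Rightarrow> 'b::{zero,topological_space}"
  assumes "openin (top_of_set (coord_space n s)) \<Omega>" "\<xi> a \<in> \<Omega>"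
    and "\<And>t. \<xi> t \<in> coord_space n s" "\<And>c. isCont (\<lambda>t. \<xi> t c) a"
  shows "\<forall>\<^sub>F t in nhds a. \<xi> t \<in> \<Omega>"
proof -
  obtain U where U: "open U" "\<Omega> = coord_space n s \<inter> U"
    using assms(1) by (auto simp: openin_open)
  have "\<xi> a \<in> U" using assms U by auto
  then obtain W where W: "\<xi> a \<in> Pi\<^sub>E UNIV W" "\<And>c. open (W c)" "finite {c. W c \<noteq> UNIV}" "Pi\<^sub>E UNIV W \<subseteq> U"
    using product_topology_open_contains_basis[of "\<lambda>_. euclidean" UNIV U "\<xi> a"] U(1)
    by (auto simp: open_fun_def)
  have "\<forall>\<^sub>F t in nhds a. \<forall>c\<in>{c. W c \<noteq> UNIV}. \<xi> t c \<in> W c"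
  proof (intro eventually_ball_finite W(3) ballI)
    fix c
    have t: "((\<lambda>t. \<xi> t c) \<longlongrightarrow> \<xi> a c) (nhds a)"
      using assms(4)[of c] tendsto_at_iff_tendsto_nhds[of "\<lambda>t. \<xi> t c" a] by (simp add: isCont_def)
    have "\<xi> a c \<in> W c" using W(1) by (rule PiE_mem) simp
    then show "\<forall>\<^sub>F t in nhds a. \<xi> t c \<in> W c" by (rule topological_tendstoD[OF t W(2)])
  qed
  then show ?thesis
  proof eventually_elim
    case (elim t)
    have "\<xi> t \<in> Pi\<^sub>E UNIV W" using elim by auto
    then show ?case using W(4) U assms(3) by auto
  qed
qed

text \<open>A partial derivative agrees with a generated function only on \<open>\<Omega>\<close>.
  Agreement near a point on the coordinate line is enough for equal derivatives, and relative
  openness provides it.\<close>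

lemma Ck_on_cong:
  fixes F G :: "(nat \<times> nat \<Rightarrow> 'a::real_normed_field) \<Rightarrow> 'a"
  assumes "openin (top_of_set (coord_space n s)) \<Omega>" "\<And>x. x \<in> \<Omega> \<Longrightarrow> F x = G x" "Ck_on m n s \<Omega> G"
  shows "Ck_on m n s \<Omega> F"
  using assms(2,3)
proof (induction m arbitrary: F G)
  case 0
  then show ?case by (auto intro: continuous_on_eq)
next
  case (Suc m)
  have ev: "\<forall>\<^sub>F t in nhds (x c). F (x(c := t)) = G (x(c := t))"
    if "x \<in> \<Omega>" "c \<in> basis_idx n s" for x c
    using eventually_upd_in_open[OF assms(1) that] by eventually_elim (rule Suc.prems)
  have pd: "partial_deriv c F x = partial_deriv c G x" if "x \<in> \<Omega>" "c \<in> basis_idx n s" for x c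
    unfolding partial_deriv_def using ev[OF that] by (intro deriv_cong_ev) auto
  have "(\<lambda>t. F (x(c := t))) field_differentiable at (x c)" if "x \<in> \<Omega>" "c \<in> basis_idx n s" for x c
  proof -
    have "(\<lambda>t. G (x(c := t))) field_differentiable at (x c)" using Suc.prems(2) that by simp
    then show ?thesis
      using DERIV_cong_ev[OF refl ev[OF that] refl] by (auto simp: field_differentiable_def)
  qed
  moreover have "continuous_on \<Omega> F" using Suc.prems by (auto intro: continuous_on_eq)
  moreover have "Ck_on m n s \<Omega> (partial_deriv c F)" if "c \<in> basis_idx n s" for c
  proof (rule Suc.IH)
    show "partial_deriv c F x = partial_deriv c G x" if "x \<in> \<Omega>" for x
      using \<open>c \<in> basis_idx n s\<close> that by (intro pd)
    show "Ck_on m n s \<Omega> (partial_deriv c G)" using Suc.prems(2) \<open>c \<in> basis_idx n s\<close> by simp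
  qed
  ultimately show ?case by simp
qed

lemma smooth_gen_Ck_on:
  assumes "openin (top_of_set (coord_space n s)) \<Omega>"
  shows "smooth_gen n s \<Omega> F \<Longrightarrow> Ck_on m n s \<Omega> F"
proof (induction m arbitrary: F)
  case 0
  then show ?case by (simp add: smooth_gen_continuous)
next
  case (Suc m)
  have "Ck_on m n s \<Omega> (partial_deriv c F)" if c: "c \<in> basis_idx n s" for c
  proof -
    obtain G where G: "smooth_gen n s \<Omega> G" "\<forall>x\<in>\<Omega>. partial_deriv c F x = G x"
      using smooth_gen_partial_deriv[OF Suc.prems c] by blast
    show ?thesis by (rule Ck_on_cong[OF assms _ Suc.IH[OF G(1)]]) (use G(2) in blast)
  qed
  moreover have "(\<lambda>t. F (x(c := t))) field_differentiable at (x c)"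
    if "x \<in> \<Omega>" "c \<in> basis_idx n s" for x c
    using smooth_gen_has_partial_deriv[OF Suc.prems that] unfolding field_differentiable_def by blast
  ultimately show ?case using smooth_gen_continuous[OF Suc.prems] by simp
qed

lemma smooth_gen_smooth_on:
  "openin (top_of_set (coord_space n s)) \<Omega> \<Longrightarrow> smooth_gen n s \<Omega> F \<Longrightarrow> smooth_on n s \<Omega> F"
  by (simp add: smooth_on_def smooth_gen_Ck_on)

section \<open>The coadjoint action in matrix form\<close>

text \<open>Matrices are also treated as functions of indices below \<open>n\<close> (counted from 0), for which products
  are associative without side conditions on dimensions.\<close>

definition fun_mult :: "nat \<Rightarrow> (nat \<Rightarrow> nat \<Rightarrow> 'a::semiring_0) \<Rightarrow> (nat \<Rightarrow> nat \<Rightarrow> 'a) \<Rightarrow> nat \<Rightarrow> nat \<Rightarrow> 'a" where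
  "fun_mult n A B = (\<lambda>i j. \<Sum>k<n. A i k * B k j)"

definition fun_trace :: "nat \<Rightarrow> (nat \<Rightarrow> nat \<Rightarrow> 'a::semiring_0) \<Rightarrow> 'a" where
  "fun_trace n A = (\<Sum>i<n. A i i)"

abbreviation ent :: "'a mat \<Rightarrow> nat \<Rightarrow> nat \<Rightarrow> 'a" where
  "ent A \<equiv> (\<lambda>i j. A $$ (i, j))"

definition fun_upper :: "nat \<Rightarrow> (nat \<Rightarrow> nat \<Rightarrow> 'a::semiring_0) \<Rightarrow> bool" where
  "fun_upper n A \<longleftrightarrow> (\<forall>i<n. \<forall>j<i. A i j = 0)"

lemma fun_mult_assoc: "fun_mult n (fun_mult n A B) C = fun_mult n A (fun_mult n B C)"
  unfolding fun_mult_def sum_distrib_left sum_distrib_right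
  by (intro ext, subst sum.swap) (simp add: mult.assoc)

lemma fun_trace_fun_mult_commute: "fun_trace n (fun_mult n A B) = fun_trace n (fun_mult n B (A :: _ \<Rightarrow> _ \<Rightarrow> 'a::comm_semiring_0))"
  unfolding fun_mult_def fun_trace_def by (subst sum.swap) (simp add: mult.commute)

lemma ent_mult:
  "A \<in> carrier_mat n n \<Longrightarrow> B \<in> carrier_mat n n \<Longrightarrow> i < n \<Longrightarrow> j < n \<Longrightarrow>
    (A * B) $$ (i, j) = fun_mult n (ent A) (ent B) i j"
  by (simp add: fun_mult_def scalar_prod_def atLeast0LessThan)

lemma fun_upper_fun_mult_lower:
  assumes "fun_upper n A" "fun_upper n B" "j < i" "i < n"
  shows "fun_mult n A B i j = 0"
  unfolding fun_mult_def
proof (rule sum.neutral, rule ballI)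
  fix k assume "k \<in> {..<n}"
  then show "A i k * B k j = 0"
    using assms by (cases "k < i") (auto simp: fun_upper_def)
qed

lemma fun_upper_fun_mult: "fun_upper n A \<Longrightarrow> fun_upper n B \<Longrightarrow> fun_upper n (fun_mult n A B)"
  by (simp add: fun_upper_def[of n "fun_mult n A B"] fun_upper_fun_mult_lower)

lemma fun_upper_fun_mult_diag:
  assumes "fun_upper n A" "fun_upper n B" "i < n"
  shows "fun_mult n A B i i = A i i * B i i"
proof -
  have "fun_mult n A B i i = (\<Sum>k\<in>{i}. A i k * B k i)"
    unfolding fun_mult_def
  proof (rule sum.mono_neutral_right)
    show "\<forall>k\<in>{..<n} - {i}. A i k * B k i = 0"
    proof
      fix k assume "k \<in> {..<n} - {i}"
      then show "A i k * B k i = 0"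
        using assms by (cases "k < i") (auto simp: fun_upper_def)
    qed
  qed (use assms in auto)
  then show ?thesis by simp
qed

lemma upper_triangular_fun_upper: "A \<in> carrier_mat n n \<Longrightarrow> upper_triangular A \<longleftrightarrow> fun_upper n (ent A)"
  by (auto simp: upper_triangular_def fun_upper_def)

text \<open>Back substitution from the bottom row: in an entry of \<open>B * C\<close> below the
  diagonal, the terms with \<open>k < i\<close> vanish by \<open>B\<close>, those with
  \<open>k > i\<close> by the rows already treated.\<close>

lemma upper_triangular_inverse:
  fixes B C :: "'a::field mat"
  assumes B: "B \<in> carrier_mat n n" "upper_triangular B" and C: "C \<in> carrier_mat n n"
    and BC: "B * C = 1\<^sub>m n" and d: "\<And>i. i < n \<Longrightarrow> B $$ (i, i) \<noteq> 0"
  shows "upper_triangular C"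
proof -
  have "C $$ (i, j) = 0" if "j < i" "i < n" for i j
    using that
  proof (induction "n - i" arbitrary: i rule: less_induct)
    case less
    have "0 = (B * C) $$ (i, j)" using less.prems BC by simp
    also have "\<dots> = (\<Sum>k<n. B $$ (i, k) * C $$ (k, j))"
      using ent_mult[OF B(1) C] less.prems by (simp add: fun_mult_def)
    also have "\<dots> = (\<Sum>k\<in>{i}. B $$ (i, k) * C $$ (k, j))"
    proof (rule sum.mono_neutral_right)
      show "\<forall>k\<in>{..<n} - {i}. B $$ (i, k) * C $$ (k, j) = 0"
      proof
        fix k assume k: "k \<in> {..<n} - {i}"
        show "B $$ (i, k) * C $$ (k, j) = 0"
        proof (cases "k < i")
          case True
          then show ?thesis using B less.prems by auto
        next
          case False
          then have "C $$ (k, j) = 0" using k less.prems by (intro less.hyps) auto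
          then show ?thesis by simp
        qed
      qed
    qed (use less.prems in auto)
    finally show ?case using d less.prems by simp
  qed
  then show ?thesis using C by auto
qed

lemma mat_inv_eq:
  fixes B C :: "'a::semiring_1 mat"
  assumes B: "B \<in> carrier_mat n n" and C: "C \<in> carrier_mat n n"
    and BC: "B * C = 1\<^sub>m n" and CB: "C * B = 1\<^sub>m n"
  shows "mat_inv B = C"
  unfolding mat_inv_def
proof (rule the_equality)
  show "inverts_mat B C \<and> inverts_mat C B" using assms by (auto simp: inverts_mat_def)
next
  fix C' assume C': "inverts_mat B C' \<and> inverts_mat C' B"
  then have 1: "B * C' = 1\<^sub>m n" and 2: "C' * B = 1\<^sub>m (dim_row C')"
    using B by (auto simp: inverts_mat_def)
  \<comment> \<open>\<open>inverts_mat\<close> leaves the dimensions of a competing inverse open;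
    they are read off from the two products.\<close>
  have "dim_col C' = n" using 1 by (metis index_mult_mat(3) index_one_mat(3))
  moreover have "dim_row C' = n" using 2 B by (metis carrier_matD(2) index_mult_mat(3) index_one_mat(3))
  ultimately have C'c: "C' \<in> carrier_mat n n" by auto
  have "C' = C' * (B * C)" using C'c BC by simp
  also have "\<dots> = (C' * B) * C" using C'c B C by (simp add: assoc_mult_mat[of _ n n _ n _ n])
  also have "\<dots> = C" using 2 C'c C by auto
  finally show "C' = C" .
qed

text \<open>The algebra of the coadjoint action and of Schur complements uses of a group element
  only triangularity and a triangular inverse; the exponential form of the diagonal enters
  separately.\<close>

definition inverse_pair :: "nat \<Rightarrow> 'a::semiring_1 mat \<Rightarrow> 'a mat \<Rightarrow> bool" where
  "inverse_pair n B C \<longleftrightarrow> B \<in> carrier_mat n n \<and> C \<in> carrier_mat n n \<and>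
     upper_triangular B \<and> upper_triangular C \<and> B * C = 1\<^sub>m n \<and> C * B = 1\<^sub>m n"

lemma tri_group_inverse_pair:
  fixes \<gamma> :: "nat \<Rightarrow> nat \<Rightarrow> 'a::{real_normed_field, banach}"
  assumes "B \<in> tri_group n s \<gamma>"
  obtains C where "inverse_pair n B C"
proof -
  have B: "B \<in> carrier_mat n n" "upper_triangular B"
    using assms by (auto simp: tri_group_def)
  obtain \<epsilon> where \<epsilon>: "\<And>i. i \<in> {1..n} \<Longrightarrow> B $$ (i - 1, i - 1) = exp (\<Sum>p=1..s. \<gamma> p i * \<epsilon> p)"
    using assms by (auto simp: tri_group_def)
  have d: "B $$ (i, i) \<noteq> 0" if "i < n" for i
    using \<epsilon>[of "Suc i"] that by simp
  have "Determinant.det B \<noteq> 0"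
    using det_upper_triangular[OF B(2,1)] d B(1)
    by (auto simp: diag_mat_def prod_list_zero_iff)
  then have det: "inverse (Determinant.det B) * Determinant.det B = 1" by simp
  define C where "C = inverse (Determinant.det B) \<cdot>\<^sub>m adj_mat B"
  have adj: "adj_mat B \<in> carrier_mat n n" "B * adj_mat B = Determinant.det B \<cdot>\<^sub>m 1\<^sub>m n"
    "adj_mat B * B = Determinant.det B \<cdot>\<^sub>m 1\<^sub>m n"
    using adj_mat[OF B(1)] by auto
  have C: "C \<in> carrier_mat n n" using adj by (simp add: C_def)
  have BC: "B * C = 1\<^sub>m n"
    using adj B(1) det by (intro eq_matI) (auto simp: C_def mult_smult_distrib[of _ n n _ n])
  have CB: "C * B = 1\<^sub>m n"
    using adj B(1) det by (intro eq_matI) (auto simp: C_def mult_smult_assoc_mat[of _ n n _ n])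
  show ?thesis
    using that[of C] B C BC CB upper_triangular_inverse[OF B C BC d] by (simp add: inverse_pair_def)
qed

lemma sum_basis_idx:
  "(\<Sum>c\<in>basis_idx n s. f c) = (\<Sum>b<n. \<Sum>a<b. f (Suc b, Suc a)) + (\<Sum>p=1..s. f (p, 0))"
proof -
  let ?P = "(\<lambda>(b, a). (Suc b, Suc a)) ` (SIGMA b:{..<n}. {..<b})" and ?Q = "(\<lambda>p. (p, 0)) ` {1..s}"
  have eq: "basis_idx n s = ?P \<union> ?Q"
  proof (intro equalityI subsetI)
    fix c assume "c \<in> basis_idx n s"
    then obtain j i where c: "c = (j, i)" "1 \<le> i \<and> i < j \<and> j \<le> n \<or> 1 \<le> j \<and> j \<le> s \<and> i = 0"
      by (auto simp: basis_idx_def)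
    then show "c \<in> ?P \<union> ?Q"
      by (cases "i = 0") (auto intro!: image_eqI[of _ _ "(j - 1, i - 1)"])
  qed (auto simp: basis_idx_def)
  have "(\<Sum>c\<in>basis_idx n s. f c) = sum f ?P + sum f ?Q"
    unfolding eq by (rule sum.union_disjoint) auto
  also have "sum f ?P = (\<Sum>b<n. \<Sum>a<b. f (Suc b, Suc a))"
    by (subst sum.reindex) (auto simp: inj_on_def sum.Sigma case_prod_unfold o_def)
  also have "sum f ?Q = (\<Sum>p=1..s. f (p, 0))"
    by (subst sum.reindex) (auto simp: inj_on_def)
  finally show ?thesis .
qed

section \<open>The adjoint and the coadjoint action in coordinates\<close>

lemma alg_mat_carrier [simp]: "alg_mat n s \<gamma> u \<in> carrier_mat n n"
  by (simp add: alg_mat_def)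

lemma fun_upper_alg_mat: "fun_upper n (ent (alg_mat n s \<gamma> u))"
  by (auto simp: fun_upper_def alg_mat_def)

text \<open>Here admissibility enters: independence of the diagonal matrices makes the coordinates
  unique, so that the definite description in \<open>Ad\<close> denotes the conjugated
  element.\<close>

lemma alg_mat_inject:
  fixes \<gamma> :: "nat \<Rightarrow> nat \<Rightarrow> 'a::field"
  assumes adm: "admissible n s \<gamma>" and u: "u \<in> coord_space n s" "v \<in> coord_space n s"
    and eq: "alg_mat n s \<gamma> u = alg_mat n s \<gamma> v"
  shows "u = v"
proof
  fix c :: "nat \<times> nat"
  have e: "alg_mat n s \<gamma> u $$ (a, b) = alg_mat n s \<gamma> v $$ (a, b)" for a b using eq by simp
  obtain j i where c: "c = (j, i)" by force
  have "\<forall>p\<in>{1..s}. u (p, 0) - v (p, 0) = 0"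
  proof -
    have "0 + (\<Sum>p=1..s. (u (p, 0) - v (p, 0)) * \<gamma> p i) = 0" if "i \<in> {1..n}" for i
      using e[of "i - 1" "i - 1"] that by (auto simp: alg_mat_def left_diff_distrib sum_subtractf)
    then show ?thesis
      using adm[unfolded admissible_def, rule_format, of 0 "\<lambda>p. u (p, 0) - v (p, 0)"] by blast
  qed
  moreover have "u (j, i) = v (j, i)" if "1 \<le> i" "i < j" "j \<le> n"
    using e[of "i - 1" "j - 1"] that by (cases i; cases j) (simp_all add: alg_mat_def)
  moreover have "u c = v c" if "c \<notin> basis_idx n s" using u that by (simp add: coord_spaceD)
  ultimately show "u c = v c" unfolding c
    by (cases "(j, i) \<in> basis_idx n s") (auto simp: basis_idx_def c)
qed

text \<open>The full product, before its upper part is discarded. Its strictly lower entries are the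
  new coordinates, and its diagonal, weighted by the parameters, is the change of the coordinates at
  the \<open>f\<close>'s.\<close>

definition conj_mat :: "nat \<Rightarrow> 'a mat \<Rightarrow> (nat \<times> nat \<Rightarrow> 'a::comm_ring_1) \<Rightarrow> 'a mat \<Rightarrow> nat \<Rightarrow> nat \<Rightarrow> 'a" where
  "conj_mat n B x C = fun_mult n (fun_mult n (ent B) (ent (Xmat n x))) (ent C)"

text \<open>Conjugating an upper triangular matrix by a triangular one keeps its diagonal, hence the
  coordinates with second index 0. The roles of \<open>B\<close> and \<open>C\<close> are exchanged
  because \<open>coad\<close> applies \<open>Ad\<close> to the inverse.\<close>

lemma Ad_eq:
  fixes \<gamma> :: "nat \<Rightarrow> nat \<Rightarrow> 'a::field"
  assumes adm: "admissible n s \<gamma>" and inv: "inverse_pair n B C"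
  shows "Ad n s \<gamma> C u = (\<lambda>(j, i). if (j, i) \<in> basis_idx n s
    then if i = 0 then u (j, 0) else fun_mult n (fun_mult n (ent C) (ent (alg_mat n s \<gamma> u))) (ent B) (i - 1) (j - 1)
    else 0)" (is "_ = ?v")
proof -
  have BC: "B \<in> carrier_mat n n" "C \<in> carrier_mat n n" "fun_upper n (ent B)" "fun_upper n (ent C)" "C * B = 1\<^sub>m n" "B * C = 1\<^sub>m n"
    using inv upper_triangular_fun_upper by (auto simp: inverse_pair_def)
  let ?U = "alg_mat n s \<gamma> u"
  let ?W = "fun_mult n (fun_mult n (ent C) (ent ?U)) (ent B)"
  have Wc: "C * ?U * B \<in> carrier_mat n n" using BC by auto
  have W: "(C * ?U * B) $$ (i, j) = ?W i j" if "i < n" "j < n" for i j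
  proof -
    have "(C * ?U * B) $$ (i, j) = fun_mult n (ent (C * ?U)) (ent B) i j"
      using BC that by (intro ent_mult) auto
    also have "\<dots> = ?W i j"
      using ent_mult[OF BC(2) alg_mat_carrier] that by (simp add: fun_mult_def[of n _ "ent B"])
    finally show ?thesis .
  qed
  have CB: "C $$ (i, i) * B $$ (i, i) = 1" if "i < n" for i
  proof -
    have "(C * B) $$ (i, i) = C $$ (i, i) * B $$ (i, i)"
      using ent_mult[OF BC(2,1) that that] fun_upper_fun_mult_diag[OF BC(4,3) that] by simp
    then show ?thesis using BC(5) that by simp
  qed
  have inv': "mat_inv C = B" using BC by (intro mat_inv_eq)
  have v: "?v \<in> coord_space n s" by (auto simp: coord_space_def)
  have av: "alg_mat n s \<gamma> ?v = C * ?U * B"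
  proof (rule eq_matI)
    fix a b assume "a < dim_row (C * ?U * B)" "b < dim_col (C * ?U * B)"
    then have ab: "a < n" "b < n" using Wc by auto
    consider "a < b" | "a = b" | "b < a" by linarith
    then show "alg_mat n s \<gamma> ?v $$ (a, b) = (C * ?U * B) $$ (a, b)"
    proof cases
      case 1
      then show ?thesis using ab W[OF ab] by (simp add: alg_mat_def basis_idx_def)
    next
      case 2
      have "?W a a = C $$ (a, a) * ?U $$ (a, a) * B $$ (a, a)"
        using ab BC by (simp add: fun_upper_fun_mult_diag fun_upper_fun_mult fun_upper_alg_mat)
      also have "\<dots> = ?U $$ (a, a)" using CB[OF ab(1)] by (simp add: mult.commute mult.left_commute)
      also have "\<dots> = alg_mat n s \<gamma> ?v $$ (a, a)"
        using ab by (simp add: alg_mat_def basis_idx_def)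
      finally show ?thesis using 2 W[OF ab] by simp
    next
      case 3
      then have "?W a b = 0" using ab BC by (intro fun_upper_fun_mult_lower fun_upper_fun_mult fun_upper_alg_mat)
      then show ?thesis using 3 ab W[OF ab] by (simp add: alg_mat_def)
    qed
  qed (use Wc in \<open>auto simp: alg_mat_def\<close>)
  show ?thesis
    unfolding Ad_def inv'
  proof (rule the_equality)
    show "?v \<in> coord_space n s \<and> alg_mat n s \<gamma> ?v = C * ?U * B" using v av by blast
    fix v' assume "v' \<in> coord_space n s \<and> alg_mat n s \<gamma> v' = C * ?U * B"
    then show "v' = ?v" using v av by (intro alg_mat_inject[OF adm]) auto
  qed
qed

text \<open>As \<open>X\<close> is strictly lower triangular, pairing with the off-diagonal
  coordinates is the trace form. Cyclicity of the trace then moves the conjugation from the algebra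
  element to \<open>X\<close>.\<close>

lemma pairing_Ad:
  fixes \<gamma> :: "nat \<Rightarrow> nat \<Rightarrow> 'a::field"
  assumes adm: "admissible n s \<gamma>" and inv: "inverse_pair n B C"
  shows "pairing n s x (Ad n s \<gamma> C u) =
    fun_trace n (fun_mult n (conj_mat n B x C) (ent (alg_mat n s \<gamma> u))) + (\<Sum>p=1..s. x (p, 0) * u (p, 0))"
proof -
  let ?U = "ent (alg_mat n s \<gamma> u)" and ?X = "ent (Xmat n x)"
  let ?W = "fun_mult n (fun_mult n (ent C) ?U) (ent B)"
  have "pairing n s x (Ad n s \<gamma> C u) =
      (\<Sum>b<n. \<Sum>a<b. x (Suc b, Suc a) * ?W a b) + (\<Sum>p=1..s. x (p, 0) * u (p, 0))"
    unfolding pairing_def sum_basis_idx Ad_eq[OF assms]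
    by (intro arg_cong2[where f = "(+)"] sum.cong) (auto simp: basis_idx_def)
  also have "(\<Sum>b<n. \<Sum>a<b. x (Suc b, Suc a) * ?W a b) = fun_trace n (fun_mult n ?X ?W)"
    unfolding fun_trace_def fun_mult_def[of n ?X]
  proof (rule sum.cong)
    fix b assume b: "b \<in> {..<n}"
    show "(\<Sum>a<b. x (Suc b, Suc a) * ?W a b) = (\<Sum>a<n. ?X b a * ?W a b)"
      by (rule sum.mono_neutral_cong_left) (use b in \<open>auto simp: Xmat_def\<close>)
  qed simp
  also have "\<dots> = fun_trace n (fun_mult n (conj_mat n B x C) ?U)"
    unfolding conj_mat_def fun_mult_assoc[symmetric]
    by (subst fun_trace_fun_mult_commute) (simp add: fun_mult_assoc)
  finally show ?thesis .
qed

lemma coad_lower: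
  fixes \<gamma> :: "nat \<Rightarrow> nat \<Rightarrow> 'a::field"
  assumes adm: "admissible n s \<gamma>" and inv: "inverse_pair n B C"
    and ij: "i < j" "j < n"
  shows "coad n s \<gamma> B x (Suc j, Suc i) = conj_mat n B x C j i"
proof -
  have inv': "mat_inv B = C" using inv by (auto simp: inverse_pair_def intro: mat_inv_eq)
  let ?Z = "conj_mat n B x C" and ?U = "ent (alg_mat n s \<gamma> (unit_coord (Suc j, Suc i)))"
  have U: "?U a b = (if a = i \<and> b = j then 1 else 0)" if "a < n" "b < n" for a b
    using that ij by (auto simp: alg_mat_def unit_coord_def)
  have "fun_trace n (fun_mult n ?Z ?U) = (\<Sum>b<n. \<Sum>a<n. if b = j then if a = i then ?Z b a else 0 else 0)"
    unfolding fun_trace_def fun_mult_def by (intro sum.cong) (auto simp: U)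
  also have "\<dots> = (\<Sum>b<n. if b = j then \<Sum>a<n. if a = i then ?Z b a else 0 else 0)"
    by (intro sum.cong) auto
  also have "\<dots> = ?Z j i" using ij by simp
  finally show ?thesis
    using ij by (simp add: coad_def inv' pairing_Ad[OF adm inv] basis_idx_def) (simp add: unit_coord_def)
qed

lemma coad_diag:
  fixes \<gamma> :: "nat \<Rightarrow> nat \<Rightarrow> 'a::field"
  assumes adm: "admissible n s \<gamma>" and inv: "inverse_pair n B C"
    and p: "p \<in> {1..s}"
  shows "coad n s \<gamma> B x (p, 0) = x (p, 0) + (\<Sum>i<n. \<gamma> p (Suc i) * conj_mat n B x C i i)"
proof -
  have inv': "mat_inv B = C" using inv by (auto simp: inverse_pair_def intro: mat_inv_eq)
  let ?Z = "conj_mat n B x C" and ?U = "ent (alg_mat n s \<gamma> (unit_coord (p, 0)))"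
  have g: "(\<Sum>q=1..s. unit_coord (p, 0) (q, 0::nat) * f q) = f p" for f :: "nat \<Rightarrow> 'a"
  proof -
    have "(\<Sum>q=1..s. unit_coord (p, 0) (q, 0::nat) * f q) = (\<Sum>q=1..s. if q = p then f q else 0)"
      by (intro sum.cong) (auto simp: unit_coord_def)
    then show ?thesis using p by simp
  qed
  have h: "unit_coord (p, 0) (Suc b, Suc a) = 0" for a b by (simp add: unit_coord_def)
  have U: "?U a b = (if a = b then \<gamma> p (Suc a) else 0)" if "a < n" "b < n" for a b
    using that g by (auto simp: alg_mat_def h)
  have "fun_trace n (fun_mult n ?Z ?U) = (\<Sum>b<n. \<Sum>a<n. if a = b then \<gamma> p (Suc a) * ?Z b a else 0)"
    unfolding fun_trace_def fun_mult_def by (intro sum.cong) (auto simp: U)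
  also have "\<dots> = (\<Sum>i<n. \<gamma> p (Suc i) * ?Z i i)" by (intro sum.cong) auto
  finally show ?thesis
    using p g[of "\<lambda>q. x (q, 0)"] by (simp add: coad_def inv' pairing_Ad[OF adm inv] basis_idx_def mult.commute)
qed

lemma coad_in_coord_space: "coad n s \<gamma> B x \<in> coord_space n s"
  by (simp add: coord_space_def coad_def)

lemma inverse_pair_fun_upper: "inverse_pair n B C \<Longrightarrow> fun_upper n (ent B)" "inverse_pair n B C \<Longrightarrow> fun_upper n (ent C)"
  using upper_triangular_fun_upper by (auto simp: inverse_pair_def)

lemma inverse_pair_fun_mult:
  assumes "inverse_pair n B C" "i < n" "j < n"
  shows "fun_mult n (ent B) (ent C) i j = (if i = j then 1 else 0)"
    and "fun_mult n (ent C) (ent B) i j = (if i = j then 1 else 0)"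
  using assms ent_mult[of B n C i j] ent_mult[of C n B i j] by (auto simp: inverse_pair_def)

section \<open>Corner minors and Schur complements\<close>

lemma sum_lessThan_add: "(\<Sum>e<m + k. f e) = (\<Sum>e<m. f e) + (\<Sum>a<k. f (m + a :: nat))"
  by (induction k) (simp_all add: add.assoc)

lemma sum_tail: "k \<le> n \<Longrightarrow> (\<Sum>b\<in>{n-k..<n}. f b) = (\<Sum>b<k. f (n - k + b :: nat))"
  by (rule sum.reindex_bij_witness[of _ "\<lambda>b. n - k + b" "\<lambda>b. b - (n - k)"]) auto

lemma conj_mat_eq_sum: "conj_mat n B x C i j = (\<Sum>d<n. \<Sum>e<n. B $$ (i, e) * Xmat n x $$ (e, d) * C $$ (d, j))"
  by (simp add: conj_mat_def fun_mult_def sum_distrib_right)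

text \<open>The last \<open>k\<close> rows of \<open>B\<close> meet only its last \<open>k\<close>
  columns, and the first \<open>k\<close> columns of \<open>C\<close> only its first
  \<open>k\<close> rows, so the corner block is multiplied by two triangular blocks. The bound on
  \<open>k\<close> keeps this block strictly below the diagonal, where the action is plain
  conjugation.\<close>

lemma minor_conj:
  fixes x :: "nat \<times> nat \<Rightarrow> 'a::field"
  assumes adm: "admissible n s \<gamma>" and inv: "inverse_pair n B C" and k: "k \<le> n div 2"
  shows "minor n (coad n s \<gamma> B x) k =
    (\<Prod>a<k. B $$ (n - k + a, n - k + a)) * minor n x k * (\<Prod>a<k. C $$ (a, a))"
proof -
  have 2: "2 * k \<le> n" using k by linarith
  define B' where "B' = mat k k (\<lambda>(a, b). B $$ (n - k + a, n - k + b))"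
  define C' where "C' = mat k k (\<lambda>(a, b). C $$ (a, b))"
  define X where "X = block (Xmat n x) (n - k + 1) n 1 k"
  have X: "X $$ (a, b) = Xmat n x $$ (n - k + a, b)" if "a < k" "b < k" for a b
    using that 2 by (simp add: X_def block_def)
  have car: "B' \<in> carrier_mat k k" "C' \<in> carrier_mat k k" "X \<in> carrier_mat k k"
    using 2 by (auto simp: B'_def C'_def X_def block_def)
  have B0: "B $$ (i, e) = 0" if "e < i" "i < n" for i e
    using inverse_pair_fun_upper(1)[OF inv] that by (auto simp: fun_upper_def)
  have C0: "C $$ (i, e) = 0" if "e < i" "i < n" for i e
    using inverse_pair_fun_upper(2)[OF inv] that by (auto simp: fun_upper_def)
  have "block (Xmat n (coad n s \<gamma> B x)) (n - k + 1) n 1 k = B' * X * C'"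
  proof (rule eq_matI)
    fix a b assume "a < dim_row (B' * X * C')" "b < dim_col (B' * X * C')"
    then have ab: "a < k" "b < k" using car by auto
    have "block (Xmat n (coad n s \<gamma> B x)) (n - k + 1) n 1 k $$ (a, b) = conj_mat n B x C (n - k + a) b"
      using ab 2 coad_lower[OF adm inv, of b "n - k + a" x] by (auto simp: block_def Xmat_def)
    also have "\<dots> = (\<Sum>d<k. \<Sum>e<n. B $$ (n - k + a, e) * Xmat n x $$ (e, d) * C $$ (d, b))"
      unfolding conj_mat_eq_sum
    proof (rule sum.mono_neutral_right)
      show "\<forall>d\<in>{..<n} - {..<k}. (\<Sum>e<n. B $$ (n - k + a, e) * Xmat n x $$ (e, d) * C $$ (d, b)) = 0"
        using C0 ab by (auto intro!: sum.neutral)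
    qed (use 2 in auto)
    also have "\<dots> = (\<Sum>d<k. \<Sum>e<k. B' $$ (a, e) * X $$ (e, d) * C' $$ (d, b))"
    proof (rule sum.cong)
      fix d assume d: "d \<in> {..<k}"
      let ?f = "\<lambda>e. B $$ (n - k + a, e) * Xmat n x $$ (e, d) * C $$ (d, b)"
      have "(\<Sum>e<n. ?f e) = (\<Sum>e<n - k. ?f e) + (\<Sum>e<k. ?f (n - k + e))"
        using sum_lessThan_add[of ?f "n - k" k] 2 by simp
      also have "(\<Sum>e<n - k. ?f e) = 0"
        using B0 ab 2 by (intro sum.neutral) auto
      finally show "(\<Sum>e<n. ?f e) = (\<Sum>e<k. B' $$ (a, e) * X $$ (e, d) * C' $$ (d, b))"
        using d ab by (simp add: B'_def C'_def X)
    qed simp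
    also have "\<dots> = (B' * X * C') $$ (a, b)"
      using ent_mult[of "B' * X" k C' a b] ent_mult[OF car(1,3), of a] car ab
      by (simp add: fun_mult_def sum_distrib_right del: index_mult_mat(1))
    finally show "block (Xmat n (coad n s \<gamma> B x)) (n - k + 1) n 1 k $$ (a, b) = (B' * X * C') $$ (a, b)" .
  qed (use car 2 in \<open>auto simp: block_def\<close>)
  then have "minor n (coad n s \<gamma> B x) k = Determinant.det (B' * X * C')" by (simp add: minor_def)
  also have "\<dots> = Determinant.det B' * Determinant.det X * Determinant.det C'"
    using car by (simp add: det_mult[of _ k])
  also have "Determinant.det B' = (\<Prod>a<k. B $$ (n - k + a, n - k + a))"
  proof -
    have "upper_triangular B'" using 2 by (intro upper_triangularI) (auto simp: B'_def intro!: B0)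
    from det_upper_triangular[OF this car(1)] show ?thesis
      by (simp add: B'_def diag_mat_def prod.distinct_set_conv_list[symmetric] atLeast0LessThan)
  qed
  also have "Determinant.det C' = (\<Prod>a<k. C $$ (a, a))"
  proof -
    have "upper_triangular C'" using 2 by (intro upper_triangularI) (auto simp: C'_def intro!: C0)
    from det_upper_triangular[OF this car(2)] show ?thesis
      by (simp add: C'_def diag_mat_def prod.distinct_set_conv_list[symmetric] atLeast0LessThan)
  qed
  finally show ?thesis by (simp add: X_def minor_def)
qed

text \<open>One \<open>\<epsilon>\<close> serves all \<open>k\<close> and \<open>x\<close>; the
  first kind combines several minors, whose factors can cancel only if they come from the same
  parameters.\<close>

lemma minor_coad:
  fixes \<gamma> :: "nat \<Rightarrow> nat \<Rightarrow> 'a::{real_normed_field, banach}"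
  assumes adm: "admissible n s \<gamma>" and B: "B \<in> tri_group n s \<gamma>"
  obtains \<epsilon> where "\<And>k x. k \<le> n div 2 \<Longrightarrow>
    minor n (coad n s \<gamma> B x) k = minor n x k * exp (- (\<Sum>p=1..s. \<epsilon> p * alpha n \<gamma> p k))"
proof -
  obtain C where inv: "inverse_pair n B C" using tri_group_inverse_pair[OF B] .
  obtain \<epsilon> where \<epsilon>: "\<And>i. i \<in> {1..n} \<Longrightarrow> B $$ (i - 1, i - 1) = exp (\<Sum>p=1..s. \<gamma> p i * \<epsilon> p)"
    using B by (auto simp: tri_group_def)
  let ?E = "\<lambda>i. \<Sum>p=1..s. \<gamma> p i * \<epsilon> p"
  have Bd: "B $$ (i, i) = exp (?E (Suc i))" if "i < n" for i
    using \<epsilon>[of "Suc i"] that by simp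
  have Cd: "C $$ (i, i) = exp (- ?E (Suc i))" if "i < n" for i
  proof -
    have "B $$ (i, i) * C $$ (i, i) = 1"
      using inverse_pair_fun_mult(1)[OF inv that that] fun_upper_fun_mult_diag[OF inverse_pair_fun_upper[OF inv] that] by simp
    then show ?thesis using Bd[OF that] by (simp add: exp_minus field_simps)
  qed
  show ?thesis
  proof (rule that[of \<epsilon>])
    fix k x assume k: "k \<le> n div 2"
    then have 2: "2 * k \<le> n" by linarith
    have "(\<Prod>a<k. B $$ (n - k + a, n - k + a)) * (\<Prod>a<k. C $$ (a, a)) =
        exp ((\<Sum>a<k. ?E (Suc (n - k + a))) + (\<Sum>a<k. - ?E (Suc a)))"
      using 2 by (simp add: exp_add exp_sum Bd Cd)
    also have "(\<Sum>a<k. ?E (Suc (n - k + a))) = (\<Sum>k'=1..k. ?E (n - k' + 1))"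
      by (rule sum.reindex_bij_witness[of _ "\<lambda>k'. k - k'" "\<lambda>a. k - a"]) (use 2 in auto)
    also have "(\<Sum>a<k. - ?E (Suc a)) = (\<Sum>k'=1..k. - ?E k')"
      by (rule sum.reindex_bij_witness[of _ "\<lambda>k'. k' - 1" Suc]) auto
    also have "(\<Sum>k'=1..k. ?E (n - k' + 1)) + (\<Sum>k'=1..k. - ?E k') =
        (\<Sum>k'=1..k. \<Sum>p=1..s. \<epsilon> p * (\<gamma> p (n - k' + 1) - \<gamma> p k'))"
      by (simp add: sum.distrib[symmetric] sum_negf[symmetric] algebra_simps)
    also have "\<dots> = - (\<Sum>p=1..s. \<epsilon> p * alpha n \<gamma> p k)"
      by (subst sum.swap) (simp add: alpha_def sum_distrib_left sum_negf)
    finally show "minor n (coad n s \<gamma> B x) k = minor n x k * exp (- (\<Sum>p=1..s. \<epsilon> p * alpha n \<gamma> p k))"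
      by (simp add: minor_conj[OF adm inv k] mult_ac del: exp_minus)
  qed
qed

section \<open>Bordered determinants and elimination\<close>

lemma det_bordered:
  fixes A :: "'a::idom mat"
  assumes A: "A \<in> carrier_mat k k" and r: "r \<in> carrier_mat 1 k" and c: "c \<in> carrier_mat k 1"
    and w: "\<And>j. j < k \<Longrightarrow> r $$ (0, j) = (\<Sum>b<k. w b * A $$ (b, j))"
  shows "Determinant.det (four_block_mat r (0\<^sub>m 1 1) A c)
    = (- 1) ^ (k + 1) * Determinant.det A * (\<Sum>b<k. w b * c $$ (b, 0))"
proof -
  let ?M = "four_block_mat r (0\<^sub>m 1 1) A c"
  \<comment> \<open>Left multiplication by the unipotent \<open>E\<close> subtracts from the border
    row the combination of rows of \<open>A\<close> that equals \<open>r\<close>. Only the last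
    entry remains, minus the sum of \<open>w b * c $$ (b, 0)\<close>; with the sign
    \<open>(- 1) ^ k\<close> of its position this gives \<open>(- 1) ^ (k + 1)\<close>.\<close>
  define E where "E = mat (Suc k) (Suc k) (\<lambda>(i, j). if i = j then 1 else if i = 0 then - w (j - 1) else 0)"
  have E: "E \<in> carrier_mat (Suc k) (Suc k)" by (simp add: E_def)
  have M: "?M \<in> carrier_mat (Suc k) (Suc k)" using r c A by auto
  have EM: "E * ?M \<in> carrier_mat (Suc k) (Suc k)" using E M by auto
  have "upper_triangular E" by (auto simp: E_def)
  from det_upper_triangular[OF this E] have "Determinant.det E = 1"
    by (simp add: E_def diag_mat_def prod.distinct_set_conv_list[symmetric] del: upt_Suc)
  then have det: "Determinant.det ?M = Determinant.det (E * ?M)"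
    using det_mult[OF E M] by simp
  have EM0: "(E * ?M) $$ (0, j) = ?M $$ (0, j) - (\<Sum>b<k. w b * ?M $$ (Suc b, j))" if "j < Suc k" for j
  proof -
    have "(E * ?M) $$ (0, j) = (\<Sum>l<Suc k. E $$ (0, l) * ?M $$ (l, j))"
      using ent_mult[OF E M _ that, of 0] by (simp only: fun_mult_def zero_less_Suc)
    also have "\<dots> = E $$ (0, 0) * ?M $$ (0, j) + (\<Sum>b<k. E $$ (0, Suc b) * ?M $$ (Suc b, j))"
      by (rule sum.lessThan_Suc_shift)
    finally show ?thesis by (simp add: E_def sum_negf)
  qed
  have EMS: "(E * ?M) $$ (Suc i, j) = ?M $$ (Suc i, j)" if "i < k" "j < Suc k" for i j
  proof -
    have "(E * ?M) $$ (Suc i, j) = (\<Sum>l<Suc k. E $$ (Suc i, l) * ?M $$ (l, j))"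
      using ent_mult[OF E M, of "Suc i" j] that by (simp only: fun_mult_def Suc_less_eq)
    also have "\<dots> = (\<Sum>l<Suc k. if l = Suc i then ?M $$ (l, j) else 0)"
      using that by (intro sum.cong) (auto simp: E_def)
    finally show ?thesis using that by simp
  qed
  have low: "?M $$ (Suc i, j) = A $$ (i, j)" if "i < k" "j < k" for i j
    using that A r c by simp
  have low': "?M $$ (Suc i, k) = c $$ (i, 0)" if "i < k" for i
    using that A r c by simp
  have z: "(E * ?M) $$ (0, j) = 0" if "j < k" for j
    unfolding EM0[OF less_SucI[OF that]] using that r A c w[OF that] by (simp add: low)
  have l: "(E * ?M) $$ (0, k) = - (\<Sum>b<k. w b * c $$ (b, 0))"
    using EM0[of k] r A c by (simp add: low')
  define P where "P = E * ?M"
  have P: "P \<in> carrier_mat (Suc k) (Suc k)" "\<And>j. j < k \<Longrightarrow> P $$ (0, j) = 0"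
    "P $$ (0, k) = - (\<Sum>b<k. w b * c $$ (b, 0))"
    "\<And>i j. i < k \<Longrightarrow> j < k \<Longrightarrow> P $$ (Suc i, j) = A $$ (i, j)"
    using EM z l EMS low by (simp_all add: P_def)
  have del: "mat_delete P 0 k = A"
    by (rule eq_matI) (use A P(1,4) in \<open>auto simp: mat_delete_def\<close>)
  have "Determinant.det P = (\<Sum>j<Suc k. P $$ (0, j) * cofactor P 0 j)"
    by (rule laplace_expansion_row[OF P(1)]) simp
  also have "\<dots> = P $$ (0, k) * cofactor P 0 k" using P(2) by simp
  also have "\<dots> = (- 1) ^ (k + 1) * Determinant.det A * (\<Sum>b<k. w b * c $$ (b, 0))"
    by (simp add: P(3) cofactor_def del)
  finally show ?thesis using det by (simp add: P_def)
qed

lemma row_solve: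
  fixes A :: "'a::field mat"
  assumes A: "A \<in> carrier_mat k k" and d: "Determinant.det A \<noteq> 0"
  shows "\<exists>w. \<forall>j<k. r j = (\<Sum>b<k. w b * A $$ (b, j))"
proof -
  let ?w = "\<lambda>b. (\<Sum>i<k. r i * adj_mat A $$ (i, b)) / Determinant.det A"
  have adj: "adj_mat A \<in> carrier_mat k k" "adj_mat A * A = Determinant.det A \<cdot>\<^sub>m 1\<^sub>m k"
    using adj_mat[OF A] by auto
  have "(\<Sum>b<k. ?w b * A $$ (b, j)) = r j" if j: "j < k" for j
  proof -
    have "(\<Sum>b<k. ?w b * A $$ (b, j)) = (\<Sum>b<k. \<Sum>i<k. r i * (adj_mat A $$ (i, b) * A $$ (b, j))) / Determinant.det A"
      by (simp add: sum_distrib_right sum_divide_distrib mult.assoc)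
    also have "(\<Sum>b<k. \<Sum>i<k. r i * (adj_mat A $$ (i, b) * A $$ (b, j))) = (\<Sum>i<k. r i * (adj_mat A * A) $$ (i, j))"
      by (subst sum.swap) (use ent_mult[OF adj(1) A] j in \<open>simp add: fun_mult_def sum_distrib_left del: index_mult_mat\<close>)
    also have "\<dots> = (\<Sum>i<k. if i = j then r i * Determinant.det A else 0)"
      using j by (intro sum.cong) (auto simp: adj)
    also have "\<dots> = r j * Determinant.det A" using j by simp
    finally show ?thesis using d by simp
  qed
  then show ?thesis by (intro exI[of _ ?w]) auto
qed

text \<open>\<open>N\<close> is a Gauss elimination matrix: it subtracts multiples of the last \<open>k\<close> rows from the middle
  rows so as to clear their first \<open>k\<close> entries. The middle block of \<open>N Y\<close> is then the Schur complement
  of the lower left corner of \<open>Y\<close>.\<close>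

definition schur_elim :: "nat \<Rightarrow> nat \<Rightarrow> (nat \<Rightarrow> nat \<Rightarrow> 'a::comm_ring_1) \<Rightarrow> (nat \<Rightarrow> nat \<Rightarrow> 'a) \<Rightarrow> bool" where
  "schur_elim n k Y N \<longleftrightarrow>
     (\<forall>i<n. \<forall>j<n. i \<notin> {k..<n-k} \<longrightarrow> N i j = 0) \<and>
     (\<forall>i\<in>{k..<n-k}. \<forall>j<n-k. N i j = (if i = j then 1 else 0)) \<and>
     (\<forall>i<n. \<forall>c<k. fun_mult n N Y i c = 0)"

lemma fun_mult_elim_row:
  fixes N Y :: "nat \<Rightarrow> nat \<Rightarrow> 'a::comm_ring_1"
  assumes "i \<in> {k..<n-k}" "\<And>j. j < n - k \<Longrightarrow> N i j = (if i = j then 1 else 0)"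
  shows "fun_mult n N Y i c = Y i c + (\<Sum>b\<in>{n-k..<n}. N i b * Y b c)"
proof -
  have "fun_mult n N Y i c = (\<Sum>j\<in>{..<n-k} \<union> {n-k..<n}. N i j * Y j c)"
    unfolding fun_mult_def using assms(1) by (intro sum.cong) auto
  also have "\<dots> = (\<Sum>j<n-k. N i j * Y j c) + (\<Sum>b\<in>{n-k..<n}. N i b * Y b c)"
    by (rule sum.union_disjoint) auto
  also have "(\<Sum>j<n-k. N i j * Y j c) = (\<Sum>j<n-k. if i = j then Y j c else 0)"
    by (rule sum.cong) (auto simp: assms(2))
  also have "\<dots> = Y i c" using assms(1) by simp
  finally show ?thesis .
qed

text \<open>In \<open>B N C\<close> the first \<open>k\<close> rows may fill up, so
  \<open>N'\<close> keeps the middle rows only. There \<open>N' Y'\<close> equals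
  \<open>B (N Y) C\<close>, and the vanishing first \<open>k\<close> columns of \<open>N Y\<close>
  survive multiplication by the triangular \<open>C\<close>. The middle blocks of \<open>B\<close>
  and \<open>C\<close> are inverse to each other, so the middle block of \<open>N Y\<close> is
  conjugated and keeps its trace.\<close>

lemma schur_elim_conj:
  fixes Y N :: "nat \<Rightarrow> nat \<Rightarrow> 'a::field"
  assumes k: "2 * k \<le> n" and inv: "inverse_pair n B C" and N: "schur_elim n k Y N"
  defines "Y' \<equiv> fun_mult n (fun_mult n (ent B) Y) (ent C)"
  defines "N' \<equiv> (\<lambda>i j. if i \<in> {k..<n-k} then fun_mult n (fun_mult n (ent B) N) (ent C) i j else 0)"
  shows "schur_elim n k Y' N'"
    and "(\<Sum>i\<in>{k..<n-k}. fun_mult n N' Y' i i) = (\<Sum>i\<in>{k..<n-k}. fun_mult n N Y i i)"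
proof -
  let ?B = "ent B" and ?C = "ent C"
  have B0: "?B i e = 0" if "e < i" "i < n" for i e
    using inverse_pair_fun_upper(1)[OF inv] that by (auto simp: fun_upper_def)
  have C0: "?C i e = 0" if "e < i" "i < n" for i e
    using inverse_pair_fun_upper(2)[OF inv] that by (auto simp: fun_upper_def)
  have BC: "fun_mult n ?B ?C i j = (if i = j then 1 else 0)" "fun_mult n ?C ?B i j = (if i = j then 1 else 0)"
    if "i < n" "j < n" for i j
    using inverse_pair_fun_mult[OF inv that] by auto
  have N0: "N i j = 0" if "i < n" "j < n" "i \<notin> {k..<n-k}" for i j
    using N that by (auto simp: schur_elim_def)
  have N1: "N i j = (if i = j then 1 else 0)" if "i \<in> {k..<n-k}" "j < n - k" for i j
    using N that by (auto simp: schur_elim_def)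
  have NY: "fun_mult n N Y i c = 0" if "i < n" "c < k" for i c
    using N that by (auto simp: schur_elim_def)
  have NY0: "fun_mult n N Y i c = 0" if "i < n" "i \<notin> {k..<n-k}" for i c
    unfolding fun_mult_def using N0 that by (intro sum.neutral) auto
  have N'1: "N' i j = (if i = j then 1 else 0)" if i: "i \<in> {k..<n-k}" and j: "j < n - k" for i j
  proof -
    have NC: "fun_mult n N ?C a j = (if a \<in> {k..<n-k} then ?C a j else 0)" if a: "a < n" for a
    proof (cases "a \<in> {k..<n-k}")
      case True
      have "(\<Sum>b\<in>{n-k..<n}. N a b * ?C b j) = 0"
        using C0 j by (intro sum.neutral) auto
      then show ?thesis using True fun_mult_elim_row[of a k n N ?C j] N1 by simp
    next
      case False
      then show ?thesis unfolding fun_mult_def using N0 a by (auto intro!: sum.neutral)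
    qed
    have "N' i j = fun_mult n ?B (fun_mult n N ?C) i j" using i by (simp add: N'_def fun_mult_assoc)
    \<comment> \<open>Here \<open>N\<close> acts like the identity: \<open>B\<close> kills the rows
      \<open>a < k\<close>, \<open>C\<close> kills the rows \<open>a\<close> from
      \<open>n - k\<close> on, and in the middle rows \<open>N C\<close> agrees with
      \<open>C\<close> in column \<open>j\<close>.\<close>
    also have "\<dots> = fun_mult n ?B ?C i j"
      unfolding fun_mult_def[of n ?B]
    proof (rule sum.cong)
      fix a assume "a \<in> {..<n}"
      then have a: "a < n" by simp
      consider "a < k" | "a \<in> {k..<n-k}" | "n - k \<le> a" by force
      then show "?B i a * fun_mult n N ?C a j = ?B i a * ?C a j"
      proof cases
        case 1
        then have "?B i a = 0" using i by (intro B0) auto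
        then show ?thesis by simp
      next
        case 2
        then show ?thesis using NC[OF a] by simp
      next
        case 3
        then have "?C a j = 0" using a j by (intro C0) auto
        then show ?thesis using NC[OF a] 3 by simp
      qed
    qed simp
    also have "\<dots> = (if i = j then 1 else 0)" using i j by (intro BC) auto
    finally show ?thesis .
  qed
  have N'Y': "fun_mult n N' Y' i c = fun_mult n (fun_mult n ?B (fun_mult n N Y)) ?C i c" if i: "i \<in> {k..<n-k}" and c: "c < n" for i c
  proof -
    have "fun_mult n N' Y' i c = fun_mult n (fun_mult n (fun_mult n ?B N) ?C) Y' i c"
      unfolding fun_mult_def[of n N'] fun_mult_def[of n "fun_mult n (fun_mult n ?B N) ?C"] using i by (simp add: N'_def)
    also have "\<dots> = fun_mult n (fun_mult n ?B N) (fun_mult n (fun_mult n ?C ?B) (fun_mult n Y ?C)) i c"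
      by (simp add: Y'_def fun_mult_assoc)
    also have "\<dots> = fun_mult n (fun_mult n ?B N) (fun_mult n Y ?C) i c"
      unfolding fun_mult_def[of n "fun_mult n ?B N"]
    proof (rule sum.cong)
      fix a assume "a \<in> {..<n}"
      then have "fun_mult n (fun_mult n ?C ?B) (fun_mult n Y ?C) a c = (\<Sum>e<n. if a = e then fun_mult n Y ?C e c else 0)"
        unfolding fun_mult_def[of n "fun_mult n ?C ?B"] by (intro sum.cong) (auto simp: BC)
      then show "fun_mult n ?B N i a * fun_mult n (fun_mult n ?C ?B) (fun_mult n Y ?C) a c = fun_mult n ?B N i a * fun_mult n Y ?C a c"
        using \<open>a \<in> {..<n}\<close> by simp
    qed simp
    finally show ?thesis by (simp add: fun_mult_assoc)
  qed
  have BNY: "fun_mult n ?B (fun_mult n N Y) i b = 0" if "b < k" for i b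
    unfolding fun_mult_def[of n ?B] using NY that by (intro sum.neutral) auto
  show "schur_elim n k Y' N'"
    unfolding schur_elim_def
  proof (intro conjI allI impI ballI)
    fix i c assume i: "i < n" and c: "c < k"
    show "fun_mult n N' Y' i c = 0"
    proof (cases "i \<in> {k..<n-k}")
      case True
      have "fun_mult n (fun_mult n ?B (fun_mult n N Y)) ?C i c = 0"
        unfolding fun_mult_def[of n "fun_mult n ?B (fun_mult n N Y)"]
      proof (rule sum.neutral, rule ballI)
        fix b assume "b \<in> {..<n}"
        then show "fun_mult n ?B (fun_mult n N Y) i b * ?C b c = 0"
          using BNY[of b i] C0[of c b] c by (cases "b < k") auto
      qed
      then show ?thesis using N'Y'[OF True, of c] c k by simp
    next
      case False
      then show ?thesis by (auto simp: N'_def fun_mult_def intro!: sum.neutral)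
    qed
  qed (auto simp: N'1, auto simp: N'_def)
  have CB': "(\<Sum>i\<in>{k..<n-k}. ?C b i * ?B i a) = (if b = a then 1 else 0)" if "a \<in> {k..<n-k}" "b \<in> {k..<n-k}" for a b
  proof -
    have "(\<Sum>i\<in>{k..<n-k}. ?C b i * ?B i a) = fun_mult n ?C ?B b a"
      unfolding fun_mult_def
    proof (rule sum.mono_neutral_left)
      show "\<forall>i\<in>{..<n} - {k..<n-k}. ?C b i * ?B i a = 0"
      proof
        fix i assume i: "i \<in> {..<n} - {k..<n-k}"
        then show "?C b i * ?B i a = 0"
          using that B0[of a i] C0[of i b] by (cases "i < k") auto
      qed
    qed auto
    also have "\<dots> = (if b = a then 1 else 0)" using that by (intro BC) auto
    finally show ?thesis .
  qed
  have red: "fun_mult n (fun_mult n ?B (fun_mult n N Y)) ?C i i = (\<Sum>b\<in>{k..<n-k}. \<Sum>a\<in>{k..<n-k}. ?B i a * fun_mult n N Y a b * ?C b i)"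
    if i: "i \<in> {k..<n-k}" for i
  proof -
    have "fun_mult n (fun_mult n ?B (fun_mult n N Y)) ?C i i = (\<Sum>b\<in>{k..<n-k}. fun_mult n ?B (fun_mult n N Y) i b * ?C b i)"
      unfolding fun_mult_def[of n "fun_mult n ?B (fun_mult n N Y)"]
    proof (rule sum.mono_neutral_right)
      show "\<forall>b\<in>{..<n} - {k..<n-k}. fun_mult n ?B (fun_mult n N Y) i b * ?C b i = 0"
      proof
        fix b assume "b \<in> {..<n} - {k..<n-k}"
        then show "fun_mult n ?B (fun_mult n N Y) i b * ?C b i = 0"
          using i BNY[of b i] C0[of i b] by (cases "b < k") auto
      qed
    qed auto
    also have "\<dots> = (\<Sum>b\<in>{k..<n-k}. (\<Sum>a\<in>{k..<n-k}. ?B i a * fun_mult n N Y a b) * ?C b i)"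
    proof (rule sum.cong)
      fix b
      have "fun_mult n ?B (fun_mult n N Y) i b = (\<Sum>a\<in>{k..<n-k}. ?B i a * fun_mult n N Y a b)"
        unfolding fun_mult_def[of n ?B] by (rule sum.mono_neutral_right) (auto simp: NY0)
      then show "fun_mult n ?B (fun_mult n N Y) i b * ?C b i = (\<Sum>a\<in>{k..<n-k}. ?B i a * fun_mult n N Y a b) * ?C b i" by simp
    qed simp
    finally show ?thesis by (simp add: sum_distrib_right)
  qed
  have "(\<Sum>i\<in>{k..<n-k}. fun_mult n N' Y' i i)
      = (\<Sum>i\<in>{k..<n-k}. \<Sum>b\<in>{k..<n-k}. \<Sum>a\<in>{k..<n-k}. ?B i a * fun_mult n N Y a b * ?C b i)"
    by (rule sum.cong) (auto simp: N'Y' red)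
  also have "\<dots> = (\<Sum>b\<in>{k..<n-k}. \<Sum>a\<in>{k..<n-k}. \<Sum>i\<in>{k..<n-k}. ?B i a * fun_mult n N Y a b * ?C b i)"
    by (subst sum.swap, rule sum.cong[OF refl], rule sum.swap)
  also have "\<dots> = (\<Sum>b\<in>{k..<n-k}. \<Sum>a\<in>{k..<n-k}. fun_mult n N Y a b * (\<Sum>i\<in>{k..<n-k}. ?C b i * ?B i a))"
    by (simp add: sum_distrib_left mult_ac)
  also have "\<dots> = (\<Sum>b\<in>{k..<n-k}. \<Sum>a\<in>{k..<n-k}. if b = a then fun_mult n N Y a b else 0)"
    by (intro sum.cong refl) (simp add: CB')
  also have "\<dots> = (\<Sum>b\<in>{k..<n-k}. fun_mult n N Y b b)" by simp
  finally show "(\<Sum>i\<in>{k..<n-k}. fun_mult n N' Y' i i) = (\<Sum>i\<in>{k..<n-k}. fun_mult n N Y i i)" .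
qed

text \<open>The second sum involves only strictly lower entries of \<open>Y\<close>, since
  \<open>i < n - k\<close> and \<open>n - k \<le> b\<close>. Discarding the upper part therefore
  changes only the first sum.\<close>

lemma schur_trace:
  assumes "schur_elim n k Y N"
  shows "(\<Sum>i\<in>{k..<n-k}. fun_mult n N Y i i) =
    (\<Sum>i\<in>{k..<n-k}. Y i i) + (\<Sum>i\<in>{k..<n-k}. \<Sum>b\<in>{n-k..<n}. N i b * Y b i)"
  unfolding sum.distrib[symmetric]
  by (rule sum.cong) (use assms in \<open>auto simp: schur_elim_def fun_mult_elim_row\<close>)

text \<open>In the first \<open>k\<close> columns the entries on or above the diagonal lie in the
  first \<open>k\<close> rows, where the entries of \<open>N\<close> are zero. The same
  \<open>N\<close> thus eliminates for \<open>B X C\<close> and for its strictly lower part.\<close>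

lemma schur_elim_cong:
  assumes N: "schur_elim n k Y N" and k: "2 * k \<le> n"
    and eq: "\<And>i j. j < i \<Longrightarrow> i < n \<Longrightarrow> Y i j = Y' i j"
  shows "schur_elim n k Y' N"
proof -
  have "fun_mult n N Y' i c = fun_mult n N Y i c" if "i < n" "c < k" for i c
    unfolding fun_mult_def
  proof (rule sum.cong)
    fix a assume a: "a \<in> {..<n}"
    have "N i a = 0" if "a \<le> c"
      using that \<open>i < n\<close> \<open>c < k\<close> k N a by (cases "i \<in> {k..<n-k}") (auto simp: schur_elim_def)
    then show "N i a * Y' a c = N i a * Y a c"
      using eq[of c a] a by (cases "a \<le> c") auto
  qed simp
  then show ?thesis using N unfolding schur_elim_def by simp
qed

lemma schur_elim_exists:
  fixes x :: "nat \<times> nat \<Rightarrow> 'a::field"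
  assumes k: "2 * k \<le> n" and d: "minor n x k \<noteq> 0"
  obtains N where "schur_elim n k (ent (Xmat n x)) N"
proof -
  let ?Y = "ent (Xmat n x)"
  define A where "A = block (Xmat n x) (n - k + 1) n 1 k"
  have A: "A \<in> carrier_mat k k" using k by (auto simp: A_def block_def)
  have Ae: "A $$ (b, j) = ?Y (n - k + b) j" if "b < k" "j < k" for b j
    using that k by (simp add: A_def block_def)
  have "\<forall>i. \<exists>w. \<forall>j<k. ?Y i j = (\<Sum>b<k. w b * A $$ (b, j))"
    by (intro allI row_solve[OF A]) (use d in \<open>simp add: A_def minor_def\<close>)
  then obtain w where w: "\<And>i j. j < k \<Longrightarrow> ?Y i j = (\<Sum>b<k. w i b * A $$ (b, j))" by metis
  define N where "N i j = (if i \<in> {k..<n-k} then if j < n - k then if i = j then 1 else 0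
    else - w i (j - (n - k)) else 0)" for i j
  have "fun_mult n N ?Y i c = 0" if "i < n" "c < k" for i c
  proof (cases "i \<in> {k..<n-k}")
    case True
    have "fun_mult n N ?Y i c = ?Y i c + (\<Sum>b\<in>{n-k..<n}. N i b * ?Y b c)"
      by (rule fun_mult_elim_row[OF True]) (use True in \<open>simp add: N_def\<close>)
    also have "(\<Sum>b\<in>{n-k..<n}. N i b * ?Y b c) = (\<Sum>b<k. - (w i b * A $$ (b, c)))"
    proof -
      have "k \<le> n" using k by simp
      then show ?thesis
        unfolding sum_tail[OF \<open>k \<le> n\<close>] by (intro sum.cong refl) (use True that k in \<open>simp add: N_def Ae[OF _ that(2)]\<close>)
    qed
    finally show ?thesis using w[OF that(2), of i] by (simp add: sum_negf)
  next
    case False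
    then show ?thesis by (auto simp: fun_mult_def N_def intro!: sum.neutral)
  qed
  then have "schur_elim n k ?Y N" by (auto simp: schur_elim_def N_def)
  then show ?thesis by (rule that)
qed

text \<open>The bordered determinants give, up to sign, the correction that turns the middle trace
  into the Schur trace; the factor \<open>(- 1) ^ (k + 1)\<close> removes the sign of the
  determinant. The index shifts by one because matrix entries count from 0.\<close>

lemma second_kind_term:
  fixes x :: "nat \<times> nat \<Rightarrow> 'a::field"
  assumes k: "2 * k \<le> n" and d: "minor n x k \<noteq> 0" and N: "schur_elim n k (ent (Xmat n x)) N"
  shows "(- 1) ^ (k + 1) / minor n x k *
     (\<Sum>i\<in>{k<..<n - k + 1}. Determinant.det (four_block_mat
        (block (Xmat n x) i i 1 k)           (0\<^sub>m 1 1)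
        (block (Xmat n x) (n - k + 1) n 1 k) (block (Xmat n x) (n - k + 1) n i i)))
    = - (\<Sum>i\<in>{k..<n-k}. \<Sum>b\<in>{n-k..<n}. N i b * Xmat n x $$ (b, i))"
proof -
  let ?Y = "ent (Xmat n x)"
  let ?A = "block (Xmat n x) (n - k + 1) n 1 k"
  let ?D = "\<lambda>i. Determinant.det (four_block_mat (block (Xmat n x) i i 1 k) (0\<^sub>m 1 1) ?A
    (block (Xmat n x) (n - k + 1) n i i))"
  have A: "?A \<in> carrier_mat k k" using k by (auto simp: block_def)
  have shift: "(\<Sum>b<k. f (n - k + b)) = (\<Sum>b\<in>{n-k..<n}. f b)" for f :: "nat \<Rightarrow> 'a"
    by (rule sum_tail[symmetric]) (use k in simp)
  have D: "?D (Suc i) = (- 1) ^ (k + 1) * minor n x k * - (\<Sum>b\<in>{n-k..<n}. N i b * ?Y b i)"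
    if i: "i \<in> {k..<n-k}" for i
  proof -
    have "?D (Suc i) = (- 1) ^ (k + 1) * Determinant.det ?A *
      (\<Sum>b<k. - N i (n - k + b) * block (Xmat n x) (n - k + 1) n (Suc i) (Suc i) $$ (b, 0))"
    proof (rule det_bordered[OF A])
      show "block (Xmat n x) (Suc i) (Suc i) 1 k \<in> carrier_mat 1 k"
        "block (Xmat n x) (n - k + 1) n (Suc i) (Suc i) \<in> carrier_mat k 1"
        using k by (auto simp: block_def)
      fix j assume j: "j < k"
      have "0 = fun_mult n N ?Y i j" using N i j by (auto simp: schur_elim_def)
      also have "\<dots> = ?Y i j + (\<Sum>b\<in>{n-k..<n}. N i b * ?Y b j)"
        by (rule fun_mult_elim_row[OF i]) (use N i in \<open>auto simp: schur_elim_def\<close>)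
      finally have "?Y i j = - (\<Sum>b<k. N i (n - k + b) * ?Y (n - k + b) j)"
        unfolding shift[of "\<lambda>b. N i b * ?Y b j"] by (simp add: eq_neg_iff_add_eq_0)
      then show "block (Xmat n x) (Suc i) (Suc i) 1 k $$ (0, j) = (\<Sum>b<k. - N i (n - k + b) * ?A $$ (b, j))"
        using j k i by (simp add: block_def sum_negf)
    qed
    also have "(\<Sum>b<k. - N i (n - k + b) * block (Xmat n x) (n - k + 1) n (Suc i) (Suc i) $$ (b, 0))
        = - (\<Sum>b<k. N i (n - k + b) * ?Y (n - k + b) i)"
      using k i by (simp add: block_def sum_negf)
    also have "(\<Sum>b<k. N i (n - k + b) * ?Y (n - k + b) i) = (\<Sum>b\<in>{n-k..<n}. N i b * ?Y b i)"
      by (rule shift)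
    finally show ?thesis by (simp add: minor_def)
  qed
  have "(\<Sum>i\<in>{k<..<n - k + 1}. ?D i) = (\<Sum>i\<in>{k..<n-k}. ?D (Suc i))"
    by (rule sum.reindex_bij_witness[of _ Suc "\<lambda>i. i - 1"]) auto
  also have "\<dots> = (\<Sum>i\<in>{k..<n-k}. (- 1) ^ (k + 1) * minor n x k * - (\<Sum>b\<in>{n-k..<n}. N i b * ?Y b i))"
    by (rule sum.cong[OF refl D])
  also have "\<dots> = (- 1) ^ (k + 1) * minor n x k * - (\<Sum>i\<in>{k..<n-k}. \<Sum>b\<in>{n-k..<n}. N i b * ?Y b i)"
    unfolding sum_negf[symmetric] by (rule sum_distrib_left[symmetric])
  finally have "(\<Sum>i\<in>{k<..<n - k + 1}. ?D i) = (- 1) ^ (k + 1) * minor n x k * - (\<Sum>i\<in>{k..<n-k}. \<Sum>b\<in>{n-k..<n}. N i b * ?Y b i)" .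
  moreover have "(- 1) ^ (k + 1) * (- 1) ^ (k + 1) = (1 :: 'a)"
    by (simp add: power_add[symmetric])
  ultimately show ?thesis using d by (simp add: field_simps power_add[symmetric])
qed

text \<open>\<open>Z i\<close> occurs in the \<open>k\<close>-th inner sum exactly for
  \<open>k\<close> up to \<open>l = min i (n - 1 - i)\<close>. The differences telescope to
  \<open>g 1 - g (l + 1)\<close>, and the symmetry of \<open>g\<close> turns
  \<open>g (l + 1)\<close> into \<open>g (Suc i)\<close>. What is left is a multiple of the full
  trace.\<close>

lemma sum_telescope_parameters:
  fixes g :: "nat \<Rightarrow> 'a::comm_ring_1" and Z :: "nat \<Rightarrow> 'a"
  assumes sym: "\<And>k. k \<in> {1..n div 2} \<Longrightarrow> g k = g (n - k + 1)"
  shows "(\<Sum>i<n. g (Suc i) * Z i) + (\<Sum>k=1..n div 2. (g k - g (k + 1)) * (\<Sum>i\<in>{k..<n-k}. Z i))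
    = g 1 * (\<Sum>i<n. Z i)"
proof -
  have "(\<Sum>k=1..n div 2. (g k - g (k + 1)) * (\<Sum>i\<in>{k..<n-k}. Z i))
      = (\<Sum>k=1..n div 2. \<Sum>i<n. if i \<in> {k..<n-k} then (g k - g (k + 1)) * Z i else 0)"
  proof (rule sum.cong)
    fix k
    have "(\<Sum>i\<in>{k..<n-k}. Z i) = (\<Sum>i<n. if i \<in> {k..<n-k} then Z i else 0)"
      by (rule sum.mono_neutral_cong_left) auto
    then show "(g k - g (k + 1)) * (\<Sum>i\<in>{k..<n-k}. Z i)
        = (\<Sum>i<n. if i \<in> {k..<n-k} then (g k - g (k + 1)) * Z i else 0)"
      by (simp add: sum_distrib_left if_distrib cong: if_cong)
  qed simp
  also have "\<dots> = (\<Sum>i<n. \<Sum>k=1..n div 2. if i \<in> {k..<n-k} then (g k - g (k + 1)) * Z i else 0)"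
    by (rule sum.swap)
  also have "\<dots> = (\<Sum>i<n. (g 1 - g (Suc i)) * Z i)"
  proof (rule sum.cong)
    fix i assume "i \<in> {..<n}"
    then have i: "i < n" by simp
    define l where "l = min i (n - 1 - i)"
    have "(\<Sum>k=1..n div 2. if i \<in> {k..<n-k} then (g k - g (k + 1)) * Z i else 0)
        = (\<Sum>k=1..l. (g k - g (k + 1)) * Z i)"
      by (rule sum.mono_neutral_cong_right) (use i in \<open>auto simp: l_def\<close>)
    also have "\<dots> = (g 1 - g (l + 1)) * Z i"
      by (induction l) (simp_all add: algebra_simps)
    also have "g (l + 1) = g (Suc i)"
    proof (cases "i \<le> n - 1 - i")
      case True
      then show ?thesis by (simp add: l_def min_def)
    next
      case False
      then have "l + 1 = n - i" "n - i \<in> {1..n div 2}" "n - (n - i) + 1 = Suc i"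
        using i by (auto simp: l_def)
      then show ?thesis using sym[of "n - i"] by simp
    qed
    finally show "(\<Sum>k=1..n div 2. if i \<in> {k..<n-k} then (g k - g (k + 1)) * Z i else 0)
        = (g 1 - g (Suc i)) * Z i" .
  qed simp
  finally show ?thesis by (simp add: sum.distrib[symmetric] sum_distrib_left algebra_simps)
qed

lemma second_kind_coad:
  fixes \<gamma> :: "nat \<Rightarrow> nat \<Rightarrow> 'a::{real_normed_field, banach}"
  assumes adm: "admissible n s \<gamma>" and B: "B \<in> tri_group n s \<gamma>" and p: "p \<in> {1..s}"
    and sym: "\<And>k. k \<in> {1..n div 2} \<Longrightarrow> \<gamma> p k = \<gamma> p (n - k + 1)"
    and d: "\<And>k. k \<in> {1..n div 2} \<Longrightarrow> minor n x k \<noteq> 0"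
  shows "second_kind n \<gamma> p (coad n s \<gamma> B x) = second_kind n \<gamma> p x"
proof -
  obtain C where inv: "inverse_pair n B C" using tri_group_inverse_pair[OF B] .
  define x' where "x' = coad n s \<gamma> B x"
  define Z where "Z = conj_mat n B x C"
  let ?Y = "ent (Xmat n x)" and ?Y' = "ent (Xmat n x')"
  let ?T = "\<lambda>x k. (- 1) ^ (k + 1) / minor n x k *
     (\<Sum>i\<in>{k<..<n - k + 1}. Determinant.det (four_block_mat
        (block (Xmat n x) i i 1 k)           (0\<^sub>m 1 1)
        (block (Xmat n x) (n - k + 1) n 1 k) (block (Xmat n x) (n - k + 1) n i i)))"
  have ZY': "Z j i = ?Y' j i" if "i < j" "j < n" for i j
    using coad_lower[OF adm inv that, of x] that by (simp add: Z_def x'_def Xmat_def)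
  \<comment> \<open>The Schur traces of \<open>X\<close> and \<open>Z\<close> agree. As
    \<open>X\<close> has zero diagonal, replacing \<open>Z\<close> by its strictly lower part costs
    exactly the middle diagonal of \<open>Z\<close>.\<close>
  have T: "?T x' k = ?T x k + (\<Sum>i\<in>{k..<n-k}. Z i i)" if k: "k \<in> {1..n div 2}" for k
  proof -
    have 2: "2 * k \<le> n" using k by auto
    obtain N where N: "schur_elim n k ?Y N" using schur_elim_exists[OF 2 d[OF k]] .
    define N' where "N' i j = (if i \<in> {k..<n-k} then fun_mult n (fun_mult n (ent B) N) (ent C) i j else 0)" for i j
    have N': "schur_elim n k Z N'" and t: "(\<Sum>i\<in>{k..<n-k}. fun_mult n N' Z i i) = (\<Sum>i\<in>{k..<n-k}. fun_mult n N ?Y i i)"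
      using schur_elim_conj[OF 2 inv N] unfolding Z_def conj_mat_def N'_def by auto
    have "minor n x' k \<noteq> 0"
    proof -
      obtain \<epsilon> where "minor n x' k = minor n x k * exp (- (\<Sum>p=1..s. \<epsilon> p * alpha n \<gamma> p k))"
        using minor_coad[OF adm B] k unfolding x'_def by (metis atLeastAtMost_iff)
      then show ?thesis using d[OF k] by simp
    qed
    then have "?T x' k = - (\<Sum>i\<in>{k..<n-k}. \<Sum>b\<in>{n-k..<n}. N' i b * ?Y' b i)"
      using second_kind_term[OF 2 _ schur_elim_cong[OF N' 2 ZY']] by simp
    also have "\<dots> = - (\<Sum>i\<in>{k..<n-k}. \<Sum>b\<in>{n-k..<n}. N' i b * Z b i)"
      by (intro arg_cong[where f = uminus] sum.cong refl) (use ZY' in auto)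
    also have "\<dots> = (\<Sum>i\<in>{k..<n-k}. Z i i) - (\<Sum>i\<in>{k..<n-k}. fun_mult n N ?Y i i)"
      unfolding t[symmetric] schur_trace[OF N'] by simp
    also have "(\<Sum>i\<in>{k..<n-k}. fun_mult n N ?Y i i) = - ?T x k"
    proof -
      have "(\<Sum>i\<in>{k..<n-k}. ?Y i i) = 0" by (rule sum.neutral) (auto simp: Xmat_def)
      then show ?thesis unfolding schur_trace[OF N] second_kind_term[OF 2 d[OF k] N] by simp
    qed
    finally show ?thesis by simp
  qed
  \<comment> \<open>\<open>Z\<close> is conjugate to the strictly lower triangular
    \<open>X\<close>.\<close>
  have trZ: "(\<Sum>i<n. Z i i) = 0"
  proof -
    have "(\<Sum>i<n. Z i i) = fun_trace n (fun_mult n (fun_mult n (ent C) (ent B)) ?Y)"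
      unfolding Z_def conj_mat_def fun_trace_def[symmetric] by (subst fun_trace_fun_mult_commute) (simp add: fun_mult_assoc)
    also have "\<dots> = (\<Sum>i<n. \<Sum>e<n. if i = e then ?Y e i else 0)"
      unfolding fun_trace_def fun_mult_def[of n _ ?Y] by (intro sum.cong) (auto simp: inverse_pair_fun_mult[OF inv])
    also have "\<dots> = 0" by (simp add: Xmat_def)
    finally show ?thesis .
  qed
  have S: "second_kind n \<gamma> p y = y (p, 0) + (\<Sum>k=1..n div 2. (\<gamma> p k - \<gamma> p (k + 1)) * ?T y k)" for y
    unfolding second_kind_def by (intro arg_cong2[where f = "(+)"] sum.cong refl) (simp only: mult_ac)
  have tel: "(\<Sum>i<n. \<gamma> p (Suc i) * Z i i) +
      (\<Sum>k=1..n div 2. (\<gamma> p k - \<gamma> p (k + 1)) * (\<Sum>i\<in>{k..<n-k}. Z i i)) = \<gamma> p 1 * (\<Sum>i<n. Z i i)"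
    by (rule sum_telescope_parameters) (rule sym)
  have "second_kind n \<gamma> p x' = x' (p, 0) + (\<Sum>k=1..n div 2. (\<gamma> p k - \<gamma> p (k + 1)) * (?T x k + (\<Sum>i\<in>{k..<n-k}. Z i i)))"
    unfolding S by (intro arg_cong2[where f = "(+)"] sum.cong refl) (simp only: T)
  also have "x' (p, 0) = x (p, 0) + (\<Sum>i<n. \<gamma> p (Suc i) * Z i i)"
    unfolding x'_def Z_def by (rule coad_diag[OF adm inv p])
  also have "x (p, 0) + (\<Sum>i<n. \<gamma> p (Suc i) * Z i i) +
      (\<Sum>k=1..n div 2. (\<gamma> p k - \<gamma> p (k + 1)) * (?T x k + (\<Sum>i\<in>{k..<n-k}. Z i i)))
    = second_kind n \<gamma> p x + ((\<Sum>i<n. \<gamma> p (Suc i) * Z i i) +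
      (\<Sum>k=1..n div 2. (\<gamma> p k - \<gamma> p (k + 1)) * (\<Sum>i\<in>{k..<n-k}. Z i i)))"
    unfolding S distrib_left sum.distrib by (simp only: add_ac)
  also have "\<dots> = second_kind n \<gamma> p x"
    by (simp only: tel trZ mult_zero_right add_0_right)
  finally show ?thesis unfolding x'_def .
qed

section \<open>Dependence of the minors on the coordinates\<close>

lemma minor_cong:
  assumes "k \<le> n div 2"
    and "\<And>a b. a < k \<Longrightarrow> b < k \<Longrightarrow> x (Suc (n - k + a), Suc b) = y (Suc (n - k + a), Suc b)"
  shows "minor n x k = minor n y k"
proof -
  have "block (Xmat n x) (n - k + 1) n 1 k = block (Xmat n y) (n - k + 1) n 1 k"
    by (rule eq_matI) (use assms in \<open>auto simp: block_def Xmat_def\<close>)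
  then show ?thesis by (simp add: minor_def)
qed

lemma minor_upd_other:
  assumes "k \<le> n div 2" "b = 0 \<or> k < b"
  shows "minor n (x((a, b) := t)) k = minor n x k"
  by (rule minor_cong) (use assms in auto)

text \<open>The entry sits at the right end of the first row of the block. No cofactor of that row
  contains it, so the minor is affine in it, and the slope is its cofactor, the previous minor up to
  sign.\<close>

lemma minor_upd_corner:
  fixes x :: "nat \<times> nat \<Rightarrow> 'a::comm_ring_1"
  assumes k: "1 \<le> k" "k \<le> n div 2"
  shows "minor n (x((n - k + 1, k) := t)) k
    = minor n x k + (t - x (n - k + 1, k)) * ((- 1) ^ (k - 1) * minor n x (k - 1))"
proof -
  define M where "M = (\<lambda>x :: nat \<times> nat \<Rightarrow> 'a. block (Xmat n x) (n - k + 1) n 1 k)"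
  define x' where "x' = x((n - k + 1, k) := t)"
  have x'e: "x' (Suc (n - k + a), Suc b) = x (Suc (n - k + a), Suc b)" if "a \<noteq> 0 \<or> b < k - 1" for a b
    using that by (auto simp: x'_def)
  have car: "M y \<in> carrier_mat k k" for y :: "nat \<times> nat \<Rightarrow> 'a" using k by (auto simp: M_def block_def)
  have e: "M y $$ (a, b) = y (Suc (n - k + a), Suc b)" if "a < k" "b < k" for y :: "nat \<times> nat \<Rightarrow> 'a" and a b
    using that k by (auto simp: M_def block_def Xmat_def)
  have del: "mat_delete (M x') 0 j = mat_delete (M x) 0 j" if "j < k" for j
  proof (rule eq_matI)
    fix a b assume "a < dim_row (mat_delete (M x) 0 j)" "b < dim_col (mat_delete (M x) 0 j)"
    then have "a < k - 1" "b < k - 1" using car[of x] by auto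
    then show "mat_delete (M x') 0 j $$ (a, b) = mat_delete (M x) 0 j $$ (a, b)"
      using car[of x] car[of x'] e[of "Suc a"] x'e[of "Suc a"] by (auto simp: mat_delete_def)
  qed (use car[of x] car[of x'] in auto)
  have last: "mat_delete (M x) 0 (k - 1) = block (Xmat n x) (n - (k - 1) + 1) n 1 (k - 1)"
  proof (rule eq_matI)
    fix a b assume "a < dim_row (block (Xmat n x) (n - (k - 1) + 1) n 1 (k - 1))"
      "b < dim_col (block (Xmat n x) (n - (k - 1) + 1) n 1 (k - 1))"
    then have ab: "a < k - 1" "b < k - 1" using k by (auto simp: block_def)
    have "n - (k - 1) + a = n - k + Suc a" using k ab by linarith
    then show "mat_delete (M x) 0 (k - 1) $$ (a, b) = block (Xmat n x) (n - (k - 1) + 1) n 1 (k - 1) $$ (a, b)"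
      using ab k car[of x] e[of "Suc a" b x] by (auto simp: mat_delete_def block_def Xmat_def)
  qed (use k car[of x] in \<open>auto simp: block_def\<close>)
  have ks: "{..<k} = insert (k - 1) {..<k - 1}" using k by auto
  have L: "minor n y k = (\<Sum>j<k - 1. M y $$ (0, j) * cofactor (M y) 0 j)
      + M y $$ (0, k - 1) * cofactor (M y) 0 (k - 1)" for y :: "nat \<times> nat \<Rightarrow> 'a"
  proof -
    have "minor n y k = Determinant.det (M y)" by (simp add: minor_def M_def)
    then show ?thesis using laplace_expansion_row[OF car, of 0 y] k by (simp add: ks add.commute)
  qed
  have "(\<Sum>j<k - 1. M x' $$ (0, j) * cofactor (M x') 0 j) = (\<Sum>j<k - 1. M x $$ (0, j) * cofactor (M x) 0 j)"
    by (rule sum.cong) (use k in \<open>auto simp: e cofactor_def del x'e[of 0, simplified]\<close>)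
  moreover have "M y $$ (0, k - 1) = y (n - k + 1, k)" for y :: "nat \<times> nat \<Rightarrow> 'a"
    using e[of 0 "k - 1" y] k by simp
  moreover have "cofactor (M x') 0 (k - 1) = (- 1) ^ (k - 1) * minor n x (k - 1)"
    "cofactor (M x) 0 (k - 1) = (- 1) ^ (k - 1) * minor n x (k - 1)"
    using del[of "k - 1"] k last by (simp_all add: cofactor_def minor_def)
  moreover have "x' (n - k + 1, k) = t" by (simp add: x'_def)
  ultimately show ?thesis
    unfolding x'_def[symmetric] L[of x'] L[of x] by (simp add: algebra_simps)
qed

lemma minor_0 [simp]: "minor n x 0 = 1"
  by (simp add: minor_def block_def)

lemma corner_in_basis_idx: "1 \<le> k \<Longrightarrow> k \<le> n div 2 \<Longrightarrow> (n - k + 1, k) \<in> basis_idx n s"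
  by (auto simp: basis_idx_def)

lemma partial_deriv_minor_corner:
  assumes "1 \<le> k" "k \<le> n div 2"
  shows "partial_deriv (n - k + 1, k) (\<lambda>x. minor n x k) x = (- 1) ^ (k - 1) * minor n x (k - 1)"
  unfolding partial_deriv_def minor_upd_corner[OF assms]
  by (rule DERIV_imp_deriv) (auto intro!: derivative_eq_intros)

lemma partial_deriv_minor_0:
  assumes "k \<le> n div 2" "b = 0 \<or> k < b"
  shows "partial_deriv (a, b) (\<lambda>x. minor n x k) x = 0"
  unfolding partial_deriv_def minor_upd_other[OF assms] by simp

text \<open>The differentials are triangular with respect to the corner coordinates. The induction
  runs downward from the largest \<open>k\<close>: at the corner of \<open>k\<close>, larger indices
  already have coefficient 0 and smaller minors do not depend on the entry.\<close>

lemma minors_independent: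
  fixes b :: "nat \<Rightarrow> 'a::real_normed_field"
  assumes nz: "\<And>k. k \<in> {1..n div 2} \<Longrightarrow> minor n x k \<noteq> 0"
    and 0: "\<And>c. c \<in> basis_idx n s \<Longrightarrow> (\<Sum>k=1..n div 2. b k * partial_deriv c (\<lambda>x. minor n x k) x) = 0"
    and k: "k \<in> {1..n div 2}"
  shows "b k = 0"
  using k
proof (induction "n - k" arbitrary: k rule: less_induct)
  case less
  have "0 = (\<Sum>j=1..n div 2. b j * partial_deriv (n - k + 1, k) (\<lambda>x. minor n x j) x)"
    using 0[OF corner_in_basis_idx] less.prems by simp
  also have "\<dots> = (\<Sum>j\<in>{k}. b j * partial_deriv (n - k + 1, k) (\<lambda>x. minor n x j) x)"
  proof (rule sum.mono_neutral_right)
    show "\<forall>j\<in>{1..n div 2} - {k}. b j * partial_deriv (n - k + 1, k) (\<lambda>x. minor n x j) x = 0"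
    proof
      fix j assume j: "j \<in> {1..n div 2} - {k}"
      show "b j * partial_deriv (n - k + 1, k) (\<lambda>x. minor n x j) x = 0"
      proof (cases "j < k")
        case True
        then show ?thesis using partial_deriv_minor_0[of j n k "n - k + 1" x] j by simp
      next
        case False
        then have "b j = 0" using j less.prems by (intro less.hyps) auto
        then show ?thesis by simp
      qed
    qed
  qed (use less.prems in auto)
  also have "\<dots> = b k * ((- 1) ^ (k - 1) * minor n x (k - 1))"
    using partial_deriv_minor_corner[of k n x] less.prems by simp
  finally have "b k = 0 \<or> minor n x (k - 1) = 0" by simp
  moreover have "minor n x (k - 1) \<noteq> 0"
  proof (cases "k = 1")
    case False
    then have "k - 1 \<in> {1..n div 2}" using less.prems by auto
    then show ?thesis by (rule nz)
  qed simp
  ultimately show ?case by blast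
qed

text \<open>The minors are made nonzero one at a time, in increasing order: moving the corner of the
  next one changes it with slope plus or minus the previous minor and leaves all smaller ones
  alone.\<close>

lemma minors_nonzero_dense:
  fixes U :: "(nat \<times> nat \<Rightarrow> 'a::real_normed_field) set"
  assumes "openin (top_of_set (coord_space n s)) U" "U \<noteq> {}" "m \<le> n div 2"
  shows "\<exists>y\<in>U. \<forall>k\<in>{1..m}. minor n y k \<noteq> 0"
  using assms(3)
proof (induction m)
  case 0
  then show ?case using assms(2) by auto
next
  case (Suc m)
  then obtain y where y: "y \<in> U" "\<forall>k\<in>{1..m}. minor n y k \<noteq> 0" by auto
  let ?c = "(n - Suc m + 1, Suc m)"
  have lower: "minor n (y(?c := t)) k = minor n y k" if "k \<in> {1..m}" for k t
    using that Suc.prems by (intro minor_upd_other) auto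
  have c: "?c \<in> basis_idx n s" using Suc.prems by (intro corner_in_basis_idx) auto
  show ?case
  proof (cases "minor n y (Suc m) = 0")
    case False
    have "{1..Suc m} = insert (Suc m) {1..m}" by auto
    then show ?thesis using y False by (intro bexI[of _ y]) auto
  next
    case True
    have "\<forall>\<^sub>F t in at (y ?c). y(?c := t) \<in> U \<and> t \<noteq> y ?c"
      using eventually_upd_in_open[OF assms(1) y(1) c]
      unfolding eventually_at_filter by eventually_elim simp
    then obtain t where t: "y(?c := t) \<in> U" "t \<noteq> y ?c"
      using eventually_happens'[OF at_neq_bot] by blast
    have "minor n y m \<noteq> 0" using y(2) by (cases "m = 0") auto
    then have "minor n (y(?c := t)) (Suc m) \<noteq> 0"
      using True t(2) minor_upd_corner[of "Suc m" n y t] Suc.prems by simp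
    moreover have "{1..Suc m} = insert (Suc m) {1..m}" by auto
    ultimately show ?thesis
      using t(1) lower y(2) by (intro bexI[of _ "y(?c := t)"]) (auto simp del: fun_upd_apply)
  qed
qed

section \<open>Smoothness of the minors and of the second kind\<close>

lemma smooth_gen_Xmat:
  assumes "i < n" "j < n"
  shows "smooth_gen n s \<Omega> (\<lambda>x. Xmat n x $$ (i, j))"
proof (cases "j < i")
  case True
  then have "smooth_gen n s \<Omega> (\<lambda>x. x (Suc i, Suc j))"
    using assms by (intro smooth_gen.coord) (auto simp: basis_idx_def)
  then show ?thesis using True assms by (simp add: Xmat_def)
qed (use assms in \<open>simp add: Xmat_def smooth_gen.const\<close>)

lemma smooth_gen_minor:
  assumes "k \<le> n div 2"
  shows "smooth_gen n s \<Omega> (\<lambda>x. minor n x k)"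
  unfolding minor_def
proof (rule smooth_gen_det)
  show "block (Xmat n x) (n - k + 1) n 1 k \<in> carrier_mat k k" for x :: "nat \<times> nat \<Rightarrow> 'a"
    using assms by (auto simp: block_def)
  show "smooth_gen n s \<Omega> (\<lambda>x. block (Xmat n x) (n - k + 1) n 1 k $$ (i, j))" if "i < k" "j < k" for i j
  proof -
    have "smooth_gen n s \<Omega> (\<lambda>x. Xmat n x $$ (n - k + i, j))"
      using that assms by (intro smooth_gen_Xmat) auto
    then show ?thesis using that assms by (simp add: block_def)
  qed
qed

lemma smooth_gen_second_kind:
  fixes \<gamma> :: "nat \<Rightarrow> nat \<Rightarrow> 'a::real_normed_field"
  assumes p: "p \<in> {1..s}" and nz: "\<And>x k. x \<in> \<Omega> \<Longrightarrow> k \<in> {1..n div 2} \<Longrightarrow> minor n x k \<noteq> 0"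
  shows "smooth_gen n s \<Omega> (second_kind n \<gamma> p)"
proof -
  have det: "smooth_gen n s \<Omega> (\<lambda>x. Determinant.det (four_block_mat
      (block (Xmat n x) i i 1 k)           (0\<^sub>m 1 1)
      (block (Xmat n x) (n - k + 1) n 1 k) (block (Xmat n x) (n - k + 1) n i i)))"
    if k: "k \<in> {1..n div 2}" and i: "i \<in> {k<..<n - k + 1}" for k i
  proof (rule smooth_gen_det)
    let ?M = "\<lambda>x :: nat \<times> nat \<Rightarrow> 'a. four_block_mat (block (Xmat n x) i i 1 k) (0\<^sub>m 1 1)
      (block (Xmat n x) (n - k + 1) n 1 k) (block (Xmat n x) (n - k + 1) n i i)"
    show "?M x \<in> carrier_mat (Suc k) (Suc k)" for x :: "nat \<times> nat \<Rightarrow> 'a"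
      using k by (auto simp: block_def)
    fix a b assume ab: "a < Suc k" "b < Suc k"
    define i' where "i' = i - 1"
    have i': "i = Suc i'" "i' < n" using i by (auto simp: i'_def)
    have X: "smooth_gen n s \<Omega> (\<lambda>x. Xmat n x $$ (i', b))" if "b < k"
      using that i' k by (intro smooth_gen_Xmat) auto
    have Y: "smooth_gen n s \<Omega> (\<lambda>x. Xmat n x $$ (n - k + (a - 1), b))" if "b < k" "a \<noteq> 0"
      using that ab k by (intro smooth_gen_Xmat) auto
    have Z: "smooth_gen n s \<Omega> (\<lambda>x. Xmat n x $$ (n - k + (a - 1), i'))" if "a \<noteq> 0"
      using that ab k i' by (intro smooth_gen_Xmat) auto
    consider "a = 0" "b < k" | "a = 0" "b = k" | "a \<noteq> 0" "b < k" | "a \<noteq> 0" "b = k" using ab by linarith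
    then show "smooth_gen n s \<Omega> (\<lambda>x. ?M x $$ (a, b))"
    proof cases
      case 1
      then have "(\<lambda>x. ?M x $$ (a, b)) = (\<lambda>x. Xmat n x $$ (i', b))"
        using k i' by (auto simp: block_def)
      then show ?thesis using X 1 by simp
    next
      case 2
      then have "(\<lambda>x. ?M x $$ (a, b)) = (\<lambda>x. 0)"
        using k i' by (auto simp: block_def)
      then show ?thesis by (simp add: smooth_gen.const)
    next
      case 3
      then have "(\<lambda>x. ?M x $$ (a, b)) = (\<lambda>x. Xmat n x $$ (n - k + (a - 1), b))"
        using k i' ab by (auto simp: block_def)
      then show ?thesis using Y 3 by simp
    next
      case 4
      then have "(\<lambda>x. ?M x $$ (a, b)) = (\<lambda>x. Xmat n x $$ (n - k + (a - 1), i'))"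
        using k i' ab by (auto simp: block_def)
      then show ?thesis using Z 4 by simp
    qed
  qed
  have inv: "smooth_gen n s \<Omega> (\<lambda>x. inverse (minor n x k))" if "k \<in> {1..n div 2}" for k
    using that nz by (intro smooth_gen_inverse smooth_gen_minor) auto
  have "smooth_gen n s \<Omega> (\<lambda>x. x (p, 0))"
    using p by (intro smooth_gen.coord) (auto simp: basis_idx_def)
  then show ?thesis
    unfolding second_kind_def[abs_def] divide_inverse
    by (intro smooth_gen.add smooth_gen_sum smooth_gen.mult smooth_gen.const inv det)
qed

section \<open>Parameters in reduced form\<close>

lemma adj_solve:
  fixes A :: "'a::field mat"
  assumes A: "A \<in> carrier_mat m m" and d: "Determinant.det A \<noteq> 0" and r: "r \<in> carrier_vec m"
  shows "\<exists>v\<in>carrier_vec m. A *\<^sub>v v = r"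
proof -
  let ?v = "(1 / Determinant.det A) \<cdot>\<^sub>v (adj_mat A *\<^sub>v r)"
  have adj: "adj_mat A \<in> carrier_mat m m" "A * adj_mat A = Determinant.det A \<cdot>\<^sub>m 1\<^sub>m m"
    using adj_mat[OF A] by auto
  have "A *\<^sub>v ?v = (1 / Determinant.det A) \<cdot>\<^sub>v (A *\<^sub>v (adj_mat A *\<^sub>v r))"
    using A adj r by (intro mult_mat_vec) auto
  also have "A *\<^sub>v (adj_mat A *\<^sub>v r) = (Determinant.det A \<cdot>\<^sub>m 1\<^sub>m m) *\<^sub>v r"
    using A adj r by (simp add: assoc_mult_mat_vec[symmetric])
  also have "\<dots> = Determinant.det A \<cdot>\<^sub>v r" using r by (intro eq_vecI) auto
  finally have "A *\<^sub>v ?v = r" using d r by (auto simp: smult_smult_assoc intro!: eq_vecI)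
  moreover have "?v \<in> carrier_vec m" using adj r by auto
  ultimately show ?thesis by blast
qed

context
  fixes n s s' :: nat and ks :: "nat \<Rightarrow> nat" and \<gamma> :: "nat \<Rightarrow> nat \<Rightarrow> 'a::field"
  assumes red: "reduced_form n s \<gamma> s' ks"
begin

lemma reduced_ks: "q \<in> {1..s'} \<Longrightarrow> ks q \<in> {1..n div 2}" "inj_on ks {1..s'}"
  "q \<in> {1..s'} \<Longrightarrow> q' \<in> {1..s'} \<Longrightarrow> q < q' \<Longrightarrow> ks q < ks q'"
proof -
  have 1: "ks ` {1..s'} \<subseteq> {1..n div 2}" and 2: "strict_mono_on {1..s'} ks"
    using red by (auto simp: reduced_form_def)
  show "ks q \<in> {1..n div 2}" if "q \<in> {1..s'}" using 1 that by blast
  show "inj_on ks {1..s'}" using 2 by (rule strict_mono_on_imp_inj_on)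
  show "ks q < ks q'" if "q \<in> {1..s'}" "q' \<in> {1..s'}" "q < q'"
    using 2 that by (rule strict_mono_onD)
qed

lemma reduced_s': "s' \<le> s" using red by (auto simp: reduced_form_def)

lemma reduced_diag: "q \<in> {1..s'} \<Longrightarrow> \<gamma> q (n - ks q + 1) - \<gamma> q (ks q) = 1"
  using red by (auto simp: reduced_form_def)

lemma reduced_off_diag:
  "q \<in> {1..s'} \<Longrightarrow> p \<in> {1..s} \<Longrightarrow> p \<noteq> q \<Longrightarrow> \<gamma> p (n - ks q + 1) = \<gamma> p (ks q)"
  using red unfolding reduced_form_def by fastforce

lemma reduced_below: "q \<in> {1..s'} \<Longrightarrow> k \<in> {1..<ks q} \<Longrightarrow> \<gamma> q (n - k + 1) = \<gamma> q k"
  using red unfolding reduced_form_def by fastforce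

lemma reduced_rest: "p \<in> {s'+1..s} \<Longrightarrow> k \<in> {1..n div 2} \<Longrightarrow> \<gamma> p k = \<gamma> p (n - k + 1)"
  using red unfolding reduced_form_def by fastforce

text \<open>By the reduced form the summands below \<open>ks q\<close> vanish. For
  \<open>k < ks q\<close> the right side is an empty sum, which makes the matrix of
  \<open>Delta\<close> triangular.\<close>

lemma alpha_from_ks:
  assumes q: "q \<in> {1..s'}"
  shows "alpha n \<gamma> q k = - (\<Sum>k'=ks q..k. \<gamma> q (n - k' + 1) - \<gamma> q k')"
proof -
  have "(\<Sum>k'=1..k. \<gamma> q (n - k' + 1) - \<gamma> q k') = (\<Sum>k'=ks q..k. \<gamma> q (n - k' + 1) - \<gamma> q k')"
  proof (rule sum.mono_neutral_right)
    show "\<forall>k'\<in>{1..k} - {ks q..k}. \<gamma> q (n - k' + 1) - \<gamma> q k' = 0"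
    proof
      fix k' assume "k' \<in> {1..k} - {ks q..k}"
      then show "\<gamma> q (n - k' + 1) - \<gamma> q k' = 0" using reduced_below[OF q, of k'] by auto
    qed
  qed (use reduced_ks(1)[OF q] in auto)
  then show ?thesis by (simp add: alpha_def)
qed

text \<open>Group parameters with index above \<open>s'\<close> fix all minors, so only
  \<open>s'\<close> equations remain for the exponents.\<close>

lemma alpha_rest:
  assumes "p \<in> {s'+1..s}" "k \<le> n div 2"
  shows "alpha n \<gamma> p k = 0"
proof -
  have "(\<Sum>k'=1..k. \<gamma> p (n - k' + 1) - \<gamma> p k') = 0"
    by (rule sum.neutral) (use assms reduced_rest[of p] in auto)
  then show ?thesis by (simp add: alpha_def)
qed

lemma Delta_eq: "Delta n \<gamma> s' ks = (- 1) ^ s'"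
proof -
  let ?A = "mat s' s' (\<lambda>(a, b). alpha n \<gamma> (a + 1) (ks (b + 1)))"
  have "upper_triangular ?A"
  proof (rule upper_triangularI)
    fix i j assume ij: "j < i" "i < dim_row ?A"
    then have "ks (j + 1) < ks (i + 1)" by (intro reduced_ks(3)) auto
    then show "?A $$ (i, j) = 0" using ij alpha_from_ks[of "i + 1" "ks (j + 1)"] by simp
  qed
  moreover have "alpha n \<gamma> (a + 1) (ks (a + 1)) = - 1" if "a < s'" for a
  proof -
    have "a + 1 \<in> {1..s'}" using that by simp
    then have "alpha n \<gamma> (a + 1) (ks (a + 1)) = - (\<gamma> (a + 1) (n - ks (a + 1) + 1) - \<gamma> (a + 1) (ks (a + 1)))"
      using alpha_from_ks[of "a + 1" "ks (a + 1)"] by simp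
    then show ?thesis using reduced_diag[OF \<open>a + 1 \<in> {1..s'}\<close>] by (simp only:)
  qed
  then have "diag_mat ?A = replicate s' (- 1)"
    by (intro nth_equalityI) (auto simp: diag_mat_def)
  ultimately show ?thesis
    unfolding Delta_def using det_upper_triangular[of ?A s'] by (simp add: prod_list_replicate)
qed

text \<open>Cramer's rule: the exponents are the negated solution of the system with the columns
  \<open>ks q\<close> and the right side \<open>k\<close>. The \<open>q\<close>-th equation says
  that the \<open>q\<close>-th group parameter drops out of the first kind.\<close>

lemma alpha_beta:
  assumes q: "q \<in> {1..s'}"
  shows "alpha n \<gamma> q k + (\<Sum>q'=1..s'. alpha n \<gamma> q (ks q') * beta n \<gamma> s' ks q' k) = 0"
proof -
  define A where "A = mat s' s' (\<lambda>(a, b). alpha n \<gamma> (a + 1) (ks (b + 1)))"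
  define r where "r = vec s' (\<lambda>a. alpha n \<gamma> (a + 1) k)"
  have A: "A \<in> carrier_mat s' s'" and det: "Determinant.det A = Delta n \<gamma> s' ks"
    by (auto simp: A_def Delta_def)
  have nz: "Delta n \<gamma> s' ks \<noteq> 0" by (simp add: Delta_eq)
  obtain v where v: "v \<in> carrier_vec s'" "A *\<^sub>v v = r"
    using adj_solve[OF A, of r] nz det by (auto simp: r_def)
  have beta: "beta n \<gamma> s' ks (b + 1) k = - v $ b" if b: "b < s'" for b
  proof -
    have "Delta_repl n \<gamma> s' ks (b + 1) k = Determinant.det (replace_col A r b)"
      unfolding Delta_repl_def replace_col_def A_def r_def
      by (intro arg_cong[where f = Determinant.det] eq_matI) auto
    also have "\<dots> = v $ b * Delta n \<gamma> s' ks"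
      using cramer_lemma_mat[OF A v(1) b] v(2) det by simp
    finally show ?thesis using nz by (simp add: beta_def)
  qed
  have "alpha n \<gamma> q k = (A *\<^sub>v v) $ (q - 1)"
    using q v by (cases q) (auto simp: r_def)
  also have "\<dots> = (\<Sum>b<s'. alpha n \<gamma> q (ks (b + 1)) * v $ b)"
    using q v(1) by (cases q) (auto simp: A_def scalar_prod_def atLeast0LessThan)
  also have "\<dots> = (\<Sum>q'=1..s'. - (alpha n \<gamma> q (ks q') * beta n \<gamma> s' ks q' k))"
    by (rule sum.reindex_bij_witness[of _ "\<lambda>q'. q' - 1" Suc])
      (use beta in \<open>auto simp: less_eq_Suc_le\<close>)
  finally show ?thesis by (simp add: sum_negf)
qed

end

section \<open>Tangent spaces of orbits\<close>

lemma group_param_tri_group: "group_param n s \<gamma> u \<in> tri_group n s \<gamma>"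
  unfolding tri_group_def
proof (intro CollectI conjI exI ballI)
  show "group_param n s \<gamma> u \<in> carrier_mat n n" "upper_triangular (group_param n s \<gamma> u)"
    by (auto simp: group_param_def)
  show "group_param n s \<gamma> u $$ (i - 1, i - 1) = exp (\<Sum>p=1..s. \<gamma> p i * u (p, 0))" if "i \<in> {1..n}" for i
    using that by (cases i) (auto simp: group_param_def)
qed

lemma group_param_0: "group_param n s \<gamma> (\<lambda>d. 0) = 1\<^sub>m n"
  by (rule eq_matI) (auto simp: group_param_def)

lemma coad_one:
  fixes \<gamma> :: "nat \<Rightarrow> nat \<Rightarrow> 'a::field"
  assumes adm: "admissible n s \<gamma>" and x: "x \<in> coord_space n s"
  shows "coad n s \<gamma> (1\<^sub>m n) x = x"
proof
  fix c :: "nat \<times> nat"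
  have inv: "inverse_pair n (1\<^sub>m n) (1\<^sub>m n :: 'a mat)" by (simp add: inverse_pair_def)
  have Z: "conj_mat n (1\<^sub>m n) x (1\<^sub>m n) i j = Xmat n x $$ (i, j)" if "i < n" "j < n" for i j
  proof -
    have "conj_mat n (1\<^sub>m n) x (1\<^sub>m n) i j =
        (\<Sum>d<n. \<Sum>e<n. if i = e then if d = j then Xmat n x $$ (e, d) else 0 else 0)"
      unfolding conj_mat_eq_sum using that by (intro sum.cong) auto
    also have "\<dots> = Xmat n x $$ (i, j)" using that by simp
    finally show ?thesis .
  qed
  obtain j i where c: "c = (j, i)" by force
  consider "c \<notin> basis_idx n s" | "i = 0" "j \<in> {1..s}" | "1 \<le> i" "i < j" "j \<le> n"
    unfolding c basis_idx_def by fastforce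
  then show "coad n s \<gamma> (1\<^sub>m n) x c = x c"
  proof cases
    case 1
    then show ?thesis using x by (simp add: coad_def coord_spaceD)
  next
    case 2
    have "(\<Sum>i<n. \<gamma> j (Suc i) * conj_mat n (1\<^sub>m n) x (1\<^sub>m n) i i) = 0"
      by (rule sum.neutral) (auto simp: Z Xmat_def)
    then show ?thesis using 2 coad_diag[OF adm inv 2(2), of x] by (simp add: c)
  next
    case 3
    then have "i - 1 < j - 1" "j - 1 < n" by auto
    from coad_lower[OF adm inv this, of x] show ?thesis
      using 3 Z[of "j - 1" "i - 1"] by (auto simp: c Xmat_def)
  qed
qed

text \<open>With the inverse \<open>C t\<close> given explicitly, a tangent vector is found by
  differentiating a product of matrices with known entries. Its coordinates come from the lower part
  and the weighted diagonal of the velocity \<open>W\<close>.\<close>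

lemma orbit_tangentI:
  fixes \<gamma> :: "nat \<Rightarrow> nat \<Rightarrow> 'a::{real_normed_field, banach}"
  assumes adm: "admissible n s \<gamma>" and u: "u \<in> coord_space n s"
    and inv: "\<And>t. inverse_pair n (group_param n s \<gamma> (\<lambda>d. t * u d)) (C t)"
    and Z: "\<And>a b. a < n \<Longrightarrow> b < n \<Longrightarrow>
      ((\<lambda>t. conj_mat n (group_param n s \<gamma> (\<lambda>d. t * u d)) x (C t) a b) has_field_derivative W a b) (at 0)"
    and low: "\<And>a b. b < a \<Longrightarrow> a < n \<Longrightarrow> v (Suc a, Suc b) = W a b"
    and diag: "\<And>p. p \<in> {1..s} \<Longrightarrow> v (p, 0) = (\<Sum>i<n. \<gamma> p (Suc i) * W i i)"
    and out: "\<And>c. c \<notin> basis_idx n s \<Longrightarrow> v c = 0"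
  shows "v \<in> orbit_tangent n s \<gamma> x"
  unfolding orbit_tangent_def
proof (intro CollectI bexI[of _ u] allI u)
  fix c :: "nat \<times> nat"
  let ?g = "\<lambda>t. group_param n s \<gamma> (\<lambda>d. t * u d)"
  obtain j i where c: "c = (j, i)" by force
  consider "c \<notin> basis_idx n s" | "i = 0" "j \<in> {1..s}" | "1 \<le> i" "i < j" "j \<le> n"
    unfolding c basis_idx_def by fastforce
  then show "((\<lambda>t. coad n s \<gamma> (?g t) x c) has_field_derivative v c) (at 0)"
  proof cases
    case 1
    then show ?thesis by (simp add: coad_def out)
  next
    case 2
    have "((\<lambda>t. x (j, 0) + (\<Sum>i<n. \<gamma> j (Suc i) * conj_mat n (?g t) x (C t) i i)) has_field_derivative
        0 + (\<Sum>i<n. \<gamma> j (Suc i) * W i i)) (at 0)"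
      by (intro DERIV_add DERIV_const DERIV_sum DERIV_cmult Z) auto
    then show ?thesis using diag[OF 2(2)] by (simp add: c 2 coad_diag[OF adm inv 2(2)])
  next
    case 3
    then obtain a b where ab: "j = Suc a" "i = Suc b" "b < a" "a < n"
      by (metis Suc_le_D Suc_le_lessD Suc_less_eq One_nat_def less_trans zero_less_Suc less_imp_Suc_add)
    show ?thesis using Z[of a b] ab by (simp add: c coad_lower[OF adm inv ab(3,4)] low)
  qed
qed

text \<open>The curve is \<open>1 + t \<sigma> E\<close> for the matrix unit \<open>E\<close> at
  \<open>(i, j)\<close>. As \<open>E\<close> squares to 0, the inverse is
  \<open>1 - t \<sigma> E\<close>, and the velocity is \<open>\<sigma>\<close> times the commutator
  of \<open>E\<close> with \<open>X\<close>. The scalar \<open>\<sigma>\<close> serves to adjust the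
  sign of the result.\<close>

lemma orbit_tangent_elementary:
  fixes \<gamma> :: "nat \<Rightarrow> nat \<Rightarrow> 'a::{real_normed_field, banach}"
  assumes adm: "admissible n s \<gamma>" and ij: "i < j" "j < n"
    and low: "\<And>a b. b < a \<Longrightarrow> a < n \<Longrightarrow> v (Suc a, Suc b) =
      \<sigma> * ((if a = i then Xmat n x $$ (j, b) else 0) - (if b = j then Xmat n x $$ (a, i) else 0))"
    and diag: "\<And>p. p \<in> {1..s} \<Longrightarrow> v (p, 0) = \<sigma> * (\<gamma> p (Suc i) - \<gamma> p (Suc j)) * Xmat n x $$ (j, i)"
    and out: "\<And>c. c \<notin> basis_idx n s \<Longrightarrow> v c = 0"
  shows "v \<in> orbit_tangent n s \<gamma> x"
proof -
  define el where "el r = mat n n (\<lambda>(a, b). (if a = b then 1 else 0) + (if b = j then if a = i then r else 0 else 0))"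
    for r :: 'a
  define u where "u = (\<lambda>d. \<sigma> * unit_coord (Suc j, Suc i) d)"
  have car: "el r \<in> carrier_mat n n" for r by (simp add: el_def)
  have L: "fun_mult n (ent (el r)) Y a b = Y a b + (if a = i then r * Y j b else 0)" if "a < n" for r Y a b
  proof -
    have "fun_mult n (ent (el r)) Y a b =
        (\<Sum>k<n. (if a = k then Y k b else 0) + (if k = j then if a = i then r * Y k b else 0 else 0))"
      unfolding fun_mult_def using that by (intro sum.cong) (auto simp: el_def distrib_right)
    then show ?thesis using that ij by (simp add: sum.distrib)
  qed
  have R: "fun_mult n Y (ent (el r)) a b = Y a b + (if b = j then r * Y a i else 0)" if "b < n" for r Y a b
  proof -
    have "fun_mult n Y (ent (el r)) a b =
        (\<Sum>k<n. (if k = b then Y a k else 0) + (if k = i then if b = j then r * Y a k else 0 else 0))"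
      unfolding fun_mult_def using that by (intro sum.cong) (auto simp: el_def distrib_left)
    then show ?thesis using that ij by (simp add: sum.distrib)
  qed
  have ut: "upper_triangular (el r)" for r
    by (rule upper_triangularI) (use ij in \<open>auto simp: el_def\<close>)
  have prod: "el r * el (- r) = 1\<^sub>m n" for r
  proof (rule eq_matI)
    fix a b assume "a < dim_row (1\<^sub>m n :: 'a mat)" "b < dim_col (1\<^sub>m n :: 'a mat)"
    then have ab: "a < n" "b < n" by auto
    then show "(el r * el (- r)) $$ (a, b) = 1\<^sub>m n $$ (a, b)"
      unfolding ent_mult[OF car car ab] L[OF ab(1)] using ij by (auto simp: el_def)
  qed (use car in auto)
  have g: "group_param n s \<gamma> (\<lambda>d. t * u d) = el (t * \<sigma>)" for t
  proof (rule eq_matI)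
    fix a b assume "a < dim_row (el (t * \<sigma>))" "b < dim_col (el (t * \<sigma>))"
    then have ab: "a < n" "b < n" using car[of "t * \<sigma>"] by auto
    have "(\<Sum>p=1..s. \<gamma> p (a + 1) * (t * u (p, 0))) = 0" by (simp add: u_def unit_coord_def)
    then show "group_param n s \<gamma> (\<lambda>d. t * u d) $$ (a, b) = el (t * \<sigma>) $$ (a, b)"
      using ab ij by (auto simp: group_param_def el_def u_def unit_coord_def)
  qed (auto simp: group_param_def el_def)
  show ?thesis
  proof (rule orbit_tangentI[OF adm, where u = u and C = "\<lambda>t. el (- (t * \<sigma>))" and
        W = "\<lambda>a b. \<sigma> * ((if a = i then Xmat n x $$ (j, b) else 0) - (if b = j then Xmat n x $$ (a, i) else 0))"])
    show "u \<in> coord_space n s" using ij by (auto simp: u_def coord_space_def unit_coord_def basis_idx_def)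
    show "inverse_pair n (group_param n s \<gamma> (\<lambda>d. t * u d)) (el (- (t * \<sigma>)))" for t
      using car ut prod[of "t * \<sigma>"] prod[of "- (t * \<sigma>)"] by (simp add: inverse_pair_def g)
    fix a b assume ab: "a < n" "b < n"
    have eq: "conj_mat n (group_param n s \<gamma> (\<lambda>d. t * u d)) x (el (- (t * \<sigma>))) a b =
      Xmat n x $$ (a, b) + t * (\<sigma> * ((if a = i then Xmat n x $$ (j, b) else 0) - (if b = j then Xmat n x $$ (a, i) else 0)))
      - (t * t) * (if a = i \<and> b = j then \<sigma> * \<sigma> * Xmat n x $$ (j, i) else 0)" for t
      using ab by (simp add: conj_mat_def g R L algebra_simps)
    show "((\<lambda>t. conj_mat n (group_param n s \<gamma> (\<lambda>d. t * u d)) x (el (- (t * \<sigma>))) a b) has_field_derivative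
      \<sigma> * ((if a = i then Xmat n x $$ (j, b) else 0) - (if b = j then Xmat n x $$ (a, i) else 0))) (at 0)"
      unfolding eq by (rule derivative_eq_intros refl)+ simp
  next
    fix p assume p: "p \<in> {1..s}"
    have "(\<Sum>a<n. \<gamma> p (Suc a) * (\<sigma> * ((if a = i then Xmat n x $$ (j, a) else 0) - (if a = j then Xmat n x $$ (a, i) else 0))))
      = (\<Sum>a<n. (if a = i then \<gamma> p (Suc a) * \<sigma> * Xmat n x $$ (j, a) else 0)
          - (if a = j then \<gamma> p (Suc a) * \<sigma> * Xmat n x $$ (a, i) else 0))"
      by (intro sum.cong) (auto simp: algebra_simps)
    also have "\<dots> = v (p, 0)" using ij diag[OF p] by (simp add: sum_subtractf algebra_simps)
    finally show "v (p, 0) = (\<Sum>a<n. \<gamma> p (Suc a) * (\<sigma> * ((if a = i then Xmat n x $$ (j, a) else 0) - (if a = j then Xmat n x $$ (a, i) else 0))))" ..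
  qed (use low out in auto)
qed

text \<open>The curve is the one-parameter group of the \<open>q\<close>-th diagonal matrix. It
  rescales the entries of \<open>X\<close>, and the diagonal stays zero.\<close>

lemma orbit_tangent_diagonal:
  fixes \<gamma> :: "nat \<Rightarrow> nat \<Rightarrow> 'a::{real_normed_field, banach}"
  assumes adm: "admissible n s \<gamma>" and q: "q \<in> {1..s}"
    and low: "\<And>a b. b < a \<Longrightarrow> a < n \<Longrightarrow> v (Suc a, Suc b) = (\<gamma> q (Suc a) - \<gamma> q (Suc b)) * Xmat n x $$ (a, b)"
    and diag: "\<And>p. p \<in> {1..s} \<Longrightarrow> v (p, 0) = 0"
    and out: "\<And>c. c \<notin> basis_idx n s \<Longrightarrow> v c = 0"
  shows "v \<in> orbit_tangent n s \<gamma> x"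
proof -
  define D where "D r = mat n n (\<lambda>(a, b). if a = b then exp (r * \<gamma> q (Suc a)) else 0)" for r :: 'a
  have car: "D r \<in> carrier_mat n n" for r by (simp add: D_def)
  have L: "fun_mult n (ent (D r)) Y a b = exp (r * \<gamma> q (Suc a)) * Y a b" if "a < n" for r Y a b
  proof -
    have "fun_mult n (ent (D r)) Y a b = (\<Sum>k<n. if a = k then exp (r * \<gamma> q (Suc a)) * Y k b else 0)"
      unfolding fun_mult_def using that by (intro sum.cong) (auto simp: D_def)
    then show ?thesis using that by simp
  qed
  have R: "fun_mult n Y (ent (D r)) a b = Y a b * exp (r * \<gamma> q (Suc b))" if "b < n" for r Y a b
  proof -
    have "fun_mult n Y (ent (D r)) a b = (\<Sum>k<n. if k = b then Y a k * exp (r * \<gamma> q (Suc b)) else 0)"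
      unfolding fun_mult_def using that by (intro sum.cong) (auto simp: D_def)
    then show ?thesis using that by simp
  qed
  have ut: "upper_triangular (D r)" for r
    by (rule upper_triangularI) (auto simp: D_def)
  have prod: "D r * D (- r) = 1\<^sub>m n" for r
  proof (rule eq_matI)
    fix a b assume "a < dim_row (1\<^sub>m n :: 'a mat)" "b < dim_col (1\<^sub>m n :: 'a mat)"
    then have ab: "a < n" "b < n" by auto
    then show "(D r * D (- r)) $$ (a, b) = 1\<^sub>m n $$ (a, b)"
      unfolding ent_mult[OF car car ab] L[OF ab(1)] by (auto simp: D_def exp_minus)
  qed (use car in auto)
  have g: "group_param n s \<gamma> (\<lambda>d. t * unit_coord (q, 0) d) = D t" for t
  proof (rule eq_matI)
    fix a b assume "a < dim_row (D t)" "b < dim_col (D t)"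
    then have ab: "a < n" "b < n" using car[of t] by auto
    have "(\<Sum>p=1..s. \<gamma> p (a + 1) * (t * unit_coord (q, 0) (p, 0))) = (\<Sum>p=1..s. if p = q then t * \<gamma> p (Suc a) else 0)"
      by (intro sum.cong) (auto simp: unit_coord_def)
    also have "\<dots> = t * \<gamma> q (Suc a)" using q by simp
    finally show "group_param n s \<gamma> (\<lambda>d. t * unit_coord (q, 0) d) $$ (a, b) = D t $$ (a, b)"
      using ab by (auto simp: group_param_def D_def unit_coord_def[of "_ :: nat \<times> nat"])
  qed (auto simp: group_param_def D_def)
  show ?thesis
  proof (rule orbit_tangentI[OF adm, where u = "unit_coord (q, 0)" and C = "\<lambda>t. D (- t)" and
        W = "\<lambda>a b. (\<gamma> q (Suc a) - \<gamma> q (Suc b)) * Xmat n x $$ (a, b)"])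
    show "unit_coord (q, 0) \<in> coord_space n s"
      using q by (intro unit_coord_in_coord_space) (auto simp: basis_idx_def)
    show "inverse_pair n (group_param n s \<gamma> (\<lambda>d. t * unit_coord (q, 0) d)) (D (- t))" for t
      using car ut prod[of t] prod[of "- t"] by (simp add: inverse_pair_def g)
    fix a b assume ab: "a < n" "b < n"
    have eq: "conj_mat n (group_param n s \<gamma> (\<lambda>d. t * unit_coord (q, 0) d)) x (D (- t)) a b =
      exp (t * \<gamma> q (Suc a)) * Xmat n x $$ (a, b) * exp (- t * \<gamma> q (Suc b))" for t
      using ab by (simp add: conj_mat_def g R L)
    show "((\<lambda>t. conj_mat n (group_param n s \<gamma> (\<lambda>d. t * unit_coord (q, 0) d)) x (D (- t)) a b)
      has_field_derivative (\<gamma> q (Suc a) - \<gamma> q (Suc b)) * Xmat n x $$ (a, b)) (at 0)"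
      unfolding eq by (rule derivative_eq_intros refl)+ (simp add: algebra_simps)
  next
    fix p assume p: "p \<in> {1..s}"
    have "(\<Sum>i<n. \<gamma> p (Suc i) * ((\<gamma> q (Suc i) - \<gamma> q (Suc i)) * Xmat n x $$ (i, i))) = 0" by simp
    then show "v (p, 0) = (\<Sum>i<n. \<gamma> p (Suc i) * ((\<gamma> q (Suc i) - \<gamma> q (Suc i)) * Xmat n x $$ (i, i)))"
      using diag[OF p] by simp
  qed (use low out in auto)
qed

section \<open>The rank of the action\<close>

lemma orbit_tangent_subset: "orbit_tangent n s \<gamma> x \<subseteq> coord_space n s"
proof
  fix v assume "v \<in> orbit_tangent n s \<gamma> x"
  then obtain u where v: "\<And>c. ((\<lambda>t. coad n s \<gamma> (group_param n s \<gamma> (\<lambda>d. t * u d)) x c) has_field_derivative v c) (at 0)"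
    unfolding orbit_tangent_def by blast
  have "v c = 0" if "c \<notin> basis_idx n s" for c
  proof -
    have "((\<lambda>t. 0) has_field_derivative v c) (at 0)" using v[of c] that by (simp add: coad_def)
    then show ?thesis using DERIV_unique DERIV_const by blast
  qed
  then show "v \<in> coord_space n s" by (simp add: coord_space_def del: split_paired_All)
qed

lemma orbit_dim_le_coad_rank:
  assumes "x \<in> coord_space n s"
  shows "orbit_dim n s \<gamma> x \<le> coad_rank n s \<gamma>"
  unfolding coad_rank_def
proof (rule Max_ge)
  have "orbit_dim n s \<gamma> ` coord_space n s \<subseteq> {..card (basis_idx n s)}"
    unfolding orbit_dim_def using fun_dim_le_card_basis_idx[OF orbit_tangent_subset] by auto
  then show "finite (orbit_dim n s \<gamma> ` coord_space n s)" by (rule finite_subset) simp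
qed (use assms in simp)

text \<open>At the point whose only nonzero coordinates lie on the antidiagonal, the action of the root
  vectors produces all coordinate directions off the antidiagonal.\<close>

lemma coad_rank_lower:
  fixes \<gamma> :: "nat \<Rightarrow> nat \<Rightarrow> 'a::{real_normed_field, banach}"
  assumes adm: "admissible n s \<gamma>" and red: "reduced_form n s \<gamma> s' ks"
  defines "R \<equiv> (\<lambda>k. (n - k + 1, k)) ` ({1..n div 2} - ks ` {1..s'}) \<union> (\<lambda>p. (p, 0)) ` {s'+1..s}"
  shows "card (basis_idx n s - R) \<le> coad_rank n s \<gamma>"
proof -
  define z :: "nat \<times> nat \<Rightarrow> 'a" where "z = (\<lambda>(a, b). if a + b = n + 1 \<and> 1 \<le> b \<and> b < a then 1 else 0)"
  have z: "z \<in> coord_space n s" by (auto simp: z_def coord_space_def basis_idx_def)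
  have X: "Xmat n z $$ (a, b) = (if b < a \<and> Suc (a + b) = n then 1 else 0)" if "a < n" "b < n" for a b
    using that by (auto simp: Xmat_def z_def)
  let ?T = "orbit_tangent n s \<gamma> z"
  \<comment> \<open>For \<open>A + B < n - 1\<close> a row of \<open>z\<close> is copied to row
    \<open>A\<close>, otherwise a column of \<open>z\<close> to column \<open>B\<close>; either has
    a single 1, which lands at \<open>(A, B)\<close>. The other half of the commutator contributes
    only above the diagonal, where it is discarded.\<close>
  have unit: "unit_coord (Suc A, Suc B) \<in> ?T" if "B < A" "A < n" "Suc (A + B) \<noteq> n" for A B
  proof (cases "Suc (A + B) < n")
    case True
    show ?thesis
      by (rule orbit_tangent_elementary[OF adm, where i = A and j = "n - 1 - B" and \<sigma> = 1])
        (use True that in \<open>auto simp: X unit_coord_def basis_idx_def\<close>)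
  next
    case False
    show ?thesis
      by (rule orbit_tangent_elementary[OF adm, where i = "n - 1 - A" and j = B and \<sigma> = "- 1"])
        (use False that in \<open>auto simp: X unit_coord_def basis_idx_def\<close>)
  qed
  \<comment> \<open>The matrix unit opposite to the antidiagonal entry of \<open>ks q\<close> has a
    diagonal commutator with \<open>z\<close>. The reduced form makes the resulting parameter
    difference 1 for \<open>p = q\<close> and 0 for the other \<open>p\<close>.\<close>
  have unit0: "unit_coord (q, 0) \<in> ?T" if q: "q \<in> {1..s'}" for q
  proof (rule orbit_tangent_elementary[OF adm, where i = "ks q - 1" and j = "n - ks q" and \<sigma> = "- 1"])
    have k: "1 \<le> ks q" "ks q \<le> n div 2" using reduced_ks(1)[OF red q] by auto
    show "ks q - 1 < n - ks q" "n - ks q < n" using k by auto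
    show "unit_coord (q, 0) c = (0 :: 'a)" if "c \<notin> basis_idx n s" for c
      using that q reduced_s'[OF red] by (auto simp: unit_coord_def basis_idx_def)
    fix p assume p: "p \<in> {1..s}"
    have 1: "Xmat n z $$ (n - ks q, ks q - 1) = 1" using k by (subst X) auto
    show "unit_coord (q, 0) (p, 0) =
      - 1 * (\<gamma> p (Suc (ks q - 1)) - \<gamma> p (Suc (n - ks q))) * Xmat n z $$ (n - ks q, ks q - 1)"
    proof (cases "p = q")
      case True
      then show ?thesis using reduced_diag[OF red q] k 1 by (simp add: unit_coord_def)
    next
      case False
      then show ?thesis using reduced_off_diag[OF red q p] k 1 by (simp add: unit_coord_def)
    qed
  next
    have k: "1 \<le> ks q" "ks q \<le> n div 2" using reduced_ks(1)[OF red q] by auto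
    fix a b assume "b < a" "a < n"
    then show "unit_coord (q, 0) (Suc a, Suc b) =
      - 1 * ((if a = ks q - 1 then Xmat n z $$ (n - ks q, b) else 0)
        - (if b = n - ks q then Xmat n z $$ (a, ks q - 1) else 0) :: 'a)"
      using k by (auto simp: X unit_coord_def)
  qed
  \<comment> \<open>The \<open>q\<close>-th diagonal matrix moves \<open>z\<close> along the
    antidiagonal by differences of parameters. On the antidiagonal only the positions of the
    \<open>ks q'\<close> lie outside \<open>R\<close>, and there the reduced form gives 1 or
    0.\<close>
  have diag: "\<exists>w\<in>?T. \<forall>d\<in>basis_idx n s - R. w d = (if d = (n - ks q + 1, ks q) then 1 else 0)"
    if q: "q \<in> {1..s'}" for q
  proof -
    define w where "w = (\<lambda>(a, b). if (a, b) \<in> basis_idx n s \<and> b \<noteq> 0 \<and> a + b = n + 1 then \<gamma> q a - \<gamma> q b else 0)"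
    have "w \<in> ?T"
      by (rule orbit_tangent_diagonal[OF adm, where q = q])
        (use q reduced_s'[OF red] in \<open>auto simp: w_def X basis_idx_def split: if_splits\<close>)
    moreover have "w d = (if d = (n - ks q + 1, ks q) then 1 else 0)" if d: "d \<in> basis_idx n s - R" for d
    proof -
      obtain a b where ab: "d = (a, b)" by force
      have k: "1 \<le> ks q" "ks q \<le> n div 2" using reduced_ks(1)[OF red q] by auto
      show ?thesis
      proof (cases "b \<noteq> 0 \<and> a + b = n + 1")
        case False
        then show ?thesis using k by (auto simp: w_def ab)
      next
        case True
        then have b: "b \<in> {1..n div 2}" "a = n - b + 1" using d by (auto simp: ab basis_idx_def)
        have "b \<in> ks ` {1..s'}"
        proof (rule ccontr)
          assume "b \<notin> ks ` {1..s'}"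
          then have "d \<in> R" unfolding R_def ab b(2) using b(1) by blast
          then show False using d by simp
        qed
        then obtain q' where q': "q' \<in> {1..s'}" "b = ks q'" by auto
        have w: "w d = \<gamma> q (n - ks q' + 1) - \<gamma> q (ks q')" using True d q' b by (simp add: w_def ab)
        show ?thesis
        proof (cases "q' = q")
          case True
          then show ?thesis using w reduced_diag[OF red q] q' b by (simp add: ab)
        next
          case False
          then have "ks q' \<noteq> ks q" using reduced_ks(2)[OF red] q q'(1) by (auto dest: inj_onD)
          then show ?thesis
            using w reduced_off_diag[OF red q'(1), of q] False q q' reduced_s'[OF red] by (auto simp: ab)
        qed
      qed
    qed
    ultimately show ?thesis by blast
  qed
  have "\<forall>c\<in>basis_idx n s - R. \<exists>w\<in>?T. \<forall>d\<in>basis_idx n s - R. w d = (if d = c then 1 else 0)"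
  proof
    fix c assume c: "c \<in> basis_idx n s - R"
    obtain a b where ab: "c = (a, b)" by force
    consider "b = 0" "a \<in> {1..s'}" | "1 \<le> b" "b < a" "a \<le> n" "a + b \<noteq> n + 1" |
      q where "q \<in> {1..s'}" "c = (n - ks q + 1, ks q)"
    proof (cases "b = 0")
      case True
      then have "a \<in> {1..s}" using c by (auto simp: ab basis_idx_def)
      moreover have "a \<notin> {s'+1..s}"
      proof
        assume "a \<in> {s'+1..s}"
        then have "c \<in> R" unfolding R_def ab True by blast
        then show False using c by simp
      qed
      ultimately show ?thesis using that(1) True by auto
    next
      case False
      then have b: "1 \<le> b" "b < a" "a \<le> n" using c by (auto simp: ab basis_idx_def)
      show ?thesis
      proof (cases "a + b = n + 1")
        case True
        then have b': "b \<in> {1..n div 2}" "a = n - b + 1" using b by auto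
        have "b \<in> ks ` {1..s'}"
        proof (rule ccontr)
          assume "b \<notin> ks ` {1..s'}"
          then have "c \<in> R" unfolding R_def ab b'(2) using b'(1) by blast
          then show False using c by simp
        qed
        then show ?thesis using that(3) b' ab by auto
      next
        case False
        then show ?thesis using that(2) b by blast
      qed
    qed
    then show "\<exists>w\<in>?T. \<forall>d\<in>basis_idx n s - R. w d = (if d = c then 1 else 0)"
    proof cases
      case 1
      then show ?thesis using unit0[of a] unfolding ab by (intro bexI[of _ "unit_coord (a, 0)"]) (auto simp: unit_coord_def)
    next
      case 2
      then have "unit_coord (Suc (a - 1), Suc (b - 1)) \<in> ?T" by (intro unit) auto
      then have "unit_coord c \<in> ?T" using 2 by (simp add: ab)
      then show ?thesis by (intro bexI[of _ "unit_coord c"]) (auto simp: unit_coord_def)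
    next
      case 3
      then show ?thesis using diag[of q] by blast
    qed
  qed
  then obtain w where w: "\<And>c. c \<in> basis_idx n s - R \<Longrightarrow> w c \<in> ?T"
    "\<And>c d. c \<in> basis_idx n s - R \<Longrightarrow> d \<in> basis_idx n s - R \<Longrightarrow> w c d = (if d = c then 1 else 0)"
    by metis
  have "card (basis_idx n s - R) \<le> fun_dim ?T"
    by (rule card_le_fun_dim[OF orbit_tangent_subset, where w = w]) (use w in auto)
  also have "\<dots> \<le> coad_rank n s \<gamma>"
    using orbit_dim_le_coad_rank[OF z] by (simp add: orbit_dim_def)
  finally show ?thesis .
qed

section \<open>The basis of invariants\<close>

text \<open>The rule for logarithmic derivatives, in a form that does not divide by the
  factors.\<close>

lemma DERIV_prod_log:
  fixes g :: "'b \<Rightarrow> 'a \<Rightarrow> 'a::real_normed_field"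
  assumes "finite A" "\<And>q. q \<in> A \<Longrightarrow> (g q has_field_derivative g q a * r q) (at a)"
  shows "((\<lambda>t. \<Prod>q\<in>A. g q t) has_field_derivative (\<Prod>q\<in>A. g q a) * (\<Sum>q\<in>A. r q)) (at a)"
  using assms
proof (induction A rule: finite_induct)
  case (insert p A)
  have "((\<lambda>t. g p t * (\<Prod>q\<in>A. g q t)) has_field_derivative
      g p a * r p * (\<Prod>q\<in>A. g q a) + ((\<Prod>q\<in>A. g q a) * (\<Sum>q\<in>A. r q)) * g p a) (at a)"
    by (intro DERIV_mult insert.IH) (use insert.prems in auto)
  then show ?case using insert.hyps by (simp add: algebra_simps)
qed simp

text \<open>The parameter \<open>\<tau>\<close> is a period of the exponential function: \<open>2 \<pi> \<i>\<close> for branches of complex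
  powers, and \<open>0\<close> for real powers.\<close>

locale power_function =
  fixes pw :: "'a \<Rightarrow> 'a \<Rightarrow> 'a::{real_normed_field, banach}"
    and ok :: "'a \<Rightarrow> 'a \<Rightarrow> bool" and \<tau> :: 'a
  assumes pw_deriv: "ok a b \<Longrightarrow> a \<noteq> 0 \<Longrightarrow> ((\<lambda>z. pw z b) has_field_derivative b * pw a b / a) (at a)"
    and pw_nonzero: "ok a b \<Longrightarrow> a \<noteq> 0 \<Longrightarrow> pw a b \<noteq> 0"
    and pw_of_nat: "pw a (of_nat j) = a ^ j"
    and ok_zero: "ok 0 b \<Longrightarrow> b \<in> \<nat>"
    and pw_mult_exp: "ok a b \<Longrightarrow> ok (a * exp e) b \<Longrightarrow>
      \<exists>m::int. pw (a * exp e) b = pw a b * exp (b * (e + of_int m * \<tau>))"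
begin

context
  fixes n s s' :: nat and ks :: "nat \<Rightarrow> nat" and \<gamma> :: "nat \<Rightarrow> nat \<Rightarrow> 'a" and \<Omega> :: "(nat \<times> nat \<Rightarrow> 'a) set"
  assumes adm: "admissible n s \<gamma>" and red: "reduced_form n s \<gamma> s' ks"
    and reg: "regular_nbhd n s \<gamma> \<Omega>" and dom: "\<Omega> \<subseteq> expr_domain ok n s \<gamma> s' ks"
begin

abbreviation "K \<equiv> {1..n div 2} - ks ` {1..s'}"
abbreviation "F \<equiv> first_kind pw n \<gamma> s' ks"
abbreviation "S \<equiv> second_kind n \<gamma>"

lemma open_\<Omega>: "openin (top_of_set (coord_space n s)) \<Omega>"
  using reg by (simp add: regular_nbhd_def)

lemma \<Omega>_coord_space: "x \<in> \<Omega> \<Longrightarrow> x \<in> coord_space n s"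
  using open_\<Omega> openin_imp_subset by blast

lemma ok_minor: "x \<in> \<Omega> \<Longrightarrow> k \<in> K \<Longrightarrow> q \<in> {1..s'} \<Longrightarrow> ok (minor n x (ks q)) (beta n \<gamma> s' ks q k)"
  using dom unfolding expr_domain_def by blast

lemma minor_nonzero: "x \<in> \<Omega> \<Longrightarrow> p \<in> {s'+1..s} \<Longrightarrow> k \<in> {1..n div 2} \<Longrightarrow> minor n x k \<noteq> 0"
  using dom unfolding expr_domain_def by fastforce

lemma smooth_gen_pw_minor:
  assumes k: "k \<in> K" and q: "q \<in> {1..s'}"
  shows "smooth_gen n s \<Omega> (\<lambda>x. pw (minor n x (ks q)) (beta n \<gamma> s' ks q k))"
proof -
  have M: "smooth_gen n s \<Omega> (\<lambda>x. minor n x (ks q))"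
    using reduced_ks(1)[OF red q] by (intro smooth_gen_minor) auto
  show ?thesis
  proof (cases "beta n \<gamma> s' ks q k \<in> \<nat>")
    case True
    then obtain j where "beta n \<gamma> s' ks q k = of_nat j" by (auto elim: Nats_cases)
    then show ?thesis using smooth_gen_power[OF M, of j] by (simp add: pw_of_nat)
  next
    case False
    then have nz: "minor n x (ks q) \<noteq> 0" if "x \<in> \<Omega>" for x
      using ok_minor[OF that k q] ok_zero by auto
    show ?thesis
      by (rule smooth_gen.power_comp[where \<phi> = "\<lambda>z. pw z (beta n \<gamma> s' ks q k)", OF M])
        (use nz pw_deriv ok_minor[OF _ k q] in blast)
  qed
qed

lemma smooth_gen_F: "k \<in> K \<Longrightarrow> smooth_gen n s \<Omega> (F k)"
  unfolding first_kind_def[abs_def]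
  by (intro smooth_gen.mult smooth_gen_minor smooth_gen_prod smooth_gen_pw_minor) auto

lemma smooth_gen_S: "p \<in> {s'+1..s} \<Longrightarrow> smooth_gen n s \<Omega> (S p)"
  by (rule smooth_gen_second_kind) (use minor_nonzero[of _ p] in auto)

text \<open>By the choice of the exponents an invariant of the first kind changes along an orbit only by
  a factor \<open>exp (\<Sum>\<^sub>q \<beta>\<^sub>q m\<^sub>q \<tau>)\<close> with integers \<open>m\<^sub>q\<close>. These factors form a countable set, so they are constant on
  the connected set in which the orbit meets \<open>\<Omega>\<close>.\<close>

lemma F_coad_countable:
  assumes k: "k \<in> K" and x: "x \<in> \<Omega>" and B: "B \<in> tri_group n s \<gamma>" and y: "coad n s \<gamma> B x \<in> \<Omega>"
  shows "\<exists>m::nat \<Rightarrow> int. F k (coad n s \<gamma> B x) = F k x * exp (\<Sum>q=1..s'. beta n \<gamma> s' ks q k * (of_int (m q) * \<tau>))"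
proof -
  let ?y = "coad n s \<gamma> B x" and ?\<beta> = "\<lambda>q. beta n \<gamma> s' ks q k"
  obtain \<epsilon> where \<epsilon>: "\<And>k x. k \<le> n div 2 \<Longrightarrow>
    minor n (coad n s \<gamma> B x) k = minor n x k * exp (- (\<Sum>p=1..s. \<epsilon> p * alpha n \<gamma> p k))"
    using minor_coad[OF adm B] by blast
  define e where "e k = - (\<Sum>p=1..s. \<epsilon> p * alpha n \<gamma> p k)" for k
  have M: "minor n ?y k = minor n x k * exp (e k)" if "k \<le> n div 2" for k
    using \<epsilon>[OF that] by (simp add: e_def)
  have ks: "ks q \<le> n div 2" if "q \<in> {1..s'}" for q using reduced_ks(1)[OF red that] by auto
  have "\<forall>q\<in>{1..s'}. \<exists>m::int. pw (minor n ?y (ks q)) (?\<beta> q)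
      = pw (minor n x (ks q)) (?\<beta> q) * exp (?\<beta> q * (e (ks q) + of_int m * \<tau>))"
  proof
    fix q assume q: "q \<in> {1..s'}"
    show "\<exists>m::int. pw (minor n ?y (ks q)) (?\<beta> q)
      = pw (minor n x (ks q)) (?\<beta> q) * exp (?\<beta> q * (e (ks q) + of_int m * \<tau>))"
      using pw_mult_exp[OF ok_minor[OF x k q], of "e (ks q)"] ok_minor[OF y k q] M[OF ks[OF q]] by simp
  qed
  then obtain m :: "nat \<Rightarrow> int" where m: "\<And>q. q \<in> {1..s'} \<Longrightarrow> pw (minor n ?y (ks q)) (?\<beta> q)
      = pw (minor n x (ks q)) (?\<beta> q) * exp (?\<beta> q * (e (ks q) + of_int (m q) * \<tau>))"
    by metis
  \<comment> \<open>Collected by the group parameters, the coefficient of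
    \<open>\<epsilon> p\<close> vanishes by the equations for the exponents if
    \<open>p \<le> s'\<close>, and term by term for the other \<open>p\<close>.\<close>
  have "e k + (\<Sum>q=1..s'. ?\<beta> q * e (ks q)) = 0"
  proof -
    have "(\<Sum>q=1..s'. ?\<beta> q * e (ks q)) = - (\<Sum>p=1..s. \<Sum>q=1..s'. \<epsilon> p * (alpha n \<gamma> p (ks q) * ?\<beta> q))"
      by (subst sum.swap) (simp add: e_def sum_distrib_left sum_negf mult_ac)
    then have "e k + (\<Sum>q=1..s'. ?\<beta> q * e (ks q))
        = - (\<Sum>p=1..s. \<epsilon> p * (alpha n \<gamma> p k + (\<Sum>q=1..s'. alpha n \<gamma> p (ks q) * ?\<beta> q)))"
      by (simp add: e_def distrib_left sum.distrib sum_distrib_left)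
    also have "\<dots> = 0"
    proof -
      have "alpha n \<gamma> p k + (\<Sum>q=1..s'. alpha n \<gamma> p (ks q) * ?\<beta> q) = 0" if p: "p \<in> {1..s}" for p
      proof (cases "p \<le> s'")
        case True
        then show ?thesis using alpha_beta[OF red, of p k] p by simp
      next
        case False
        then have "p \<in> {s'+1..s}" using p by auto
        then show ?thesis using alpha_rest[OF red] k ks by simp
      qed
      then show ?thesis by simp
    qed
    finally show ?thesis .
  qed
  then have ek: "exp (e k) * exp (\<Sum>q=1..s'. ?\<beta> q * e (ks q)) = 1" by (simp add: exp_add[symmetric])
  have "F k ?y = F k x * (exp (e k) * (\<Prod>q=1..s'. exp (?\<beta> q * (e (ks q) + of_int (m q) * \<tau>))))"
    using k by (simp add: first_kind_def M m prod.distrib mult_ac)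
  also have "(\<Prod>q=1..s'. exp (?\<beta> q * (e (ks q) + of_int (m q) * \<tau>)))
      = exp (\<Sum>q=1..s'. ?\<beta> q * e (ks q)) * exp (\<Sum>q=1..s'. ?\<beta> q * (of_int (m q) * \<tau>))"
    by (simp add: exp_sum[symmetric] exp_add[symmetric] distrib_left sum.distrib)
  also have "exp (e k) * \<dots> = exp (\<Sum>q=1..s'. ?\<beta> q * (of_int (m q) * \<tau>))"
    using ek by (simp add: mult.assoc[symmetric])
  finally show ?thesis by blast
qed

lemma F_invariant:
  assumes k: "k \<in> K" and x: "x \<in> \<Omega>" and B: "B \<in> tri_group n s \<gamma>" and y: "coad n s \<gamma> B x \<in> \<Omega>"
  shows "F k (coad n s \<gamma> B x) = F k x"
proof (rule ccontr)
  assume ne: "F k (coad n s \<gamma> B x) \<noteq> F k x"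
  let ?O = "orbit n s \<gamma> x \<inter> \<Omega>"
  let ?f = "\<lambda>m::nat \<Rightarrow> int. F k x * exp (\<Sum>q=1..s'. beta n \<gamma> s' ks q k * (of_int (m q) * \<tau>))"
  \<comment> \<open>Only the values \<open>m q\<close> with \<open>q\<close> in
    \<open>{1..s'}\<close> enter. Restricting \<open>m\<close> to them makes the index set
    countable, while the set of all functions from \<open>nat\<close> to \<open>int\<close> is
    not.\<close>
  have "F k ` ?O \<subseteq> ?f ` (Pi\<^sub>E {1..s'} (\<lambda>_. UNIV))"
  proof
    fix w assume "w \<in> F k ` ?O"
    then obtain B' where B': "B' \<in> tri_group n s \<gamma>" "coad n s \<gamma> B' x \<in> \<Omega>" "w = F k (coad n s \<gamma> B' x)"
      by (auto simp: orbit_def)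
    obtain m where "w = ?f m" using F_coad_countable[OF k x B'(1,2)] B'(3) by blast
    also have "?f m = ?f (restrict m {1..s'})" by simp
    finally have w: "w = ?f (restrict m {1..s'})" .
    show "w \<in> ?f ` (Pi\<^sub>E {1..s'} (\<lambda>_. UNIV))"
      by (rule image_eqI[of w ?f "restrict m {1..s'}", OF w]) simp
  qed
  moreover have "countable (?f ` (Pi\<^sub>E {1..s'} (\<lambda>_. UNIV)))"
    by (intro countable_image countable_PiE) auto
  ultimately have "countable (F k ` ?O)" using countable_subset by blast
  moreover have "connected (F k ` ?O)"
  proof (rule connected_continuous_image)
    show "continuous_on ?O (F k)"
      using smooth_gen_continuous[OF smooth_gen_F[OF k]] by (rule continuous_on_subset) auto
    show "connected ?O" using reg x by (auto simp: regular_nbhd_def acts_regularly_def)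
  qed
  moreover have "x \<in> ?O"
  proof -
    have "x = coad n s \<gamma> (1\<^sub>m n) x" using coad_one[OF adm \<Omega>_coord_space[OF x]] by simp
    moreover have "1\<^sub>m n \<in> tri_group n s \<gamma>"
      using group_param_tri_group[of n s \<gamma> "\<lambda>d. 0"] by (simp add: group_param_0)
    ultimately show ?thesis using x unfolding orbit_def by blast
  qed
  moreover have "coad n s \<gamma> B x \<in> ?O" using y B by (auto simp: orbit_def)
  ultimately show False using connected_uncountable[of "F k ` ?O"] ne by blast
qed

lemma F_Inv: "k \<in> K \<Longrightarrow> F k \<in> Inv n s \<gamma> \<Omega>"
  using smooth_gen_smooth_on[OF open_\<Omega> smooth_gen_F] F_invariant by (auto simp: Inv_def)

lemma S_Inv:
  assumes p: "p \<in> {s'+1..s}"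
  shows "S p \<in> Inv n s \<gamma> \<Omega>"
proof -
  have "S p (coad n s \<gamma> B x) = S p x" if "B \<in> tri_group n s \<gamma>" "x \<in> \<Omega>" for B x
    by (rule second_kind_coad[OF adm that(1)])
      (use p reduced_rest[OF red p] minor_nonzero[OF that(2) p] in auto)
  then show ?thesis
    using smooth_gen_smooth_on[OF open_\<Omega> smooth_gen_S[OF p]] by (auto simp: Inv_def)
qed

text \<open>Logarithmic differentiation. It expresses the differential by those of the minors, whose
  independence is known.\<close>

lemma partial_deriv_F:
  assumes k: "k \<in> K" and y: "y \<in> \<Omega>" "\<And>k. k \<in> {1..n div 2} \<Longrightarrow> minor n y k \<noteq> 0" and c: "c \<in> basis_idx n s"
  shows "partial_deriv c (F k) y = F k y * (partial_deriv c (\<lambda>x. minor n x k) y / minor n y k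
    + (\<Sum>q=1..s'. beta n \<gamma> s' ks q k * partial_deriv c (\<lambda>x. minor n x (ks q)) y / minor n y (ks q)))"
  unfolding partial_deriv_def[of c "F k"]
proof (rule DERIV_imp_deriv)
  let ?d = "\<lambda>k. partial_deriv c (\<lambda>x. minor n x k) y" and ?\<beta> = "\<lambda>q. beta n \<gamma> s' ks q k"
  have D: "((\<lambda>t. minor n (y(c := t)) k) has_field_derivative ?d k) (at (y c))" if "k \<le> n div 2" for k
    using smooth_gen_has_partial_deriv[OF smooth_gen_minor[OF that] y(1) c] .
  \<comment> \<open>The points are kept as \<open>y(c := y c)\<close> to match the form produced by
    the product rule; \<open>fun_upd_triv\<close> removes them at the end.\<close>
  have P: "((\<lambda>t. \<Prod>q=1..s'. pw (minor n (y(c := t)) (ks q)) (?\<beta> q)) has_field_derivative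
      (\<Prod>q=1..s'. pw (minor n (y(c := y c)) (ks q)) (?\<beta> q)) * (\<Sum>q=1..s'. ?\<beta> q * ?d (ks q) / minor n y (ks q))) (at (y c))"
  proof (rule DERIV_prod_log)
    fix q assume q: "q \<in> {1..s'}"
    have kq: "ks q \<in> {1..n div 2}" using reduced_ks(1)[OF red q] .
    have "((\<lambda>t. pw (minor n (y(c := t)) (ks q)) (?\<beta> q)) has_field_derivative
        (?\<beta> q * pw (minor n (y(c := y c)) (ks q)) (?\<beta> q) / minor n (y(c := y c)) (ks q)) * ?d (ks q)) (at (y c))"
      by (rule DERIV_chain2[where f = "\<lambda>z. pw z (?\<beta> q)"])
        (use pw_deriv ok_minor[OF y(1) k q] y(2)[OF kq] D[of "ks q"] kq in auto)
    then show "((\<lambda>t. pw (minor n (y(c := t)) (ks q)) (?\<beta> q)) has_field_derivative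
        pw (minor n (y(c := y c)) (ks q)) (?\<beta> q) * (?\<beta> q * ?d (ks q) / minor n y (ks q))) (at (y c))"
      by (simp add: mult_ac)
  qed simp
  have M: "minor n y k \<noteq> 0" using y(2) k by auto
  have eq: "d * P + (P * T) * minor n y k = minor n y k * P * (d / minor n y k + T)" for d P T
    using M by (simp add: field_simps)
  have "((\<lambda>t. F k (y(c := t))) has_field_derivative
      ?d k * (\<Prod>q=1..s'. pw (minor n (y(c := y c)) (ks q)) (?\<beta> q))
      + ((\<Prod>q=1..s'. pw (minor n (y(c := y c)) (ks q)) (?\<beta> q)) * (\<Sum>q=1..s'. ?\<beta> q * ?d (ks q) / minor n y (ks q)))
        * minor n (y(c := y c)) k) (at (y c))"
    unfolding first_kind_def by (rule DERIV_mult[OF D P]) (use k in auto)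
  then show "((\<lambda>t. F k (y(c := t))) has_field_derivative
      F k y * (?d k / minor n y k + (\<Sum>q=1..s'. ?\<beta> q * ?d (ks q) / minor n y (ks q)))) (at (y c))"
    unfolding fun_upd_triv eq first_kind_def .
qed

text \<open>Indexing by a disjoint sum allows linear relations to be discussed before the
  expressions are known to be distinct functions.\<close>

definition "fam = case_sum F S"
definition "I = Inl ` K \<union> Inr ` {s'+1..s}"

lemma finite_I: "finite I" by (simp add: I_def)

lemma sum_I: "(\<Sum>i\<in>I. f i) = (\<Sum>k\<in>K. f (Inl k)) + (\<Sum>p=s'+1..s. f (Inr p))"
  unfolding I_def by (subst sum.union_disjoint) (auto simp: sum.reindex)

text \<open>The coordinate \<open>(p, 0)\<close> occurs only in the second kind with index
  \<open>p\<close>, so these coefficients vanish first. The remaining relation becomes a relation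
  between the differentials of the minors.\<close>

lemma fam_independent:
  assumes y: "y \<in> \<Omega>" "\<And>k. k \<in> {1..n div 2} \<Longrightarrow> minor n y k \<noteq> 0"
    and 0: "\<forall>c\<in>basis_idx n s. (\<Sum>i\<in>I. a i * partial_deriv c (fam i) y) = 0"
  shows "\<forall>i\<in>I. a i = 0"
proof -
  let ?d = "\<lambda>c k. partial_deriv c (\<lambda>x. minor n x k) y"
  have ks: "ks q \<in> {1..n div 2}" if "q \<in> {1..s'}" for q using reduced_ks(1)[OF red that] .
  have aS: "a (Inr p) = 0" if p: "p \<in> {s'+1..s}" for p
  proof -
    have c: "(p, 0) \<in> basis_idx n s" using p by (auto simp: basis_idx_def)
    have "?d (p, 0) k = 0" if "k \<le> n div 2" for k using that by (intro partial_deriv_minor_0) auto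
    then have "partial_deriv (p, 0) (F k) y = 0" if "k \<in> K" for k
      using partial_deriv_F[OF that y c] that ks by simp
    moreover have "partial_deriv (p, 0) (S p') y = (if p' = p then 1 else 0)" for p'
    proof -
      have "Xmat n (y((p, 0) := t)) = Xmat n y" for t by (rule eq_matI) (auto simp: Xmat_def)
      then have "S p' (y((p, 0) := t)) = (if p' = p then t else y (p', 0)) + (S p' y - y (p', 0))" for t
        by (simp add: second_kind_def minor_def)
      then show ?thesis
        unfolding partial_deriv_def by (intro DERIV_imp_deriv) (auto intro!: derivative_eq_intros)
    qed
    ultimately have "(\<Sum>i\<in>I. a i * partial_deriv (p, 0) (fam i) y) = a (Inr p)"
      using p by (simp add: sum_I fam_def if_distrib[of "\<lambda>x. _ * x"] cong: if_cong)
    then show ?thesis using 0 c by simp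
  qed
  have Fnz: "F k y \<noteq> 0" if "k \<in> K" for k
  proof -
    have "pw (minor n y (ks q)) (beta n \<gamma> s' ks q k) \<noteq> 0" if q: "q \<in> {1..s'}" for q
      using pw_nonzero[OF ok_minor[OF y(1) \<open>k \<in> K\<close> q] y(2)[OF ks[OF q]]] .
    then show ?thesis using y(2) that by (simp add: first_kind_def)
  qed
  \<comment> \<open>The coefficient of the differential of the \<open>j\<close>-th minor. For
    \<open>j\<close> in \<open>K\<close> only \<open>F j\<close> contributes; for
    \<open>j = ks q\<close> every \<open>F k\<close> contributes through its exponent, and
    \<open>inv_into\<close> recovers \<open>q\<close>.\<close>
  define b where "b j = (if j \<in> K then a (Inl j) * F j y / minor n y j
    else (\<Sum>k\<in>K. a (Inl k) * F k y * beta n \<gamma> s' ks (inv_into {1..s'} ks j) k) / minor n y j)" for j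
  have bks: "b (ks q) = (\<Sum>k\<in>K. a (Inl k) * F k y * beta n \<gamma> s' ks q k) / minor n y (ks q)" if q: "q \<in> {1..s'}" for q
    using q inv_into_f_f[OF reduced_ks(2)[OF red] q] by (simp add: b_def)
  have "(\<Sum>j=1..n div 2. b j * ?d c j) = 0" if c: "c \<in> basis_idx n s" for c
  proof -
    have split: "{1..n div 2} = K \<union> ks ` {1..s'}" using ks by auto
    have "(\<Sum>j=1..n div 2. b j * ?d c j) = (\<Sum>j\<in>K. b j * ?d c j) + (\<Sum>j\<in>ks ` {1..s'}. b j * ?d c j)"
      by (subst split, rule sum.union_disjoint) auto
    also have "(\<Sum>j\<in>ks ` {1..s'}. b j * ?d c j) = (\<Sum>q=1..s'. b (ks q) * ?d c (ks q))"
      by (rule sum.reindex[OF reduced_ks(2)[OF red], unfolded o_def])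
    also have "\<dots> = (\<Sum>q=1..s'. \<Sum>k\<in>K. a (Inl k) * F k y * (beta n \<gamma> s' ks q k * ?d c (ks q) / minor n y (ks q)))"
    proof (rule sum.cong[OF refl])
      fix q assume q: "q \<in> {1..s'}"
      show "b (ks q) * ?d c (ks q)
          = (\<Sum>k\<in>K. a (Inl k) * F k y * (beta n \<gamma> s' ks q k * ?d c (ks q) / minor n y (ks q)))"
        unfolding bks[OF q] by (simp add: sum_divide_distrib sum_distrib_left sum_distrib_right mult_ac)
    qed
    also have "\<dots> = (\<Sum>k\<in>K. \<Sum>q=1..s'. a (Inl k) * F k y * (beta n \<gamma> s' ks q k * ?d c (ks q) / minor n y (ks q)))"
      by (rule sum.swap)
    also have "(\<Sum>j\<in>K. b j * ?d c j) + \<dots> = (\<Sum>k\<in>K. a (Inl k) * partial_deriv c (F k) y)"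
      unfolding sum.distrib[symmetric]
    proof (rule sum.cong[OF refl])
      fix k assume k: "k \<in> K"
      show "b k * ?d c k + (\<Sum>q=1..s'. a (Inl k) * F k y * (beta n \<gamma> s' ks q k * ?d c (ks q) / minor n y (ks q)))
          = a (Inl k) * partial_deriv c (F k) y"
      proof -
        have "b k * ?d c k = a (Inl k) * F k y * (?d c k / minor n y k)" using k by (simp add: b_def)
        then show ?thesis
          by (simp only: partial_deriv_F[OF k y c] distrib_left sum_distrib_left mult.assoc)
      qed
    qed
    also have "\<dots> = (\<Sum>i\<in>I. a i * partial_deriv c (fam i) y)"
      using aS by (simp add: sum_I fam_def)
    finally show ?thesis using 0 c by simp
  qed
  then have "b k = 0" if "k \<in> {1..n div 2}" for k
    using minors_independent[OF y(2), of s b k] that by blast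
  then have "a (Inl k) = 0" if "k \<in> K" for k
    using that Fnz[OF that] y(2)[of k] by (fastforce simp: b_def)
  then show ?thesis using aS by (auto simp: I_def)
qed

section \<open>Generic points and the number of invariants\<close>

lemma generic_dense: "\<Omega> \<subseteq> closure {x \<in> \<Omega>. \<forall>k\<in>{1..n div 2}. minor n x k \<noteq> 0}"
proof
  fix x assume x: "x \<in> \<Omega>"
  show "x \<in> closure {x \<in> \<Omega>. \<forall>k\<in>{1..n div 2}. minor n x k \<noteq> 0}"
    unfolding closure_iff_nhds_not_empty
  proof (intro allI impI)
    fix A V assume V: "V \<subseteq> A" "open V" "x \<in> V"
    have "openin (top_of_set (coord_space n s)) (V \<inter> \<Omega>)"
      using open_\<Omega> V(2) by (metis inf_commute openin_Int_open)
    moreover have "V \<inter> \<Omega> \<noteq> {}" using V x by blast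
    ultimately obtain y where "y \<in> V \<inter> \<Omega>" "\<forall>k\<in>{1..n div 2}. minor n y k \<noteq> 0"
      using minors_nonzero_dense[of n s "V \<inter> \<Omega>" "n div 2"] by blast
    then show "{x \<in> \<Omega>. \<forall>k\<in>{1..n div 2}. minor n x k \<noteq> 0} \<inter> A \<noteq> {}" using V(1) by blast
  qed
qed

lemma generic_point: "\<exists>y\<in>\<Omega>. \<forall>k\<in>{1..n div 2}. minor n y k \<noteq> 0"
proof (rule minors_nonzero_dense[OF open_\<Omega>])
  show "\<Omega> \<noteq> {}" using reg unfolding regular_nbhd_def by blast
qed simp

lemma fam_Inv: "i \<in> I \<Longrightarrow> fam i \<in> Inv n s \<gamma> \<Omega>"
  using F_Inv S_Inv by (auto simp: I_def fam_def)

lemma smooth_gen_fam: "i \<in> I \<Longrightarrow> smooth_gen n s \<Omega> (fam i)"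
  using smooth_gen_F smooth_gen_S by (auto simp: I_def fam_def)

text \<open>For small times the orbit curve with velocity \<open>v\<close> stays in
  \<open>\<Omega>\<close>, where the invariant is constant along it. The chain rule evaluates the
  same derivative as the pairing of the differential with \<open>v\<close>.\<close>

lemma fam_annihilates_tangent:
  assumes i: "i \<in> I" and y: "y \<in> \<Omega>" and v: "v \<in> orbit_tangent n s \<gamma> y"
  shows "(\<Sum>c\<in>basis_idx n s. partial_deriv c (fam i) y * v c) = 0"
proof -
  obtain u where u: "\<And>c. ((\<lambda>t. coad n s \<gamma> (group_param n s \<gamma> (\<lambda>d. t * u d)) y c) has_field_derivative v c) (at 0)"
    using v unfolding orbit_tangent_def by blast
  define \<xi> where "\<xi> t = coad n s \<gamma> (group_param n s \<gamma> (\<lambda>d. t * u d)) y" for t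
  have \<xi>0: "\<xi> 0 = y"
    using coad_one[OF adm \<Omega>_coord_space[OF y]] by (simp add: \<xi>_def group_param_0)
  have D: "((\<lambda>t. fam i (\<xi> t)) has_field_derivative (\<Sum>c\<in>basis_idx n s. partial_deriv c (fam i) y * v c)) (at 0)"
    by (rule smooth_gen_curve_deriv[where F = "fam i" and \<xi> = \<xi> and v = v, OF smooth_gen_fam[OF i] y \<xi>0]) (use u in \<open>simp add: \<xi>_def\<close>)
  have "\<forall>\<^sub>F t in nhds 0. \<xi> t \<in> \<Omega>"
  proof (rule eventually_curve_in_open[OF open_\<Omega>])
    show "\<xi> 0 \<in> \<Omega>" using \<xi>0 y by simp
    show "isCont (\<lambda>t. \<xi> t c) 0" for c using DERIV_isCont[OF u[of c]] by (simp add: \<xi>_def)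
  qed (simp add: \<xi>_def coad_in_coord_space)
  then have ev: "\<forall>\<^sub>F t in nhds 0. fam i (\<xi> t) = fam i y"
  proof eventually_elim
    case (elim t)
    then show ?case
      using fam_Inv[OF i] y group_param_tri_group unfolding Inv_def \<xi>_def by blast
  qed
  have "((\<lambda>t. fam i y) has_field_derivative (\<Sum>c\<in>basis_idx n s. partial_deriv c (fam i) y * v c)) (at 0)"
    by (rule DERIV_cong_ev[OF refl ev refl, THEN iffD1, OF D])
  then show ?thesis using DERIV_unique DERIV_const by blast
qed

text \<open>A basis is a set with a prescribed cardinality, so coincidences must be excluded. Two
  equal members would satisfy the relation with coefficients 1 and -1 at a generic point.\<close>

lemma fam_inj: "inj_on fam I"
proof (rule inj_onI, rule ccontr)
  fix i j assume ij: "i \<in> I" "j \<in> I" "fam i = fam j" "i \<noteq> j"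
  obtain y where y: "y \<in> \<Omega>" "\<And>k. k \<in> {1..n div 2} \<Longrightarrow> minor n y k \<noteq> 0"
    using generic_point by blast
  define a :: "nat + nat \<Rightarrow> 'a" where "a k = (if k = i then 1 else if k = j then - 1 else 0)" for k
  have "(\<Sum>k\<in>I. a k * partial_deriv c (fam k) y) = 0" for c
  proof -
    have "(\<Sum>k\<in>I. a k * partial_deriv c (fam k) y) = (\<Sum>k\<in>{i, j}. a k * partial_deriv c (fam k) y)"
      using finite_I ij by (intro sum.mono_neutral_right) (auto simp: a_def)
    then show ?thesis using ij by (simp add: a_def)
  qed
  then have "a i = 0" using fam_independent[OF y] ij(1) by blast
  then show False by (simp add: a_def)
qed

lemma Inv_basis_reduced: "Inv_basis n s \<gamma> \<Omega> (F ` K \<union> S ` {s'+1..s})"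
proof -
  have Fs: "F ` K \<union> S ` {s'+1..s} = fam ` I"
    by (simp add: I_def fam_def image_Un image_image)
  \<comment> \<open>One coordinate for each expression; the lower bound for the rank leaves out
    exactly these.\<close>
  let ?R = "(\<lambda>k. (n - k + 1, k)) ` K \<union> (\<lambda>p. (p, 0)) ` {s'+1..s}"
  have R: "?R \<subseteq> basis_idx n s" by (auto simp: basis_idx_def)
  have "card ?R = card K + card {s'+1..s}"
    by (subst card_Un_disjoint) (auto simp: card_image inj_on_def)
  moreover have "card I = card K + card {s'+1..s}"
    unfolding I_def by (subst card_Un_disjoint) (auto simp: card_image)
  ultimately have cR: "card ?R = card I" by simp
  have "card (basis_idx n s) - card I \<le> coad_rank n s \<gamma>"
    using coad_rank_lower[OF adm red] R cR by (simp add: card_Diff_subset)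
  moreover obtain x where x: "x \<in> \<Omega>" "orbit_dim n s \<gamma> x = coad_rank n s \<gamma>"
    using reg by (auto simp: regular_nbhd_def)
  obtain y where y: "y \<in> \<Omega>" "\<And>k. k \<in> {1..n div 2} \<Longrightarrow> minor n y k \<noteq> 0"
    using generic_point by blast
  have "fun_dim (orbit_tangent n s \<gamma> y) + card I \<le> card (basis_idx n s)"
    by (rule fun_dim_annihilated[OF orbit_tangent_subset finite_I, where \<Lambda> = "\<lambda>i c. partial_deriv c (fam i) y"])
      (use fam_annihilates_tangent[OF _ y(1)] fam_independent[OF y] in auto)
  \<comment> \<open>\<open>\<Omega>\<close> contains a point of a regular orbit and orbit dimensions
    are constant on \<open>\<Omega>\<close>, so the generic point \<open>y\<close> lies on a regular
    orbit too.\<close>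
  moreover have "fun_dim (orbit_tangent n s \<gamma> y) = coad_rank n s \<gamma>"
    using reg x y(1) unfolding regular_nbhd_def acts_regularly_def orbit_dim_def by metis
  ultimately have card: "card I = card (basis_idx n s) - coad_rank n s \<gamma>" by linarith
  have "{x \<in> \<Omega>. \<forall>k\<in>{1..n div 2}. minor n x k \<noteq> 0} \<subseteq> {x \<in> \<Omega>. indep_diff_at n s (fam ` I) x}"
  proof clarify
    fix y assume y: "y \<in> \<Omega>" "\<forall>k\<in>{1..n div 2}. minor n y k \<noteq> 0"
    show "indep_diff_at n s (fam ` I) y"
      unfolding indep_diff_at_def sum.reindex[OF fam_inj] o_def
    proof (intro allI impI)
      fix a assume 0: "\<forall>c\<in>basis_idx n s. (\<Sum>i\<in>I. a (fam i) * partial_deriv c (fam i) y) = 0"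
      have "\<forall>i\<in>I. a (fam i) = 0"
        by (rule fam_independent[OF y(1) _ 0]) (use y(2) in blast)
      then show "\<forall>F\<in>fam ` I. a F = 0" by blast
    qed
  qed
  then have "functionally_independent n s \<Omega> (fam ` I)"
    unfolding functionally_independent_def using generic_dense closure_mono by blast
  then show ?thesis
    unfolding Inv_basis_def Fs using finite_I fam_Inv card by (auto simp: card_image[OF fam_inj])
qed

end

end

section \<open>Real and complex powers\<close>

text \<open>Besides the quotient \<open>m / d\<close>, the value depends on the fraction only
  through the parity of \<open>m\<close>.\<close>

lemma root_powi_eq:
  assumes "odd d" "a \<noteq> 0"
  shows "root d a powi m = (if a < 0 \<and> odd m then - 1 else 1) * \<bar>a\<bar> powr (of_int m / of_nat d)"
proof -
  have d: "0 < d" using assms(1) by (cases d) auto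
  have pos: "root d c powi m = c powr (of_int m / of_nat d)" if "0 < c" for c
  proof -
    have "root d c powi m = (c powr (1 / d)) powr of_int m"
      using that d by (simp add: root_powr_inverse powr_real_of_int')
    then show ?thesis by (simp add: powr_powr)
  qed
  show ?thesis
  proof (cases "0 < a")
    case True
    then show ?thesis using pos by simp
  next
    case False
    then have "root d a powi m = (- root d (- a)) powi m" by (simp add: real_root_minus)
    also have "\<dots> = (if odd m then - 1 else 1) * root d (- a) powi m"
      by (simp add: power_int_minus_left)
    finally show ?thesis using pos[of "- a"] False assms(2) by simp
  qed
qed

text \<open>Equal fractions with odd denominators have numerators of equal parity, which makes the
  definite description in \<open>real_power\<close> unique. At base 0 only the vanishing of the
  numerator matters.\<close>

lemma real_power_fraction:
  assumes "odd d"
  shows "real_power a (of_int m / of_nat d) = root d a powi m"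
proof -
  let ?b = "of_int m / of_nat d :: real"
  have "root d' a powi m' = root d a powi m" if "odd d'" "?b = of_int m' / of_nat d'" for m' :: int and d' :: nat
  proof -
    have nz: "d \<noteq> 0" "d' \<noteq> 0" using odd_pos[OF assms] odd_pos[OF that(1)] by simp_all
    then have "(of_int (m * int d') :: real) = of_int (m' * int d)" using that(2) by (simp add: field_simps)
    then have eq: "m * int d' = m' * int d" by (simp only: of_int_eq_iff)
    show ?thesis
    proof (cases "a = 0")
      case True
      have "m = 0 \<longleftrightarrow> m' = 0" using eq nz by auto
      then show ?thesis by (simp add: True power_int_0_left_if)
    next
      case False
      have "odd m \<longleftrightarrow> odd m'" using arg_cong[OF eq, of even] assms that(1) by simp
      then show ?thesis
        unfolding root_powi_eq[OF assms False] root_powi_eq[OF that(1) False] that(2)[symmetric] by simp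
    qed
  qed
  then have "(THE y. \<exists>(m'::int) (d'::nat). odd d' \<and> ?b = of_int m' / of_nat d' \<and> y = root d' a powi m') = root d a powi m"
    using assms by (intro the_equality) blast+
  moreover have "\<exists>(m'::int) (d'::nat). odd d' \<and> ?b = of_int m' / of_nat d'" using assms by blast
  ultimately show ?thesis by (simp add: real_power_def)
qed

text \<open>On each half-line all variants of the power are a constant multiple of one function;
  \<open>\<sigma>\<close> is the constant for negative bases, so derivatives need no distinction of
  exponents.\<close>

lemma real_power_eq_powr:
  obtains \<sigma> where "\<sigma> \<noteq> 0" "\<And>a. a \<noteq> 0 \<Longrightarrow> real_power a b = (if a < 0 then \<sigma> else 1) * \<bar>a\<bar> powr b"
proof (cases "\<exists>(m::int) (d::nat). odd d \<and> b = of_int m / of_nat d")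
  case True
  then obtain m :: int and d :: nat where "odd d" "b = of_int m / of_nat d" by blast
  then show ?thesis
    using that[of "if odd m then - 1 else 1"] by (simp add: real_power_fraction root_powi_eq)
next
  case False
  then have "real_power a b = \<bar>a\<bar> powr b" for a by (simp only: real_power_def if_False)
  then show ?thesis using that[of 1] by simp
qed

lemma real_power_of_nat: "real_power a (of_nat j) = a ^ j"
  using real_power_fraction[of 1 a "int j"] by simp

lemma power_function_real_power: "power_function real_power real_power_ok 0"
proof
  fix a b e :: real and j :: nat
  show "real_power a (of_nat j) = a ^ j" by (rule real_power_of_nat)
  show "b \<in> \<nat>" if "real_power_ok 0 b" using that by (simp add: real_power_ok_def)
  obtain \<sigma> where \<sigma>: "\<sigma> \<noteq> 0" "\<And>a. a \<noteq> 0 \<Longrightarrow> real_power a b = (if a < 0 then \<sigma> else 1) * \<bar>a\<bar> powr b"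
    using real_power_eq_powr[of b] by blast
  show "real_power a b \<noteq> 0" if "a \<noteq> 0" using that \<sigma> by simp
  show "((\<lambda>z. real_power z b) has_field_derivative b * real_power a b / a) (at a)" if a: "a \<noteq> 0"
  proof (cases "0 < a")
    case True
    have "((\<lambda>z. z powr b) has_field_derivative b * real_power a b / a) (at a)"
      using True by (auto intro!: derivative_eq_intros simp: \<sigma>(2) powr_diff)
    then show ?thesis
      by (rule has_field_derivative_transform_within_open[where S = "{0<..}"]) (use True \<sigma>(2) in auto)
  next
    case False
    then have a': "a < 0" using a by simp
    have "((\<lambda>z. \<sigma> * (- z) powr b) has_field_derivative b * real_power a b / a) (at a)"
      using a' by (auto intro!: derivative_eq_intros simp: \<sigma>(2) powr_diff divide_simps)
    then show ?thesis
      by (rule has_field_derivative_transform_within_open[where S = "{..<0}"]) (use a' \<sigma>(2) in auto)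
  qed
  show "\<exists>m::int. real_power (a * exp e) b = real_power a b * exp (b * (e + of_int m * 0))"
    if "real_power_ok a b" "real_power_ok (a * exp e) b"
  proof (cases "a = 0")
    case True
    then have "b \<in> \<nat>" using that(1) by (simp add: real_power_ok_def)
    then obtain j where "b = of_nat j" by (rule Nats_cases)
    then have "real_power 0 b = 0 ^ j" "j = 0 \<longrightarrow> b = 0" by (simp_all add: real_power_of_nat)
    then show ?thesis using True by (cases j) auto
  next
    case False
    then have "real_power (a * exp e) b = real_power a b * exp (b * e)"
      by (simp add: \<sigma>(2) abs_mult powr_mult mult_less_0_iff) (simp add: powr_def)
    then show ?thesis by simp
  qed
qed

section \<open>Complex powers with a fixed branch of the logarithm\<close>

lemma branch_power_of_int: "branch_power L z (of_int m) = z powi m"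
proof -
  have "(THE k. (of_int m :: complex) = of_int k) = m" by (rule the_equality) auto
  then show ?thesis unfolding branch_power_def by auto
qed

lemma branch_power_non_int: "b \<notin> \<int> \<Longrightarrow> branch_power L z b = exp (b * L z)"
  by (auto simp: branch_power_def)

text \<open>A continuous branch is automatically holomorphic: it inverts \<open>exp\<close>, whose
  derivative at \<open>L z\<close> is the nonzero number \<open>z\<close>.\<close>

lemma log_branch_deriv:
  assumes "log_branch L D" "z \<in> D"
  shows "(L has_field_derivative inverse z) (at z)"
proof -
  have L: "open D" "continuous_on D L" "\<And>z. z \<in> D \<Longrightarrow> exp (L z) = z"
    using assms(1) by (auto simp: log_branch_def)
  have "z \<noteq> 0" using L(3)[OF assms(2)] by (metis exp_not_eq_zero)
  show ?thesis
    by (rule has_field_derivative_inverse_basic[where f = exp and t = D])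
      (use L assms(2) \<open>z \<noteq> 0\<close> DERIV_exp[of "L z"] in \<open>auto simp: continuous_on_eq_continuous_at\<close>)
qed

lemma power_function_branch_power:
  assumes L: "log_branch L D"
  shows "power_function (branch_power L) (branch_power_ok D) (2 * of_real pi * \<i>)"
proof
  fix a b e :: complex and j :: nat
  have expL: "exp (L z) = z" if "z \<in> D" for z using L that by (simp add: log_branch_def)
  then have D0: "0 \<notin> D" by (metis exp_not_eq_zero)
  \<comment> \<open>A non-integer exponent forces the base into \<open>D\<close>, so
    \<open>L\<close> is evaluated only where it is a logarithm.\<close>
  have ok: "a \<in> D" if "branch_power_ok D a b" "b \<notin> \<int>" for a
    using that Nats_subset_Ints by (auto simp: branch_power_ok_def)
  show "branch_power L a (of_nat j) = a ^ j"
    using branch_power_of_int[of L a "int j"] by simp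
  show "b \<in> \<nat>" if "branch_power_ok D 0 b" using that D0 by (simp add: branch_power_ok_def)
  show "branch_power L a b \<noteq> 0" if "branch_power_ok D a b" "a \<noteq> 0"
  proof (cases "b \<in> \<int>")
    case True
    then obtain m where "b = of_int m" by (auto elim: Ints_cases)
    then show ?thesis using that by (simp add: branch_power_of_int)
  qed (simp add: branch_power_non_int)
  show "((\<lambda>z. branch_power L z b) has_field_derivative b * branch_power L a b / a) (at a)"
    if "branch_power_ok D a b" "a \<noteq> 0"
  proof (cases "b \<in> \<int>")
    case True
    then obtain m where m: "b = of_int m" by (auto elim: Ints_cases)
    show ?thesis
      unfolding m branch_power_of_int using that(2)
      by (auto intro!: derivative_eq_intros simp: power_int_diff)
  next
    case False
    have "((\<lambda>z. exp (b * L z)) has_field_derivative exp (b * L a) * (b * inverse a)) (at a)"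
      by (intro DERIV_chain2[where f = exp] DERIV_exp DERIV_cmult log_branch_deriv[OF L ok[OF that(1) False]])
    then show ?thesis using False by (simp add: branch_power_non_int divide_inverse mult_ac)
  qed
  show "\<exists>m::int. branch_power L (a * exp e) b = branch_power L a b * exp (b * (e + of_int m * (2 * of_real pi * \<i>)))"
    if "branch_power_ok D a b" "branch_power_ok D (a * exp e) b"
  proof (cases "b \<in> \<int>")
    case True
    then obtain m where m: "b = of_int m" by (auto elim: Ints_cases)
    have "branch_power L (a * exp e) b = branch_power L a b * exp (b * (e + of_int 0 * (2 * of_real pi * \<i>)))"
      by (simp add: m branch_power_of_int power_int_mult_distrib exp_power_int)
    then show ?thesis by blast
  next
    case False
    \<comment> \<open>\<open>L (a * exp e)\<close> and \<open>L a + e\<close> are logarithms of the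
      same number, but \<open>a * exp e\<close> may lie on another turn around 0; they differ by an
      integer multiple of the period.\<close>
    have "exp (L (a * exp e)) = exp (L a + e)"
      using expL[OF ok[OF that(1) False]] expL[OF ok[OF that(2) False]] by (simp add: exp_add)
    then obtain m :: int where "L (a * exp e) = L a + e + (of_int (2 * m) * pi) * \<i>"
      unfolding exp_eq by blast
    then have "branch_power L (a * exp e) b = branch_power L a b * exp (b * (e + of_int m * (2 * of_real pi * \<i>)))"
      using False by (simp add: branch_power_non_int exp_add[symmetric] algebra_simps)
    then show ?thesis by blast
  qed
qed

theorem theorem7:
  fixes n s s' :: nat and ks :: "nat \<Rightarrow> nat"
  assumes "1 < n" and "s \<le> n - 1"
  shows
    "(\<forall>\<gamma> :: nat \<Rightarrow> nat \<Rightarrow> real.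
        admissible n s \<gamma> \<and> reduced_form n s \<gamma> s' ks \<longrightarrow>
        (\<forall>q\<in>{1..s'}. \<forall>k\<in>{1..n div 2}.
           alpha n \<gamma> q k = - (\<Sum>k'=ks q..k. \<gamma> q (n - k' + 1) - \<gamma> q k')) \<and>
        Delta n \<gamma> s' ks = (- 1) ^ s' \<and>
        (\<forall>\<Omega>. regular_nbhd n s \<gamma> \<Omega> \<and> \<Omega> \<subseteq> expr_domain real_power_ok n s \<gamma> s' ks \<longrightarrow>
           Inv_basis n s \<gamma> \<Omega>
             (first_kind real_power n \<gamma> s' ks ` ({1..n div 2} - ks ` {1..s'}) \<union>
              second_kind n \<gamma> ` {s'+1..s})))
     \<and>
     (\<forall>(\<gamma> :: nat \<Rightarrow> nat \<Rightarrow> complex) L D.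
        admissible n s \<gamma> \<and> reduced_form n s \<gamma> s' ks \<and> log_branch L D \<longrightarrow>
        (\<forall>q\<in>{1..s'}. \<forall>k\<in>{1..n div 2}.
           alpha n \<gamma> q k = - (\<Sum>k'=ks q..k. \<gamma> q (n - k' + 1) - \<gamma> q k')) \<and>
        Delta n \<gamma> s' ks = (- 1) ^ s' \<and>
        (\<forall>\<Omega>. regular_nbhd n s \<gamma> \<Omega> \<and> \<Omega> \<subseteq> expr_domain (branch_power_ok D) n s \<gamma> s' ks \<longrightarrow>
           Inv_basis n s \<gamma> \<Omega>
             (first_kind (branch_power L) n \<gamma> s' ks ` ({1..n div 2} - ks ` {1..s'}) \<union>
              second_kind n \<gamma> ` {s'+1..s})))"
proof (intro conjI allI impI ballI; (elim conjE)?)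
  fix \<gamma> :: "nat \<Rightarrow> nat \<Rightarrow> real" and q k \<Omega>
  assume adm: "admissible n s \<gamma>" and red: "reduced_form n s \<gamma> s' ks"
  show "Delta n \<gamma> s' ks = (- 1) ^ s'" by (rule Delta_eq[OF red])
  show "alpha n \<gamma> q k = - (\<Sum>k'=ks q..k. \<gamma> q (n - k' + 1) - \<gamma> q k')" if "q \<in> {1..s'}"
    by (rule alpha_from_ks[OF red that])
  show "Inv_basis n s \<gamma> \<Omega> (first_kind real_power n \<gamma> s' ks ` ({1..n div 2} - ks ` {1..s'}) \<union>
      second_kind n \<gamma> ` {s'+1..s})"
    if "regular_nbhd n s \<gamma> \<Omega>" "\<Omega> \<subseteq> expr_domain real_power_ok n s \<gamma> s' ks"
    by (rule power_function.Inv_basis_reduced[OF power_function_real_power adm red that])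
next
  fix \<gamma> :: "nat \<Rightarrow> nat \<Rightarrow> complex" and L D q k \<Omega>
  assume adm: "admissible n s \<gamma>" and red: "reduced_form n s \<gamma> s' ks" and L: "log_branch L D"
  show "Delta n \<gamma> s' ks = (- 1) ^ s'" by (rule Delta_eq[OF red])
  show "alpha n \<gamma> q k = - (\<Sum>k'=ks q..k. \<gamma> q (n - k' + 1) - \<gamma> q k')" if "q \<in> {1..s'}"
    by (rule alpha_from_ks[OF red that])
  show "Inv_basis n s \<gamma> \<Omega> (first_kind (branch_power L) n \<gamma> s' ks ` ({1..n div 2} - ks ` {1..s'}) \<union>
      second_kind n \<gamma> ` {s'+1..s})"
    if "regular_nbhd n s \<gamma> \<Omega>" "\<Omega> \<subseteq> expr_domain (branch_power_ok D) n s \<gamma> s' ks"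
    by (rule power_function.Inv_basis_reduced[OF power_function_branch_power[OF L] adm red that])
qed

end
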